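(* Let $X(t)$ be a Markov process on $\mathbb{R}^d$ whose operators $T(t)f(x)=E_x[f(X(t))]$, $t\ge0$, form a uniformly bounded, strongly continuous semigroup on $L^1(\mathbb{R}^d)$, with generator $L_x$. Let $Y_t$ be a one-dimensional Brownian motion started at $0$ with $\mathrm{Var}(Y_t)=2t$, independent of $X$. Let $D_t$ be the $1/2$-stable subordinator with $E[e^{-sD_t}]=e^{-ts^{1/2}}$, independent of $X$, and let $E_t=\inf\{x>0:D_x>t\}$ be its inverse. Then the processes $X(|Y_t|)$ and $X(E_t)$ have the same one-dimensional distributions. Hence both are stochastic solutions to the fractional Cauchy problem $$\frac{\partial^{1/2}}{\partial t^{1/2}}u(t,x)=L_xu(t,x),\qquad u(0,x)=f(x)\qquad(t>0,\ x\in\mathbb{R}^d),$$ or equivalently, to the higher order initial value problem $$\frac{\partial}{\partial t}u(t,x)=\frac{L_xf(x)}{\sqrt{\pi t}}+L_x^2u(t,x),\qquad u(0,x)=f(x)\qquad(t>0,\ x\in\mathbb{R}^d);$$ that is, for $Z_t=X(|Y_t|)$ and for $Z_t=X(E_t)$, and every $f\in D(L_x)$, the function $u(t,x)=E_x[f(Z_t)]$ solves both problems.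
   Context: $E_x$ denotes expectation given $X(0)=x$. Having the same one-dimensional distributions means: for each starting point $X(0)=x$ and each fixed $t\ge0$, $X(|Y_t|)$ and $X(E_t)$ have the same law. The stable subordinator $D_t$ is a Lévy process with $D_0=0$ and strictly increasing sample paths. The generator is $L_xf=\lim_{h\downarrow 0}h^{-1}(T(h)f-f)$ in $L^1(\mathbb{R}^d)$, with domain $D(L_x)$ the set of $f$ for which the limit exists; $L_x^2$ is $L_x$ applied twice. Solutions are understood as functions $t\mapsto u(t,\cdot)$ with values in $L^1(\mathbb{R}^d)$, continuous on $[0,\infty)$, with the equations holding in $L^1(\mathbb{R}^d)$ for $t>0$. The Caputo fractional derivative $\partial^\beta g(t)/\partial t^\beta$, $0<\beta<1$, is the function of $t>0$ whose Laplace transform is $s^\beta\tilde g(s)-s^{\beta-1}g(0)$, where $\tilde g(s)=\int_0^\infty e^{-st}g(t)\,dt$.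
   Formalization: The Markov process X is additionally assumed jointly measurable in time and outcome with respect to the sigma-algebra generated by X itself (as holds for right-continuous paths); without this, X(|Y_t|) and X(E_t) can have different laws. *)

theory Defs
  imports "HOL-Probability.Probability"
begin

text \<open>For \<open>f\<close> with \<open>integrable lborel f\<close>, \<open>abs_L1 f\<close> is the class of \<open>f\<close>; on other functions
  \<open>abs_L1\<close> has no meaning.\<close>

quotient_type (overloaded) 'a L1 = "'a::euclidean_space \<Rightarrow> real" /
  partial: "\<lambda>f g. integrable lborel f \<and> integrable lborel g \<and> (AE x in lborel. f x = g x)"
proof (rule part_equivpI)
  show "\<exists>f::'a \<Rightarrow> real. integrable lborel f \<and> integrable lborel f \<and> (AE x in lborel. f x = f x)"
    by (rule exI[of _ "\<lambda>_. 0"]) simp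
  show "symp (\<lambda>f g::'a \<Rightarrow> real. integrable lborel f \<and> integrable lborel g \<and> (AE x in lborel. f x = g x))"
    by (rule sympI) (auto simp: eq_commute)
  show "transp (\<lambda>f g::'a \<Rightarrow> real. integrable lborel f \<and> integrable lborel g \<and> (AE x in lborel. f x = g x))"
    by (rule transpI) (auto elim: AE_mp)
qed

instantiation L1 :: (euclidean_space) real_normed_vector
begin

lift_definition zero_L1 :: "'a L1" is "\<lambda>_. 0" by simp

lift_definition plus_L1 :: "'a L1 \<Rightarrow> 'a L1 \<Rightarrow> 'a L1" is "\<lambda>f g x. f x + g x"
  by (auto elim: AE_mp)

lift_definition minus_L1 :: "'a L1 \<Rightarrow> 'a L1 \<Rightarrow> 'a L1" is "\<lambda>f g x. f x - g x"
  by (auto elim: AE_mp)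

lift_definition uminus_L1 :: "'a L1 \<Rightarrow> 'a L1" is "\<lambda>f x. - f x"
  by auto

lift_definition scaleR_L1 :: "real \<Rightarrow> 'a L1 \<Rightarrow> 'a L1" is "\<lambda>c f x. c * f x"
  by (auto elim: AE_mp)

lift_definition norm_L1 :: "'a L1 \<Rightarrow> real" is "\<lambda>f. \<integral>x. \<bar>f x\<bar> \<partial>lborel"
  by (intro integral_cong_AE) (auto elim: AE_mp)

definition dist_L1 :: "'a L1 \<Rightarrow> 'a L1 \<Rightarrow> real" where
  "dist_L1 f g = norm (f - g)"

definition sgn_L1 :: "'a L1 \<Rightarrow> 'a L1" where
  "sgn_L1 f = inverse (norm f) *\<^sub>R f"

definition uniformity_L1 :: "('a L1 \<times> 'a L1) filter" where
  "uniformity_L1 = (INF e\<in>{0<..}. principal {(f, g). dist f g < e})"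

definition open_L1 :: "'a L1 set \<Rightarrow> bool" where
  "open_L1 U \<longleftrightarrow> (\<forall>f\<in>U. eventually (\<lambda>(f', g). f' = f \<longrightarrow> g \<in> U) uniformity)"

instance
proof
  fix f g h :: "'a L1" and a b :: real
  show "f + g + h = f + (g + h)" by transfer (auto simp: add.assoc)
  show "f + g = g + f" by transfer (auto simp: add.commute)
  show "0 + f = f" by transfer auto
  show "- f + f = 0" by transfer auto
  show "f - g = f + - g" by transfer auto
  show "a *\<^sub>R (f + g) = a *\<^sub>R f + a *\<^sub>R g" by transfer (auto simp: algebra_simps)
  show "(a + b) *\<^sub>R f = a *\<^sub>R f + b *\<^sub>R f" by transfer (auto simp: algebra_simps)
  show "a *\<^sub>R b *\<^sub>R f = (a * b) *\<^sub>R f" by transfer (auto simp: algebra_simps)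
  show "1 *\<^sub>R f = f" by transfer auto
  show "dist f g = norm (f - g)" by (rule dist_L1_def)
  show "sgn f = inverse (norm f) *\<^sub>R f" by (rule sgn_L1_def)
  show "uniformity = (INF e\<in>{0<..}. principal {(f, g::'a L1). dist f g < e})"
    by (rule uniformity_L1_def)
  show "open U = (\<forall>f\<in>U. eventually (\<lambda>(f', g). f' = f \<longrightarrow> g \<in> U) uniformity)" for U :: "'a L1 set"
    by (rule open_L1_def)
  show "(norm f = 0) = (f = 0)"
    by transfer (auto simp: integral_nonneg_eq_0_iff_AE)
  show "norm (f + g) \<le> norm f + norm g"
  proof transfer
    fix f g :: "'a \<Rightarrow> real"
    assume "integrable lborel f \<and> integrable lborel f \<and> (AE x in lborel. f x = f x)"
      and "integrable lborel g \<and> integrable lborel g \<and> (AE x in lborel. g x = g x)"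
    then have I: "integrable lborel f" "integrable lborel g" by auto
    then have "(\<integral>x. \<bar>f x + g x\<bar> \<partial>lborel) \<le> (\<integral>x. \<bar>f x\<bar> + \<bar>g x\<bar> \<partial>lborel)"
      by (intro integral_mono) (auto simp: abs_triangle_ineq)
    also have "\<dots> = (\<integral>x. \<bar>f x\<bar> \<partial>lborel) + (\<integral>x. \<bar>g x\<bar> \<partial>lborel)"
      using I by (intro Bochner_Integration.integral_add) auto
    finally show "(\<integral>x. \<bar>f x + g x\<bar> \<partial>lborel)
        \<le> (\<integral>x. \<bar>f x\<bar> \<partial>lborel) + (\<integral>x. \<bar>g x\<bar> \<partial>lborel)" .
  qed
  show "norm (a *\<^sub>R f) = \<bar>a\<bar> * norm f" by transfer (simp add: abs_mult)
qed

end

definition bounded_C0_semigroup :: "(real \<Rightarrow> 'b \<Rightarrow> 'b::real_normed_vector) \<Rightarrow> bool" where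
  "bounded_C0_semigroup T \<longleftrightarrow>
     (\<forall>t\<ge>0. bounded_linear (T t)) \<and>
     (\<forall>f. T 0 f = f) \<and>
     (\<forall>s\<ge>0. \<forall>t\<ge>0. \<forall>f. T (s + t) f = T s (T t f)) \<and>
     (\<exists>C. \<forall>t\<ge>0. \<forall>f. norm (T t f) \<le> C * norm f) \<and>
     (\<forall>f. ((\<lambda>t. T t f) \<longlongrightarrow> f) (at_right 0))"

definition generator_domain :: "(real \<Rightarrow> 'b \<Rightarrow> 'b::real_normed_vector) \<Rightarrow> 'b set" where
  "generator_domain T = {f. \<exists>g. ((\<lambda>h. (T h f - f) /\<^sub>R h) \<longlongrightarrow> g) (at_right 0)}"

definition generator :: "(real \<Rightarrow> 'b \<Rightarrow> 'b::real_normed_vector) \<Rightarrow> 'b \<Rightarrow> 'b" where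
  "generator T f = Lim (at_right 0) (\<lambda>h. (T h f - f) /\<^sub>R h)"

text \<open>A Laplace transform determines a function on the open half line only almost everywhere;
  continuity of \<open>h\<close> makes the Caputo derivative unique at every \<open>t > 0\<close>. Only large \<open>s\<close> are needed
  for this. The values of \<open>h\<close> at \<open>t \<le> 0\<close> are irrelevant.\<close>

definition has_caputo_derivative ::
    "real \<Rightarrow> (real \<Rightarrow> 'b::real_normed_vector) \<Rightarrow> (real \<Rightarrow> 'b) \<Rightarrow> bool" where
  "has_caputo_derivative \<beta> g h \<longleftrightarrow>
     continuous_on {0<..} h \<and>
     (\<forall>\<^sub>F s in at_top. \<exists>G.
        ((\<lambda>t. exp (- s * t) *\<^sub>R g t) has_integral G) {0..} \<and>
        ((\<lambda>t. exp (- s * t) *\<^sub>R h t) has_integral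
           (s powr \<beta> *\<^sub>R G - s powr (\<beta> - 1) *\<^sub>R g 0)) {0<..})"

definition solves_fractional_cauchy ::
    "real \<Rightarrow> (real \<Rightarrow> 'b \<Rightarrow> 'b::real_normed_vector) \<Rightarrow> 'b \<Rightarrow> (real \<Rightarrow> 'b) \<Rightarrow> bool" where
  "solves_fractional_cauchy \<beta> T f u \<longleftrightarrow>
     continuous_on {0..} u \<and> u 0 = f \<and>
     (\<forall>t>0. u t \<in> generator_domain T) \<and>
     has_caputo_derivative \<beta> u (\<lambda>t. generator T (u t))"

definition solves_higher_order ::
    "(real \<Rightarrow> 'b \<Rightarrow> 'b::real_normed_vector) \<Rightarrow> 'b \<Rightarrow> (real \<Rightarrow> 'b) \<Rightarrow> bool" where
  "solves_higher_order T f u \<longleftrightarrow>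
     continuous_on {0..} u \<and> u 0 = f \<and>
     (\<forall>t>0. u t \<in> generator_domain T \<and> generator T (u t) \<in> generator_domain T \<and>
        (u has_vector_derivative
           (generator T f /\<^sub>R sqrt (pi * t) + generator T (generator T (u t)))) (at t))"

text \<open>Pulling back along the path map gives the \<open>\<sigma>\<close>-algebra generated by all \<open>Z t\<close>, \<open>t \<in> I\<close>.\<close>

definition path_algebra ::
    "'w set \<Rightarrow> real set \<Rightarrow> (real \<Rightarrow> 'w \<Rightarrow> 'b::topological_space) \<Rightarrow> 'w measure" where
  "path_algebra \<Omega> I Z = vimage_algebra \<Omega> (\<lambda>\<omega>. \<lambda>t\<in>I. Z t \<omega>) (\<Pi>\<^sub>M t\<in>I. borel)"

definition independent_processes ::
    "'w measure \<Rightarrow> (real \<Rightarrow> 'w \<Rightarrow> 'b::topological_space) \<Rightarrow> (real \<Rightarrow> 'w \<Rightarrow> 'c::topological_space) \<Rightarrow> bool"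
  where
  "independent_processes M Z W \<longleftrightarrow>
     prob_space.indep_set M (sets (path_algebra (space M) {0..} Z))
                            (sets (path_algebra (space M) {0..} W))"

text \<open>A Markov process is a family of laws \<open>P x\<close>, \<open>x\<close> being the starting point, on one measurable
  space \<open>S\<close>. Joint measurability in \<open>(t, \<omega>)\<close>, which holds for instance for right-continuous paths,
  is what makes \<open>X\<close> at a random time a random variable. It is required with respect to the
  \<open>\<sigma>\<close>-algebra of \<open>X\<close> itself: with a larger one, independence of \<open>X\<close> and a random time would not
  determine the law of \<open>X\<close> at that time.\<close>

definition markov_process ::
    "'w measure \<Rightarrow> ('a::euclidean_space \<Rightarrow> 'w measure) \<Rightarrow> (real \<Rightarrow> 'w \<Rightarrow> 'a) \<Rightarrow> bool" where
  "markov_process S P X \<longleftrightarrow>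
     (\<forall>x. prob_space (P x) \<and> sets (P x) = sets S) \<and>
     (\<forall>t\<ge>0. X t \<in> S \<rightarrow>\<^sub>M borel) \<and>
     (\<lambda>(t, \<omega>). X t \<omega>) \<in>
        restrict_space borel {0..} \<Otimes>\<^sub>M path_algebra (space S) {0..} X \<rightarrow>\<^sub>M borel \<and>
     (\<forall>x. AE \<omega> in P x. X 0 \<omega> = x) \<and>
     (\<forall>t\<ge>0. \<forall>A\<in>sets borel.
        (\<lambda>x. measure (P x) (X t -` A \<inter> space S)) \<in> borel_measurable borel) \<and>
     (\<forall>x. \<forall>s\<ge>0. \<forall>t\<ge>0. \<forall>A\<in>sets borel.
        AE \<omega> in P x.
          real_cond_exp (P x) (path_algebra (space S) {0..s} X)
            (indicator (X (s + t) -` A \<inter> space S)) \<omega> =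
          measure (P (X s \<omega>)) (X t -` A \<inter> space S))"

definition expect_at ::
    "('a \<Rightarrow> 'w measure) \<Rightarrow> ('w \<Rightarrow> 'a) \<Rightarrow> ('a \<Rightarrow> real) \<Rightarrow> 'a \<Rightarrow> real" where
  "expect_at P Z f x = (\<integral>\<omega>. f (Z \<omega>) \<partial>P x)"

definition expect_in_L1 ::
    "('a::euclidean_space \<Rightarrow> 'w measure) \<Rightarrow> ('w \<Rightarrow> 'a) \<Rightarrow> ('a \<Rightarrow> real) \<Rightarrow> bool" where
  "expect_in_L1 P Z f \<longleftrightarrow>
     (AE x in lborel. integrable (P x) (\<lambda>\<omega>. f (Z \<omega>))) \<and> integrable lborel (expect_at P Z f)"

definition transition_operators ::
    "('a::euclidean_space \<Rightarrow> 'w measure) \<Rightarrow> (real \<Rightarrow> 'w \<Rightarrow> 'a) \<Rightarrow> (real \<Rightarrow> 'a L1 \<Rightarrow> 'a L1) \<Rightarrow> bool"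
  where
  "transition_operators P X T \<longleftrightarrow>
     (\<forall>t\<ge>0. \<forall>f. integrable lborel f \<longrightarrow>
        expect_in_L1 P (X t) f \<and> T t (abs_L1 f) = abs_L1 (expect_at P (X t) f))"

definition independent_increments :: "'w measure \<Rightarrow> (real \<Rightarrow> 'w \<Rightarrow> real) \<Rightarrow> bool" where
  "independent_increments M Z \<longleftrightarrow>
     (\<forall>n (\<tau> :: nat \<Rightarrow> real). 0 \<le> \<tau> 0 \<and> (\<forall>i<n. \<tau> i \<le> \<tau> (Suc i)) \<longrightarrow>
        prob_space.indep_vars M (\<lambda>_. borel) (\<lambda>i \<omega>. Z (\<tau> (Suc i)) \<omega> - Z (\<tau> i) \<omega>) {..<n})"

text \<open>Brownian motion started at \<open>0\<close> with \<open>Var (Y t) = v * t\<close>.\<close>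

definition brownian_motion :: "'w measure \<Rightarrow> real \<Rightarrow> (real \<Rightarrow> 'w \<Rightarrow> real) \<Rightarrow> bool" where
  "brownian_motion M v Y \<longleftrightarrow>
     prob_space M \<and>
     (\<forall>t\<ge>0. Y t \<in> borel_measurable M) \<and>
     (AE \<omega> in M. Y 0 \<omega> = 0) \<and>
     independent_increments M Y \<and>
     (\<forall>s\<ge>0. \<forall>t>s. distributed M lborel (\<lambda>\<omega>. Y t \<omega> - Y s \<omega>)
        (normal_density 0 (sqrt (v * (t - s))))) \<and>
     (AE \<omega> in M. continuous_on {0..} (\<lambda>t. Y t \<omega>))"

definition levy_process :: "'w measure \<Rightarrow> (real \<Rightarrow> 'w \<Rightarrow> real) \<Rightarrow> bool" where
  "levy_process M D \<longleftrightarrow>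
     prob_space M \<and>
     (\<forall>t\<ge>0. D t \<in> borel_measurable M) \<and>
     (AE \<omega> in M. D 0 \<omega> = 0) \<and>
     independent_increments M D \<and>
     (\<forall>s\<ge>0. \<forall>t\<ge>0. distr M borel (\<lambda>\<omega>. D (s + t) \<omega> - D s \<omega>) = distr M borel (D t)) \<and>
     (AE \<omega> in M. (\<forall>t\<ge>0. continuous (at_right t) (\<lambda>r. D r \<omega>)) \<and>
                 (\<forall>t>0. \<exists>l. ((\<lambda>r. D r \<omega>) \<longlongrightarrow> l) (at_left t)))"

text \<open>Every path, not only almost every one, is strictly increasing; this makes the first passage
  times measurable without completing \<open>M\<close>.\<close>

definition stable_subordinator :: "'w measure \<Rightarrow> real \<Rightarrow> (real \<Rightarrow> 'w \<Rightarrow> real) \<Rightarrow> bool" where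
  "stable_subordinator M \<alpha> D \<longleftrightarrow>
     levy_process M D \<and>
     (\<forall>\<omega>\<in>space M. strict_mono_on {0..} (\<lambda>t. D t \<omega>)) \<and>
     (\<forall>t\<ge>0. \<forall>s>0. (\<integral>\<omega>. exp (- s * D t \<omega>) \<partial>M) = exp (- t * s powr \<alpha>))"

text \<open>\<open>Inf\<close> of the empty set of reals is an unspecified number; the convention \<open>0\<close> only concerns paths
  that are bounded by \<open>t\<close>, a null event for a stable subordinator.\<close>

definition inverse_process :: "(real \<Rightarrow> 'w \<Rightarrow> real) \<Rightarrow> real \<Rightarrow> 'w \<Rightarrow> real" where
  "inverse_process D t \<omega> = (if \<exists>x>0. D x \<omega> > t then Inf {x. x > 0 \<and> D x \<omega> > t} else 0)"

definition same_law ::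
    "'w measure \<Rightarrow> ('w \<Rightarrow> 'b::topological_space) \<Rightarrow> ('w \<Rightarrow> 'b) \<Rightarrow> bool" where
  "same_law M Z W \<longleftrightarrow> Z \<in> M \<rightarrow>\<^sub>M borel \<and> W \<in> M \<rightarrow>\<^sub>M borel \<and> distr M borel Z = distr M borel W"

end

theory Submission
  imports Defs
begin

text \<open>Both \<open>\<bar>Y\<^sub>t\<bar>\<close> and \<open>E\<^sub>t\<close> have the density \<open>p(t, s) = exp (- s\<^sup>2 / 4t) / sqrt (\<pi> t)\<close> on the half line: for
  \<open>E\<^sub>t\<close> this follows from \<open>{D\<^sub>a > t} \<subseteq> {E\<^sub>t \<le> a} \<subseteq> {D\<^sub>b > t}\<close> for \<open>a < b\<close>, once the Laplace transform has
  identified the density of \<open>D\<^sub>a\<close>. By independence the law of \<open>X\<close> at either time is the mixture of the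
  laws of \<open>X\<^sub>s\<close> with weight \<open>p(t, s) ds\<close>, so that \<open>u(t) = \<integral> p(t, s) T(s)f ds\<close>.

  Since \<open>p\<close> solves the heat equation, differentiating under the integral and integrating by parts
  twice give \<open>u' = \<integral> p\<^sub>s\<^sub>s T(s)f ds = Lf / sqrt (\<pi> t) + L\<^sup>2u\<close>; the boundary term at \<open>s = 0\<close> is the
  inhomogeneity. Since the Laplace transform of \<open>p(\<cdot>, s)\<close> at \<open>\<lambda>\<close> is \<open>exp (- s sqrt \<lambda>) / sqrt \<lambda>\<close>, that of \<open>u\<close>
  is the resolvent \<open>R(sqrt \<lambda>)f / sqrt \<lambda>\<close>, and \<open>L R(\<mu>)f = \<mu> R(\<mu>)f - f\<close> is the fractional equation.\<close>


section \<open>The Banach space of integrable functions\<close>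

text \<open>The formula for u mixes two kinds of integral. The expectation is computed at each
  starting point x, while T(s)f and its integral over s live in L1, where a gauge integral of
  vector-valued functions is used. The two are compared by testing with indicators of Borel sets:
  these functionals separate the points of L1 and turn every identity, the exchange of integrals in
  the Laplace transform included, into a scalar use of Fubini's theorem. Fubini over s and x needs
  the law of X(s) to be measurable jointly in s and x. Measurability in x is given only at one fixed
  time. The Markov property extends it to finitely many times, hence to the law of the whole path,
  and the joint measurability of X in time and path does the rest. The initial datum lies only in
  D(L). That u(t) lies in the domain of the square of L for t > 0 is a gain from the kernel:
  integration by parts moves one L onto p. The second boundary term is absent because p_s(t, 0) =
  0.\<close>

lemma norm_abs_L1: "integrable lborel f \<Longrightarrow> norm (abs_L1 f) = (\<integral>x. \<bar>f x\<bar> \<partial>lborel)"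
  by (rule norm_L1.abs_eq) simp

lemma diff_abs_L1:
  "integrable lborel f \<Longrightarrow> integrable lborel g \<Longrightarrow> abs_L1 f - abs_L1 g = abs_L1 (\<lambda>x. f x - g x)"
  by (rule minus_L1.abs_eq) auto

lemma add_abs_L1:
  "integrable lborel f \<Longrightarrow> integrable lborel g \<Longrightarrow> abs_L1 f + abs_L1 g = abs_L1 (\<lambda>x. f x + g x)"
  by (rule plus_L1.abs_eq) auto

lemma abs_L1_eqI:
  assumes "integrable lborel f" "integrable lborel g" "AE x in lborel. f x = g x"
  shows "abs_L1 f = abs_L1 g"
  using Quotient_rel[OF Quotient_L1, of f g] assms by auto

lemma integrable_rep_L1 [simp]: "integrable lborel (rep_L1 F)"
  using Quotient_rep_reflp[OF Quotient_L1, of F] by simp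

lemma abs_rep_L1 [simp]: "abs_L1 (rep_L1 F) = F"
  by (rule Quotient_abs_rep[OF Quotient_L1])

lemma rep_abs_L1_AE: "integrable lborel f \<Longrightarrow> AE x in lborel. rep_L1 (abs_L1 f) x = f x"
  using Quotient_rel[OF Quotient_L1, of "rep_L1 (abs_L1 f)" f] by simp

section \<open>Completeness of the space\<close>

lemma abs_L1_sum:
  fixes f :: "nat \<Rightarrow> 'a::euclidean_space \<Rightarrow> real"
  assumes "\<And>i. integrable lborel (f i)"
  shows "(\<Sum>i<n. abs_L1 (f i)) = abs_L1 (\<lambda>x. \<Sum>i<n. f i x)"
proof (induction n)
  case 0
  show ?case by (simp add: zero_L1.abs_eq)
next
  case (Suc n)
  then show ?case using assms by (simp add: add_abs_L1)
qed

text \<open>The Riesz-Fischer argument: the sum of the \<open>|f n|\<close> has a finite integral,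
  hence is finite almost everywhere, so the \<open>f n\<close> have a pointwise sum; the tails of
  the series of norms bound the L1 distance to it.\<close>

lemma summable_norm_imp_summable_L1:
  fixes F :: "nat \<Rightarrow> 'a::euclidean_space L1"
  assumes sm: "summable (\<lambda>n. norm (F n))"
  shows "summable F"
proof -
  define f where "f n = rep_L1 (F n)" for n
  have int: "integrable lborel (f n)" for n by (simp add: f_def)
  have F: "F n = abs_L1 (f n)" for n by (simp add: f_def)
  have nF: "norm (F n) = (\<integral>x. norm (f n x) \<partial>lborel)" for n
    by (simp add: F norm_abs_L1 int)
  have s2: "summable (\<lambda>n. \<integral>x. norm (f n x) \<partial>lborel)"
    using sm by (simp add: nF)
  have "(\<integral>\<^sup>+x. (\<Sum>n. ennreal (norm (f n x))) \<partial>lborel) = (\<Sum>n. \<integral>\<^sup>+x. ennreal (norm (f n x)) \<partial>lborel)"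
    using int by (intro nn_integral_suminf) auto
  also have "\<dots> = (\<Sum>n. ennreal (norm (F n)))"
    using int by (simp add: nF nn_integral_eq_integral)
  also have "\<dots> \<noteq> \<infinity>"
    using ennreal_suminf_neq_top[OF sm, OF norm_ge_zero] unfolding infinity_ennreal_def .
  finally have "AE x in lborel. (\<Sum>n. ennreal (norm (f n x))) \<noteq> \<infinity>"
    using int by (intro nn_integral_PInf_AE) auto
  then have ae: "AE x in lborel. summable (\<lambda>n. norm (f n x))"
    by eventually_elim (auto intro!: summable_suminf_not_top)
  have ae': "AE x in lborel. summable (\<lambda>i. norm (f (i + n) x))" for n
    using ae by eventually_elim (rule summable_ignore_initial_segment)
  have s2': "summable (\<lambda>i. \<integral>x. norm (f (i + n) x) \<partial>lborel)" for n
    using s2 by (subst summable_iff_shift)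
  have intS: "integrable lborel (\<lambda>x. \<Sum>i. f (i + n) x)" for n
    by (rule integrable_suminf[OF int ae' s2'])
  have "norm ((\<Sum>i<n. F i) - abs_L1 (\<lambda>x. \<Sum>i. f i x)) \<le> (\<Sum>i. norm (F (i + n)))" for n
  proof -
    have "norm ((\<Sum>i<n. F i) - abs_L1 (\<lambda>x. \<Sum>i. f i x))
        = (\<integral>x. \<bar>(\<Sum>i<n. f i x) - (\<Sum>i. f i x)\<bar> \<partial>lborel)"
      using intS[of 0] int by (simp add: F abs_L1_sum diff_abs_L1 norm_abs_L1)
    also have "\<dots> = (\<integral>x. norm (\<Sum>i. f (i + n) x) \<partial>lborel)"
    proof (rule integral_cong_AE)
      show "AE x in lborel. \<bar>(\<Sum>i<n. f i x) - (\<Sum>i. f i x)\<bar> = norm (\<Sum>i. f (i + n) x)"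
        using ae by eventually_elim
          (auto dest!: summable_rabs_cancel simp: suminf_split_initial_segment[where k=n])
    qed (use intS[of 0] intS[of n] int in auto)
    also have "\<dots> \<le> (\<integral>x. (\<Sum>i. norm (f (i + n) x)) \<partial>lborel)"
    proof (rule integral_mono_AE)
      show "integrable lborel (\<lambda>x. \<Sum>i. norm (f (i + n) x))"
        by (rule integrable_suminf) (use int ae'[of n] s2'[of n] in auto)
      show "AE x in lborel. norm (\<Sum>i. f (i + n) x) \<le> (\<Sum>i. norm (f (i + n) x))"
        using ae'[of n] by eventually_elim (rule summable_norm)
    qed (use intS[of n] in auto)
    also have "\<dots> = (\<Sum>i. norm (F (i + n)))"
      unfolding nF by (rule integral_suminf) (use int ae'[of n] s2'[of n] in auto)
    finally show ?thesis .
  qed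
  moreover have "(\<lambda>n. \<Sum>i. norm (F (i + n))) \<longlonglongrightarrow> 0"
    by (rule suminf_exist_split2[OF sm])
  ultimately have "(\<lambda>n. (\<Sum>i<n. F i) - abs_L1 (\<lambda>x. \<Sum>i. f i x)) \<longlonglongrightarrow> 0"
    by (rule Lim_null_comparison[OF always_eventually[OF allI]])
  then have "F sums abs_L1 (\<lambda>x. \<Sum>i. f i x)"
    unfolding sums_def by (rule LIM_zero_cancel)
  then show ?thesis by (rule sums_summable)
qed

lemma Cauchy_fast_subseq:
  fixes X :: "nat \<Rightarrow> 'b::real_normed_vector"
  assumes "Cauchy X"
  shows "\<exists>r. strict_mono r \<and> (\<forall>n. norm (X (r (Suc n)) - X (r n)) < (1/2)^n)"
proof -
  have "\<exists>M. \<forall>m\<ge>M. \<forall>n\<ge>M. norm (X m - X n) < (1/2)^k" for k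
    using assms by (intro CauchyD) auto
  then obtain M where M: "\<And>k m n. m \<ge> M k \<Longrightarrow> n \<ge> M k \<Longrightarrow> norm (X m - X n) < (1/2)^k"
    by metis
  \<comment> \<open>\<open>Suc k\<close> makes the indices increase; \<open>M (Suc n)\<close> puts
    the next index beyond the threshold for the next power of 1/2.\<close>
  define r where "r = rec_nat (M 0) (\<lambda>n k. max (Suc k) (M (Suc n)))"
  have r: "r (Suc n) > r n" "r n \<ge> M n" for n
    by (simp add: r_def, cases n) (auto simp: r_def)
  show ?thesis
  proof (intro exI[of _ r] conjI allI)
    show "strict_mono r" using r(1) by (rule strict_monoI_Suc)
    show "norm (X (r (Suc n)) - X (r n)) < (1/2)^n" for n
      using r(1)[of n] r(2)[of n] by (intro M) auto
  qed
qed

instance L1 :: (euclidean_space) banach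
proof
  fix X :: "nat \<Rightarrow> 'a L1"
  assume C: "Cauchy X"
  obtain r where r: "strict_mono r" and lt: "\<And>n. norm (X (r (Suc n)) - X (r n)) < (1/2)^n"
    using Cauchy_fast_subseq[OF C] by blast
  have "summable (\<lambda>n. norm (X (r (Suc n)) - X (r n)))"
    by (rule summable_comparison_test'[of "\<lambda>n. (1/2)^n"]) (use lt in \<open>auto intro: less_imp_le\<close>)
  then have "summable (\<lambda>n. X (r (Suc n)) - X (r n))"
    by (rule summable_norm_imp_summable_L1)
  then obtain S where "(\<lambda>n. X (r (Suc n)) - X (r n)) sums S" by (auto simp: summable_def)
  then have "(\<lambda>n. X (r n) - X (r 0)) \<longlonglongrightarrow> S"
    by (simp add: sums_def sum_lessThan_telescope[of "\<lambda>n. X (r n)"])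
  then have "(\<lambda>n. X (r n) - X (r 0) + X (r 0)) \<longlonglongrightarrow> S + X (r 0)"
    by (intro tendsto_add tendsto_const)
  then have lim: "(X \<circ> r) \<longlonglongrightarrow> S + X (r 0)" by (simp add: o_def)
  have "X \<longlonglongrightarrow> S + X (r 0)"
  proof (rule metric_LIMSEQ_I)
    fix e :: real assume "e > 0"
    then obtain M where M: "\<And>m n. m \<ge> M \<Longrightarrow> n \<ge> M \<Longrightarrow> dist (X m) (X n) < e / 2"
      using metric_CauchyD[OF C, of "e/2"] by auto
    obtain K where K: "\<And>n. n \<ge> K \<Longrightarrow> dist (X (r n)) (S + X (r 0)) < e / 2"
      using metric_LIMSEQ_D[OF lim, of "e/2"] \<open>e > 0\<close> by auto
    have "dist (X n) (S + X (r 0)) < e" if "n \<ge> M" for n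
    proof -
      let ?k = "max M K"
      have "r ?k \<ge> M" using seq_suble[OF r, of ?k] by linarith
      then have "dist (X n) (X (r ?k)) < e / 2" using M that by auto
      moreover have "dist (X (r ?k)) (S + X (r 0)) < e / 2" using K by auto
      ultimately show ?thesis using dist_triangle[of "X n" "S + X (r 0)" "X (r ?k)"] by linarith
    qed
    then show "\<exists>no. \<forall>n\<ge>no. dist (X n) (S + X (r 0)) < e" by blast
  qed
  then show "convergent X" by (auto simp: convergent_def)
qed

section \<open>A separating family of functionals\<close>

definition integral_over :: "'a::euclidean_space set \<Rightarrow> 'a L1 \<Rightarrow> real" where
  "integral_over A F = (\<integral>x. indicator A x * rep_L1 F x \<partial>lborel)"

lemma integral_over_abs_L1:
  assumes "A \<in> sets borel" "integrable lborel f"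
  shows "integral_over A (abs_L1 f) = (\<integral>x. indicator A x * f x \<partial>lborel)"
  unfolding integral_over_def
proof (rule integral_cong_AE)
  show "AE x in lborel. indicator A x * rep_L1 (abs_L1 f) x = indicator A x * f x"
    using rep_abs_L1_AE[OF assms(2)] by eventually_elim simp
  show "(\<lambda>x. indicator A x * rep_L1 (abs_L1 f) x) \<in> borel_measurable lborel"
    using borel_measurable_integrable[OF integrable_rep_L1] assms(1)
    by (intro borel_measurable_times borel_measurable_indicator) auto
qed (use assms in auto)

lemma bounded_linear_integral_over:
  assumes A: "A \<in> sets (borel :: 'a::euclidean_space measure)"
  shows "bounded_linear (integral_over A)"
proof (rule bounded_linear_intro[where K=1])
  have *: "integrable lborel (\<lambda>x. indicator A x * f x)" if "integrable lborel f" for f :: "'a \<Rightarrow> real"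
    using integrable_mult_indicator[OF _ that, of A] A by simp
  fix F G :: "'a L1" and c :: real
  have F: "F = abs_L1 (rep_L1 F)" and G: "G = abs_L1 (rep_L1 G)" by simp_all
  show "integral_over A (F + G) = integral_over A F + integral_over A G"
    apply (subst F, subst G)
    apply (subst add_abs_L1)
      apply (simp_all add: integral_over_abs_L1 A distrib_left *)
    apply (simp add: integral_over_def)
    done
  show "integral_over A (c *\<^sub>R F) = c *\<^sub>R integral_over A F"
    apply (subst F)
    apply (subst scaleR_L1.abs_eq)
     apply (simp_all add: integral_over_abs_L1 A mult.left_commute[of _ c])
    apply (simp add: integral_over_def)
    done
  have "\<bar>integral_over A F\<bar> \<le> (\<integral>x. \<bar>indicator A x * rep_L1 F x\<bar> \<partial>lborel)"
    unfolding integral_over_def by (rule integral_abs_bound)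
  also have "\<dots> \<le> (\<integral>x. \<bar>rep_L1 F x\<bar> \<partial>lborel)"
    by (rule integral_mono) (auto intro!: integrable_abs * simp: abs_mult mult_left_le_one_le)
  also have "\<dots> = norm F" by (subst (2) F) (simp only: norm_abs_L1 integrable_rep_L1)
  finally show "norm (integral_over A F) \<le> norm F * 1" by simp
qed

lemma integral_over_separates:
  assumes "\<And>A. A \<in> sets borel \<Longrightarrow> integral_over A F = integral_over A G"
  shows "F = G"
proof -
  have "AE x in lborel. rep_L1 F x = rep_L1 G x"
  proof (rule density_unique_real)
    fix A :: "'a set" assume "A \<in> sets lborel"
    then show "(\<integral>x\<in>A. rep_L1 F x \<partial>lborel) = (\<integral>x\<in>A. rep_L1 G x \<partial>lborel)"
      using assms[of A] by (simp add: integral_over_def set_lebesgue_integral_def)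
  qed auto
  then have "abs_L1 (rep_L1 F) = abs_L1 (rep_L1 G)"
    by (intro abs_L1_eqI) auto
  then show ?thesis by simp
qed

section \<open>The laws of the two random times\<close>

text \<open>The distribution function of the normal law with variance \<open>1/2\<close>, that is \<open>(1 + erf x) / 2\<close>.\<close>

definition gauss_cdf :: "real \<Rightarrow> real" where
  "gauss_cdf x = cdf std_normal_distribution (sqrt 2 * x)"

lemma std_normal_cdf_diff:
  assumes "x \<le> y"
  shows "cdf std_normal_distribution y = cdf std_normal_distribution x + integral {x..y} std_normal_density"
proof -
  interpret N: real_distribution std_normal_distribution by (rule real_dist_normal_dist)
  have int: "integrable lborel (\<lambda>z. indicator A z * std_normal_density z)" if "A \<in> sets borel" for A
    using that integrable_mult_indicator[of A lborel std_normal_density] by simp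
  have "measure std_normal_distribution {x<..y}
      = (\<integral>z. indicator {x<..y} z * std_normal_density z \<partial>lborel)"
    using int[of "{x<..y}"]
    by (simp add: measure_def emeasure_density nn_integral_eq_integral mult.commute flip: ennreal_indicator ennreal_mult')
  also have "\<dots> = (\<integral>z. indicator {x..y} z * std_normal_density z \<partial>lborel)"
    by (intro integral_cong_AE)
      (auto intro!: eventually_mono[OF AE_lborel_singleton[of x]] split: split_indicator)
  also have "\<dots> = integral {x..y} std_normal_density"
    using set_borel_integral_eq_integral(2)[of "{x..y}" std_normal_density] int[of "{x..y}"]
    by (simp add: set_lebesgue_integral_def set_integrable_def)
  finally show ?thesis
    using N.cdf_diff_eq[of x y] assms by (cases "x = y") auto
qed

lemma DERIV_std_normal_cdf:
  "(cdf std_normal_distribution has_real_derivative std_normal_density z) (at z)"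
proof -
  let ?I = "\<lambda>y. cdf std_normal_distribution (z - 1) + integral {z-1..y} std_normal_density"
  have cont: "continuous_on {z-1..z+1} std_normal_density"
    unfolding normal_density_def by (intro continuous_intros) auto
  have "((\<lambda>y. integral {z-1..y} std_normal_density) has_real_derivative std_normal_density z)
      (at z within {z-1..z+1})"
    by (rule integral_has_real_derivative[OF cont]) auto
  then have "((\<lambda>y. integral {z-1..y} std_normal_density) has_real_derivative std_normal_density z) (at z)"
    by (subst (asm) at_within_interior) auto
  then have "(?I has_real_derivative std_normal_density z) (at z)"
    by (auto intro!: derivative_eq_intros)
  then show ?thesis
    by (rule has_field_derivative_transform_within_open[of _ _ _ "{z-1<..<z+1}"])
      (auto simp flip: std_normal_cdf_diff)
qed

lemma DERIV_gauss_cdf [derivative_intros]: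
  assumes "(f has_real_derivative f') (at x within A)"
  shows "((\<lambda>x. gauss_cdf (f x)) has_real_derivative exp (- (f x)\<^sup>2) / sqrt pi * f') (at x within A)"
proof -
  have "(gauss_cdf has_real_derivative exp (- y\<^sup>2) / sqrt pi) (at y)" for y
  proof -
    have "((\<lambda>y. cdf std_normal_distribution (sqrt 2 * y)) has_real_derivative
        std_normal_density (sqrt 2 * y) * (sqrt 2 * 1)) (at y)"
      by (rule DERIV_chain2[OF DERIV_std_normal_cdf]) (intro DERIV_cmult DERIV_ident)
    then show ?thesis
      unfolding gauss_cdf_def[abs_def]
      by (simp add: normal_density_def real_sqrt_mult power_mult_distrib)
  qed
  from DERIV_chain2[OF this assms] show ?thesis .
qed

lemma isCont_gauss_cdf: "isCont gauss_cdf x"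
  by (rule DERIV_isCont[OF DERIV_gauss_cdf[OF DERIV_ident]])

lemma tendsto_gauss_cdf [tendsto_intros]:
  "(f \<longlongrightarrow> a) F \<Longrightarrow> ((\<lambda>x. gauss_cdf (f x)) \<longlongrightarrow> gauss_cdf a) F"
  by (rule isCont_tendsto_compose[OF isCont_gauss_cdf])

lemma gauss_cdf_at_top: "filterlim f at_top F \<Longrightarrow> ((\<lambda>x. gauss_cdf (f x)) \<longlongrightarrow> 1) F"
  unfolding gauss_cdf_def
  by (rule filterlim_compose[OF real_distribution.cdf_lim_at_top_prob[OF real_dist_normal_dist]])
    (simp add: filterlim_tendsto_pos_mult_at_top[OF tendsto_const])

lemma gauss_cdf_at_bot: "filterlim f at_bot F \<Longrightarrow> ((\<lambda>x. gauss_cdf (f x)) \<longlongrightarrow> 0) F"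
  unfolding gauss_cdf_def
  by (rule filterlim_compose[OF finite_borel_measure.cdf_lim_at_bot])
    (auto intro: real_distribution.finite_borel_measure_M[OF real_dist_normal_dist] simp: filterlim_tendsto_pos_mult_at_bot[OF tendsto_const])

text \<open>The derivative of \<open>gauss_cdf\<close> is even, so
  \<open>gauss_cdf x + gauss_cdf (- x)\<close> is constant; its limit at infinity is 1.\<close>

lemma gauss_cdf_minus: "gauss_cdf (- x) = 1 - gauss_cdf x"
proof -
  let ?g = "\<lambda>x. gauss_cdf x + gauss_cdf (- x)"
  have "\<forall>x. (?g has_real_derivative 0) (at x)"
    by (auto intro!: derivative_eq_intros)
  then have c: "?g x = ?g y" for x y by (rule DERIV_isconst_all)
  have "(?g \<longlongrightarrow> 1 + 0) at_top"
    by (intro tendsto_add gauss_cdf_at_top gauss_cdf_at_bot filterlim_ident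
        filterlim_uminus_at_bot_at_top)
  moreover have "?g = (\<lambda>_. ?g x)" using c by blast
  ultimately have "((\<lambda>_::real. ?g x) \<longlongrightarrow> 1 + 0) at_top" by (rule back_subst[of "\<lambda>f. (f \<longlongrightarrow> 1 + 0) at_top"])
  then have "?g x = 1" by (simp add: tendsto_const_iff)
  then show ?thesis by simp
qed

lemma gauss_cdf_0: "gauss_cdf 0 = 1/2"
  using gauss_cdf_minus[of 0] unfolding minus_zero by linarith

section \<open>Explicit primitives and the densities of the random times\<close>

text \<open>For a nonnegative integrand the existence of both limits of a primitive already gives
  absolute integrability, so each primitive found below yields integrability and value
  together.\<close>

lemma FTC_nonneg_Ioi:
  fixes f F :: "real \<Rightarrow> real"
  assumes "\<And>x. 0 < x \<Longrightarrow> DERIV F x :> f x" "\<And>x. 0 < x \<Longrightarrow> isCont f x" "\<And>x. 0 < x \<Longrightarrow> 0 \<le> f x"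
    and "(F \<longlongrightarrow> A) (at_right 0)" "(F \<longlongrightarrow> B) at_top"
  shows "set_integrable lborel {0<..} f" "(\<integral>x\<in>{0<..}. f x \<partial>lborel) = B - A"
proof -
  have e: "einterval 0 \<infinity> = {0<..}" by (auto simp: einterval_def zero_ereal_def)
  have 0: "((F \<circ> real_of_ereal) \<longlongrightarrow> A) (at_right 0)"
    using assms(4) by (simp add: zero_ereal_def ereal_tendsto_simps)
  have t: "((F \<circ> real_of_ereal) \<longlongrightarrow> B) (at_left \<infinity>)"
    using assms(5) by (simp add: ereal_tendsto_simps)
  note F = interval_integral_FTC_nonneg[of 0 \<infinity> F f, OF _ _ _ _ 0 t]
  show "set_integrable lborel {0<..} f" "(\<integral>x\<in>{0<..}. f x \<partial>lborel) = B - A"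
    using F assms by (auto simp: e interval_lebesgue_integral_def zero_ereal_def)
qed

lemma FTC_nonneg_Ioo:
  fixes f F :: "real \<Rightarrow> real"
  assumes "0 < T" "\<And>x. 0 < x \<Longrightarrow> DERIV F x :> f x" "\<And>x. 0 < x \<Longrightarrow> isCont f x" "\<And>x. 0 < x \<Longrightarrow> 0 \<le> f x"
    and "(F \<longlongrightarrow> A) (at_right 0)"
  shows "set_integrable lborel {0<..<T} f" "(\<integral>x\<in>{0<..<T}. f x \<partial>lborel) = F T - A"
proof -
  have e: "einterval 0 (ereal T) = {0<..<T}" by (auto simp: einterval_def zero_ereal_def)
  have 0: "((F \<circ> real_of_ereal) \<longlongrightarrow> A) (at_right 0)"
    using assms(5) by (simp add: zero_ereal_def ereal_tendsto_simps)
  have "(F \<longlongrightarrow> F T) (at_left T)"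
    using DERIV_isCont[OF assms(2)[OF assms(1)]] by (auto simp: isCont_def filterlim_at_split)
  then have t: "((F \<circ> real_of_ereal) \<longlongrightarrow> F T) (at_left (ereal T))"
    by (simp add: ereal_tendsto_simps)
  note F = interval_integral_FTC_nonneg[of 0 "ereal T" F f, OF _ _ _ _ 0 t]
  show "set_integrable lborel {0<..<T} f" "(\<integral>x\<in>{0<..<T}. f x \<partial>lborel) = F T - A"
    using F assms by (auto simp: e interval_lebesgue_integral_def zero_ereal_def)
qed

text \<open>As functions of their second argument, \<open>heat_kernel t\<close> is the density of \<open>\<bar>Y\<^sub>t\<bar>\<close> and
  \<open>hitting_density q\<close> that of \<open>D\<^sub>q\<close>.\<close>

definition heat_kernel :: "real \<Rightarrow> real \<Rightarrow> real" where
  "heat_kernel t s = exp (- s\<^sup>2 / (4 * t)) / sqrt (pi * t)"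

definition hitting_density :: "real \<Rightarrow> real \<Rightarrow> real" where
  "hitting_density q t = q / (2 * sqrt pi * t * sqrt t) * exp (- q\<^sup>2 / (4 * t))"

text \<open>Completing the square: twice the product of \<open>sqrt (s * t)\<close> and
  \<open>r / (2 * sqrt t)\<close> is \<open>r * sqrt s\<close>, free of \<open>t\<close>, and the
  exponential prefactor cancels it. The case \<open>s = 0\<close> is included because it gives the
  plain integral of \<open>hitting_density\<close>.\<close>

lemma gauss_exponent_split:
  fixes r s t :: real
  assumes "t > 0" "s \<ge> 0"
  shows "exp (r * sqrt s) * exp (- (sqrt (s * t) + r / (2 * sqrt t))\<^sup>2) = exp (- s * t) * exp (- r\<^sup>2 / (4 * t))"
    and "exp (- r * sqrt s) * exp (- (sqrt (s * t) - r / (2 * sqrt t))\<^sup>2) = exp (- s * t) * exp (- r\<^sup>2 / (4 * t))"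
proof -
  let ?a = "sqrt (s * t)" and ?b = "r / (2 * sqrt t)"
  have ab: "2 * ?a * ?b = r * sqrt s" and a: "?a\<^sup>2 = s * t" and b: "?b\<^sup>2 = r\<^sup>2 / (4 * t)"
    using assms by (auto simp: real_sqrt_mult power_divide power_mult_distrib)
  have "r * sqrt s + - (?a + ?b)\<^sup>2 = - s * t + - r\<^sup>2 / (4 * t)"
    using ab a b by (simp add: power2_sum)
  then show "exp (r * sqrt s) * exp (- (?a + ?b)\<^sup>2) = exp (- s * t) * exp (- r\<^sup>2 / (4 * t))"
    by (simp only: exp_add[symmetric])
  have "- r * sqrt s + - (?a - ?b)\<^sup>2 = - s * t + - r\<^sup>2 / (4 * t)"
    using ab a b by (simp add: power2_diff)
  then show "exp (- r * sqrt s) * exp (- (?a - ?b)\<^sup>2) = exp (- s * t) * exp (- r\<^sup>2 / (4 * t))"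
    by (simp only: exp_add[symmetric])
qed

lemma DERIV_gauss_argument:
  assumes "t > 0"
  shows "DERIV (\<lambda>t. sqrt (s * t) + r / (2 * sqrt t)) t :> sqrt s / (2 * sqrt t) - r / (4 * t * sqrt t)"
    and "DERIV (\<lambda>t. sqrt (s * t) - r / (2 * sqrt t)) t :> sqrt s / (2 * sqrt t) + r / (4 * t * sqrt t)"
  unfolding real_sqrt_mult using assms
  by (auto intro!: derivative_eq_intros simp: field_simps)

text \<open>The primitives in the next lemmas come from differentiating \<open>gauss_cdf (sqrt (s t) \<plusminus> r / (2 sqrt t))\<close>:
  the exponents are \<open>- s t - r\<^sup>2 / 4t\<close> up to the constants \<open>\<mp> r sqrt s\<close>.\<close>

lemma heat_kernel_laplace:
  assumes r: "r > 0" and s: "s > 0"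
  shows "set_integrable lborel {0<..} (\<lambda>t. exp (- s * t) * heat_kernel t r)"
    and "(\<integral>t\<in>{0<..}. exp (- s * t) * heat_kernel t r \<partial>lborel) = exp (- r * sqrt s) / sqrt s"
proof -
  let ?p = "\<lambda>t. sqrt (s * t) + r / (2 * sqrt t)" and ?m = "\<lambda>t. sqrt (s * t) - r / (2 * sqrt t)"
  let ?F = "\<lambda>t. (exp (r * sqrt s) * gauss_cdf (?p t) + exp (- r * sqrt s) * gauss_cdf (?m t)) / sqrt s"
  have D: "DERIV ?F t :> exp (- s * t) * heat_kernel t r" if t: "t > 0" for t
  proof -
    let ?d = "(exp (r * sqrt s) * (exp (- (?p t)\<^sup>2) / sqrt pi * (sqrt s / (2 * sqrt t) - r / (4 * t * sqrt t)))
       + exp (- r * sqrt s) * (exp (- (?m t)\<^sup>2) / sqrt pi * (sqrt s / (2 * sqrt t) + r / (4 * t * sqrt t)))) / sqrt s"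
    have "DERIV ?F t :> ?d"
      by (intro DERIV_cdivide DERIV_add DERIV_cmult DERIV_gauss_cdf DERIV_gauss_argument t)
    also have "?d = ((exp (r * sqrt s) * exp (- (?p t)\<^sup>2)) / sqrt pi * (sqrt s / (2 * sqrt t) - r / (4 * t * sqrt t))
       + (exp (- r * sqrt s) * exp (- (?m t)\<^sup>2)) / sqrt pi * (sqrt s / (2 * sqrt t) + r / (4 * t * sqrt t))) / sqrt s"
      by (simp add: mult.assoc)
    also have "\<dots> = exp (- s * t) * heat_kernel t r"
      using t s unfolding gauss_exponent_split[OF t less_imp_le[OF s]]
      by (simp add: heat_kernel_def real_sqrt_mult field_simps)
    finally show ?thesis .
  qed
  \<comment> \<open>Near 0 the term \<open>r / (2 * sqrt t)\<close> decides, near infinity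
    \<open>sqrt (s * t)\<close>. So the first summand of \<open>?F\<close> has the same limit at
    both ends, and only the second one, going from 0 to \<open>exp (- r * sqrt s) / sqrt s\<close>,
    contributes.\<close>
  have p0: "filterlim ?p at_top (at_right 0)" and m0: "filterlim ?m at_bot (at_right 0)"
    and p1: "filterlim ?p at_top at_top" and m1: "filterlim ?m at_top at_top"
    using r s by real_asymp+
  have A: "(?F \<longlongrightarrow> (exp (r * sqrt s) * 1 + exp (- r * sqrt s) * 0) / sqrt s) (at_right 0)"
    using s by (intro tendsto_intros gauss_cdf_at_top[OF p0] gauss_cdf_at_bot[OF m0]) auto
  have B: "(?F \<longlongrightarrow> (exp (r * sqrt s) * 1 + exp (- r * sqrt s) * 1) / sqrt s) at_top"
    using s by (intro tendsto_intros gauss_cdf_at_top[OF p1] gauss_cdf_at_top[OF m1]) auto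
  have C: "isCont (\<lambda>t. exp (- s * t) * heat_kernel t r) t" if "t > 0" for t
    using that unfolding heat_kernel_def by (intro continuous_intros) auto
  have P: "0 \<le> exp (- s * t) * heat_kernel t r" if "t > 0" for t
    using that by (simp add: heat_kernel_def)
  show "set_integrable lborel {0<..} (\<lambda>t. exp (- s * t) * heat_kernel t r)"
    by (rule FTC_nonneg_Ioi(1)[OF D C P A B])
  show "(\<integral>t\<in>{0<..}. exp (- s * t) * heat_kernel t r \<partial>lborel) = exp (- r * sqrt s) / sqrt s"
    by (subst FTC_nonneg_Ioi(2)[OF D C P A B]) (auto simp: diff_divide_distrib[symmetric])
qed

lemma DERIV_hitting_density:
  assumes t: "t > 0" and s: "s \<ge> 0"
  shows "DERIV (\<lambda>t. exp (- q * sqrt s) * gauss_cdf (sqrt (s * t) - q / (2 * sqrt t))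
      - exp (q * sqrt s) * gauss_cdf (sqrt (s * t) + q / (2 * sqrt t))) t
    :> exp (- s * t) * hitting_density q t"
proof -
  let ?p = "\<lambda>t. sqrt (s * t) + q / (2 * sqrt t)" and ?m = "\<lambda>t. sqrt (s * t) - q / (2 * sqrt t)"
  let ?d = "exp (- q * sqrt s) * (exp (- (?m t)\<^sup>2) / sqrt pi * (sqrt s / (2 * sqrt t) + q / (4 * t * sqrt t)))
       - exp (q * sqrt s) * (exp (- (?p t)\<^sup>2) / sqrt pi * (sqrt s / (2 * sqrt t) - q / (4 * t * sqrt t)))"
  have "DERIV (\<lambda>t. exp (- q * sqrt s) * gauss_cdf (?m t) - exp (q * sqrt s) * gauss_cdf (?p t)) t :> ?d"
    by (intro DERIV_diff DERIV_cmult DERIV_gauss_cdf DERIV_gauss_argument t)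
  also have "?d = (exp (- q * sqrt s) * exp (- (?m t)\<^sup>2)) / sqrt pi * (sqrt s / (2 * sqrt t) + q / (4 * t * sqrt t))
       - (exp (q * sqrt s) * exp (- (?p t)\<^sup>2)) / sqrt pi * (sqrt s / (2 * sqrt t) - q / (4 * t * sqrt t))"
    by (simp add: mult.assoc)
  also have "\<dots> = exp (- s * t) * hitting_density q t"
    using t s unfolding gauss_exponent_split[OF t s]
    by (simp add: hitting_density_def field_simps)
  finally show ?thesis .
qed

lemma isCont_hitting_density: "t > 0 \<Longrightarrow> isCont (hitting_density q) t"
  unfolding hitting_density_def by (intro continuous_intros) auto

lemma hitting_density_nonneg: "q \<ge> 0 \<Longrightarrow> t > 0 \<Longrightarrow> hitting_density q t \<ge> 0"
  by (simp add: hitting_density_def)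

lemma hitting_density_laplace:
  assumes q: "q > 0" and s: "s > 0"
  shows "set_integrable lborel {0<..} (\<lambda>t. exp (- s * t) * hitting_density q t)"
    and "(\<integral>t\<in>{0<..}. exp (- s * t) * hitting_density q t \<partial>lborel) = exp (- q * sqrt s)"
proof -
  let ?p = "\<lambda>t. sqrt (s * t) + q / (2 * sqrt t)" and ?m = "\<lambda>t. sqrt (s * t) - q / (2 * sqrt t)"
  let ?F = "\<lambda>t. exp (- q * sqrt s) * gauss_cdf (?m t) - exp (q * sqrt s) * gauss_cdf (?p t)"
  have p0: "filterlim ?p at_top (at_right 0)" and m0: "filterlim ?m at_bot (at_right 0)"
    and p1: "filterlim ?p at_top at_top" and m1: "filterlim ?m at_top at_top"
    using q s by real_asymp+
  have A: "(?F \<longlongrightarrow> exp (- q * sqrt s) * 0 - exp (q * sqrt s) * 1) (at_right 0)"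
    by (intro tendsto_intros gauss_cdf_at_top[OF p0] gauss_cdf_at_bot[OF m0])
  have B: "(?F \<longlongrightarrow> exp (- q * sqrt s) * 1 - exp (q * sqrt s) * 1) at_top"
    by (intro tendsto_intros gauss_cdf_at_top[OF p1] gauss_cdf_at_top[OF m1])
  have C: "isCont (\<lambda>t. exp (- s * t) * hitting_density q t) t" if "t > 0" for t
    using that by (intro continuous_intros isCont_hitting_density)
  have P: "0 \<le> exp (- s * t) * hitting_density q t" if "t > 0" for t
    using that q by (simp add: hitting_density_nonneg)
  note D = DERIV_hitting_density[OF _ less_imp_le[OF s]]
  show "set_integrable lborel {0<..} (\<lambda>t. exp (- s * t) * hitting_density q t)"
    by (rule FTC_nonneg_Ioi(1)[OF D C P A B])
  show "(\<integral>t\<in>{0<..}. exp (- s * t) * hitting_density q t \<partial>lborel) = exp (- q * sqrt s)"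
    by (subst FTC_nonneg_Ioi(2)[OF D C P A B]) auto
qed

lemma hitting_density_integral:
  assumes q: "q > 0"
  shows "set_integrable lborel {0<..} (hitting_density q)"
    and "(\<integral>t\<in>{0<..}. hitting_density q t \<partial>lborel) = 1"
    and "T > 0 \<Longrightarrow> set_integrable lborel {0<..<T} (hitting_density q)"
    and "T > 0 \<Longrightarrow> (\<integral>t\<in>{0<..<T}. hitting_density q t \<partial>lborel) = 2 - 2 * gauss_cdf (q / (2 * sqrt T))"
proof -
  \<comment> \<open>This is the primitive of \<open>DERIV_hitting_density\<close> at
    \<open>s = 0\<close>, where the exponential factors are 1. It tends to -1 at 0 and to 0 at
    infinity.\<close>
  let ?F = "\<lambda>t. gauss_cdf (- (q / (2 * sqrt t))) - gauss_cdf (q / (2 * sqrt t))"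
  have p0: "filterlim (\<lambda>t. q / (2 * sqrt t)) at_top (at_right 0)"
    and m0: "filterlim (\<lambda>t. - (q / (2 * sqrt t))) at_bot (at_right 0)"
    and p1: "((\<lambda>t. q / (2 * sqrt t)) \<longlongrightarrow> 0) at_top"
    using q by real_asymp+
  have A: "(?F \<longlongrightarrow> 0 - 1) (at_right 0)"
    by (intro tendsto_intros gauss_cdf_at_top[OF p0] gauss_cdf_at_bot[OF m0])
  have B: "(?F \<longlongrightarrow> gauss_cdf (- 0) - gauss_cdf 0) at_top"
    by (intro tendsto_intros p1)
  have D: "DERIV ?F t :> hitting_density q t" if "t > 0" for t
    using DERIV_hitting_density[OF that, of 0 q] by simp
  note C = isCont_hitting_density[of _ q] and P = hitting_density_nonneg[OF less_imp_le[OF q]]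
  show "set_integrable lborel {0<..} (hitting_density q)"
    by (rule FTC_nonneg_Ioi(1)[OF D C P A B])
  show "(\<integral>t\<in>{0<..}. hitting_density q t \<partial>lborel) = 1"
    by (subst FTC_nonneg_Ioi(2)[OF D C P A B]) auto
  show "set_integrable lborel {0<..<T} (hitting_density q)" if "T > 0"
    by (rule FTC_nonneg_Ioo(1)[OF that D C P A])
  show "(\<integral>t\<in>{0<..<T}. hitting_density q t \<partial>lborel) = 2 - 2 * gauss_cdf (q / (2 * sqrt T))" if "T > 0"
    by (subst FTC_nonneg_Ioo(2)[OF that D C P A]) (auto simp: gauss_cdf_minus)
qed

lemma heat_kernel_integral:
  assumes t: "t > 0"
  shows "set_integrable lborel {0<..} (heat_kernel t)"
    and "(\<integral>s\<in>{0<..}. heat_kernel t s \<partial>lborel) = 1"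
    and "a > 0 \<Longrightarrow> (\<integral>s\<in>{0<..<a}. heat_kernel t s \<partial>lborel) = 2 * gauss_cdf (a / (2 * sqrt t)) - 1"
proof -
  \<comment> \<open>The factor 2 reflects that the absolute value folds both halves of the Gaussian
    onto the half line.\<close>
  let ?F = "\<lambda>s. 2 * gauss_cdf (s / (2 * sqrt t))"
  have p1: "filterlim (\<lambda>s. s / (2 * sqrt t)) at_top at_top"
    using t by real_asymp
  have A: "(?F \<longlongrightarrow> 2 * gauss_cdf (0 / (2 * sqrt t))) (at_right 0)"
    using t by (intro tendsto_intros) auto
  have B: "(?F \<longlongrightarrow> 2 * 1) at_top"
    by (intro tendsto_intros gauss_cdf_at_top[OF p1])
  have D: "DERIV ?F s :> heat_kernel t s" for s
    using t by (auto intro!: derivative_eq_intros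
        simp: heat_kernel_def real_sqrt_mult power_divide power_mult_distrib real_div_sqrt field_simps)
  have C: "isCont (heat_kernel t) s" for s
    using t unfolding heat_kernel_def by (intro continuous_intros) auto
  have P: "0 \<le> heat_kernel t s" for s using t by (simp add: heat_kernel_def)
  show "set_integrable lborel {0<..} (heat_kernel t)"
    by (rule FTC_nonneg_Ioi(1)[OF D C P A B])
  show "(\<integral>s\<in>{0<..}. heat_kernel t s \<partial>lborel) = 1"
    by (subst FTC_nonneg_Ioi(2)[OF D C P A B]) (auto simp: gauss_cdf_0)
  show "(\<integral>s\<in>{0<..<a}. heat_kernel t s \<partial>lborel) = 2 * gauss_cdf (a / (2 * sqrt t)) - 1" if "a > 0"
    by (subst FTC_nonneg_Ioo(2)[OF that D C P A]) (auto simp: gauss_cdf_0)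
qed


text \<open>The characteristic function of a law on \<open>[0, 1]\<close> is the power series of its moments.\<close>

lemma bounded_moments_unique:
  assumes M: "real_distribution M" and N: "real_distribution N"
    and "AE x in M. x \<in> {0..1}" "AE x in N. x \<in> {0..1}"
    and eq: "\<And>n::nat. (\<integral>x. x ^ n \<partial>M) = (\<integral>x. x ^ n \<partial>N)"
  shows "M = N"
proof -
  have char: "char L t = (\<Sum>n. ((\<i> * t) ^ n /\<^sub>R fact n) * complex_of_real (\<integral>x. x ^ n \<partial>L))"
    if L: "real_distribution L" and ae: "AE x in L. x \<in> {0..1}" for L t
  proof -
    interpret L: real_distribution L by (rule L)
    let ?f = "\<lambda>n x. (\<i> * t * x) ^ n /\<^sub>R fact n :: complex"
    have nf: "norm (?f n x) = \<bar>t\<bar> ^ n / fact n * \<bar>x\<bar> ^ n" for n x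
      by (simp add: norm_power norm_mult power_mult_distrib divide_inverse)
    \<comment> \<open>On [0, 1] the n-th term of the exponential series has a summable bound that
      does not involve \<open>x\<close>; it justifies exchanging the sum with the integral.\<close>
    have le: "AE x in L. norm (?f n x) \<le> \<bar>t\<bar> ^ n / fact n" for n
      using ae
    proof eventually_elim
      case (elim x)
      then have "\<bar>x\<bar> ^ n \<le> 1" by (auto intro: power_le_one)
      then show ?case unfolding nf by (intro mult_left_le) auto
    qed
    have int: "integrable L (?f n)" for n
      by (rule L.integrable_const_bound[OF le]) simp
    have "char L t = (\<integral>x. (\<Sum>n. ?f n x) \<partial>L)"
      unfolding char_def by (simp add: exp_def mult.assoc)
    also have "\<dots> = (\<Sum>n. \<integral>x. ?f n x \<partial>L)"
    proof (rule integral_suminf[OF int])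
      show "AE x in L. summable (\<lambda>n. norm (?f n x))"
        using summable_norm_exp by (intro AE_I2)
      show "summable (\<lambda>n. \<integral>x. norm (?f n x) \<partial>L)"
      proof (rule summable_comparison_test')
        show "summable (\<lambda>n. \<bar>t\<bar> ^ n / fact n)"
          using summable_exp[of "\<bar>t\<bar>"] by (simp add: divide_inverse mult.commute)
        show "norm (\<integral>x. norm (?f n x) \<partial>L) \<le> \<bar>t\<bar> ^ n / fact n" for n
        proof -
          have "(\<integral>x. norm (?f n x) \<partial>L) \<le> (\<integral>x. \<bar>t\<bar> ^ n / fact n \<partial>L)"
            by (rule integral_mono_AE[OF integrable_norm[OF int] _ le]) simp
          moreover have "(\<integral>x. \<bar>t\<bar> ^ n / fact n \<partial>L) = \<bar>t\<bar> ^ n / fact n"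
            by (simp only: lebesgue_integral_const L.prob_space scaleR_one)
          moreover have "(\<integral>x. norm (?f n x) \<partial>L) \<ge> 0" by simp
          ultimately show ?thesis unfolding real_norm_def by linarith
        qed
      qed
    qed
    also have "(\<lambda>n. \<integral>x. ?f n x \<partial>L) = (\<lambda>n. ((\<i> * t) ^ n /\<^sub>R fact n) * complex_of_real (\<integral>x. x ^ n \<partial>L))"
    proof
      fix n
      have "(\<integral>x. ?f n x \<partial>L) = (\<integral>x. ((\<i> * t) ^ n /\<^sub>R fact n) * complex_of_real (x ^ n) \<partial>L)"
        by (intro Bochner_Integration.integral_cong) (auto simp: power_mult_distrib)
      then show "(\<integral>x. ?f n x \<partial>L) = ((\<i> * t) ^ n /\<^sub>R fact n) * complex_of_real (\<integral>x. x ^ n \<partial>L)"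
        by (simp del: of_real_power)
    qed
    finally show ?thesis .
  qed
  have "char M = char N"
    using char[OF M assms(3)] char[OF N assms(4)] eq by (intro ext) simp
  then show ?thesis by (rule Levy_uniqueness[OF M N])
qed

text \<open>Under \<open>x \<mapsto> exp (- x)\<close> the values of the Laplace transform at the integers become moments.\<close>

lemma laplace_transform_unique:
  assumes M: "real_distribution M" and N: "real_distribution N"
    and ae: "AE x in M. x \<ge> 0" "AE x in N. x \<ge> 0"
    and eq: "\<And>s. s > 0 \<Longrightarrow> (\<integral>x. exp (- s * x) \<partial>M) = (\<integral>x. exp (- s * x) \<partial>N)"
  shows "M = N"
proof -
  interpret M: real_distribution M by (rule M)
  interpret N: real_distribution N by (rule N)
  \<comment> \<open>Since \<open>- ln\<close> inverts \<open>exp (- x)\<close>, equality of the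
    image laws gives back equality of the laws themselves.\<close>
  have inv: "distr (distr L borel (\<lambda>x. exp (- x))) borel (\<lambda>y. - ln y) = L" if "real_distribution L" for L
  proof -
    interpret L: real_distribution L by (rule that)
    show ?thesis by (subst distr_distr) (auto simp: o_def intro!: distr_id2)
  qed
  have "distr M borel (\<lambda>x. exp (- x)) = distr N borel (\<lambda>x. exp (- x))"
  proof (rule bounded_moments_unique)
    show "real_distribution (distr M borel (\<lambda>x. exp (- x)))" "real_distribution (distr N borel (\<lambda>x. exp (- x)))"
      by (auto intro!: M.real_distribution_distr N.real_distribution_distr)
    show "AE x in distr M borel (\<lambda>x. exp (- x)). x \<in> {0..1}" "AE x in distr N borel (\<lambda>x. exp (- x)). x \<in> {0..1}"
      using ae by (subst AE_distr_iff; simp)+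
    \<comment> \<open>The n-th moment of the image is the Laplace transform at n. The case
      \<open>n = 0\<close> is apart, as the hypothesis speaks of \<open>s > 0\<close>; there both
      sides are the total mass 1.\<close>
    show "(\<integral>x. x ^ n \<partial>distr M borel (\<lambda>x. exp (- x))) = (\<integral>x. x ^ n \<partial>distr N borel (\<lambda>x. exp (- x)))" for n
      using eq[of "real n"] M.prob_space N.prob_space
      by (cases "n = 0") (auto simp: integral_distr measure_distr simp flip: exp_of_nat_mult)
  qed
  then have "distr (distr M borel (\<lambda>x. exp (- x))) borel (\<lambda>y. - ln y)
      = distr (distr N borel (\<lambda>x. exp (- x))) borel (\<lambda>y. - ln y)" by simp
  then show ?thesis by (simp only: inv[OF M] inv[OF N])
qed

section \<open>Laws on the half line given by a density\<close>

text \<open>Arguments below 0 have to be cut off: for \<open>t > 0\<close> the function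
  \<open>heat_kernel t\<close> is even, so its mass over the whole line would be 2.\<close>

definition Ioi_density :: "(real \<Rightarrow> real) \<Rightarrow> real measure" where
  "Ioi_density f = density lborel (\<lambda>s. ennreal (indicator {0<..} s * f s))"

lemma sets_Ioi_density [simp, measurable_cong]: "sets (Ioi_density f) = sets borel"
  by (simp add: Ioi_density_def)

context
  fixes f :: "real \<Rightarrow> real"
  assumes int: "set_integrable lborel {0<..} f" and nonneg: "\<And>s. s > 0 \<Longrightarrow> f s \<ge> 0"
    and one: "(\<integral>s\<in>{0<..}. f s \<partial>lborel) = 1"
begin

lemma Ioi_density_integrable: "integrable lborel (\<lambda>s. indicator {0<..} s * f s)"
  using int by (simp add: set_integrable_def)

lemma real_distribution_Ioi_density: "real_distribution (Ioi_density f)"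
proof -
  have "emeasure (Ioi_density f) (space (Ioi_density f)) = 1"
    using Ioi_density_integrable nonneg one
    by (simp add: Ioi_density_def emeasure_density nn_integral_eq_integral set_lebesgue_integral_def indicator_def)
  then have "prob_space (Ioi_density f)" by (rule prob_spaceI)
  then show ?thesis
    by (auto simp: real_distribution_def real_distribution_axioms_def)
qed

lemma AE_Ioi_density: "AE s in Ioi_density f. s > 0"
proof -
  have "(\<lambda>s. ennreal (indicator {0<..} s * f s)) \<in> borel_measurable lborel"
    using Ioi_density_integrable by (intro measurable_compose[OF _ measurable_ennreal]) auto
  then show ?thesis
    unfolding Ioi_density_def by (subst AE_density) (auto simp: indicator_def)
qed

lemma integral_Ioi_density:
  fixes g :: "real \<Rightarrow> real"
  assumes "g \<in> borel_measurable borel"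
  shows "(\<integral>s. g s \<partial>Ioi_density f) = (\<integral>s\<in>{0<..}. g s * f s \<partial>lborel)"
proof -
  have "(\<integral>s. g s \<partial>Ioi_density f) = (\<integral>s. (indicator {0<..} s * f s) *\<^sub>R g s \<partial>lborel)"
    unfolding Ioi_density_def
  proof (rule integral_density)
    show "g \<in> borel_measurable lborel" using assms by simp
    show "(\<lambda>s. indicator {0<..} s * f s) \<in> borel_measurable lborel"
      by (rule borel_measurable_integrable[OF Ioi_density_integrable])
    show "AE s in lborel. 0 \<le> indicator {0<..} s * f s"
      using nonneg by (intro AE_I2) (auto simp: indicator_def)
  qed
  then show ?thesis
    by (simp add: set_lebesgue_integral_def mult_ac)
qed

lemma cdf_Ioi_density:
  "cdf (Ioi_density f) a = (if a \<le> 0 then 0 else (\<integral>s\<in>{0<..<a}. f s \<partial>lborel))"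
proof -
  have "measure (Ioi_density f) {..a} = (\<integral>s. indicator {..a} s \<partial>Ioi_density f)"
    by simp
  also have "\<dots> = (\<integral>s\<in>{0<..}. indicator {..a} s * f s \<partial>lborel)"
    by (rule integral_Ioi_density) simp
  also have "\<dots> = (\<integral>s. indicator {0<..<a} s *\<^sub>R f s \<partial>lborel)"
    unfolding set_lebesgue_integral_def
  proof (rule integral_cong_AE)
    have m: "(\<lambda>s. indicator A s * (indicator {0<..} s * f s)) \<in> borel_measurable lborel"
      if "A \<in> sets borel" for A
      using that by (intro borel_measurable_times borel_measurable_indicator
          borel_measurable_integrable[OF Ioi_density_integrable]) simp
    show "(\<lambda>s. indicator {0<..} s *\<^sub>R (indicator {..a} s * f s)) \<in> borel_measurable lborel"
      using m[of "{..a}"] by (simp add: mult_ac)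
    have "(\<lambda>s. indicator {0<..<a} s *\<^sub>R f s) = (\<lambda>s. indicator {0<..<a} s * (indicator {0<..} s * f s))"
      by (auto simp: indicator_def)
    then show "(\<lambda>s. indicator {0<..<a} s *\<^sub>R f s) \<in> borel_measurable lborel"
      using m[of "{0<..<a}"] by simp
    \<comment> \<open>The two sets differ by the point \<open>a\<close>, which is null. The open
      interval is the form in which \<open>FTC_nonneg_Ioo\<close> computes the integral.\<close>
    show "AE x in lborel. indicator {0<..} x *\<^sub>R (indicator {..a} x * f x) = indicator {0<..<a} x *\<^sub>R f x"
      using AE_lborel_singleton[of a] by eventually_elim (auto simp: indicator_def)
  qed
  finally show ?thesis
    by (auto simp: cdf_def set_lebesgue_integral_def)
qed

end

lemma heat_kernel_nonneg: "t > 0 \<Longrightarrow> heat_kernel t s \<ge> 0"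
  by (simp add: heat_kernel_def)

lemmas heat_density_facts =
  heat_kernel_integral(1) heat_kernel_nonneg heat_kernel_integral(2)

lemmas hitting_density_facts =
  hitting_density_integral(1) hitting_density_nonneg[OF less_imp_le] hitting_density_integral(2)

lemma real_distribution_heat: "t > 0 \<Longrightarrow> real_distribution (Ioi_density (heat_kernel t))"
  by (rule real_distribution_Ioi_density[OF heat_density_facts])

lemma cdf_heat_density:
  "t > 0 \<Longrightarrow> cdf (Ioi_density (heat_kernel t)) a = (if a \<le> 0 then 0 else 2 * gauss_cdf (a / (2 * sqrt t)) - 1)"
  by (subst cdf_Ioi_density[OF heat_density_facts]) (auto simp: heat_kernel_integral)

lemma cdf_hitting_density:
  assumes "q > 0" "t > 0"
  shows "cdf (Ioi_density (hitting_density q)) t = 2 - 2 * gauss_cdf (q / (2 * sqrt t))"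
  using assms by (subst cdf_Ioi_density[OF hitting_density_facts]) (auto simp: hitting_density_integral)

lemma distr_abs_brownian:
  assumes Y: "brownian_motion M 2 Y" and t: "t > 0"
  shows "distr M borel (\<lambda>\<omega>. \<bar>Y t \<omega>\<bar>) = Ioi_density (heat_kernel t)"
proof (rule cdf_unique)
  interpret prob_space M using Y by (simp add: brownian_motion_def)
  have [measurable]: "Y t \<in> borel_measurable M" "Y 0 \<in> borel_measurable M"
    using Y t by (auto simp: brownian_motion_def)
  have Y0: "AE \<omega> in M. Y 0 \<omega> = 0" using Y by (simp add: brownian_motion_def)
  \<comment> \<open>Only the increments of \<open>Y\<close> have a prescribed law, so
    \<open>Y 0\<close> is carried along until the almost sure equality \<open>Y 0 = 0\<close>
    removes it inside a probability.\<close>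
  have "distributed M lborel (\<lambda>\<omega>. Y t \<omega> - Y 0 \<omega>) (normal_density 0 (sqrt (2 * t)))"
    using Y t by (force simp: brownian_motion_def)
  then have "distributed M lborel (\<lambda>\<omega>. (Y t \<omega> - Y 0 \<omega> - 0) / sqrt (2 * t)) std_normal_density"
    using t by (subst normal_standard_normal_convert[symmetric]) auto
  then have d: "distr M lborel (\<lambda>\<omega>. (Y t \<omega> - Y 0 \<omega>) / sqrt (2 * t)) = std_normal_distribution"
    by (simp add: distributed_def)
  show "real_distribution (distr M borel (\<lambda>\<omega>. \<bar>Y t \<omega>\<bar>))"
    by (rule real_distribution_distr) simp
  show "real_distribution (Ioi_density (heat_kernel t))"
    by (rule real_distribution_heat[OF t])
  interpret N: real_distribution std_normal_distribution by (rule real_dist_normal_dist)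
  show "cdf (distr M borel (\<lambda>\<omega>. \<bar>Y t \<omega>\<bar>)) = cdf (Ioi_density (heat_kernel t))"
  proof
    fix a
    let ?z = "a / sqrt (2 * t)"
    have "cdf (distr M borel (\<lambda>\<omega>. \<bar>Y t \<omega>\<bar>)) a = measure M {\<omega> \<in> space M. \<bar>Y t \<omega>\<bar> \<le> a}"
      by (simp add: cdf_def measure_distr vimage_def Int_def conj_commute)
    also have "\<dots> = measure M {\<omega> \<in> space M. (Y t \<omega> - Y 0 \<omega>) / sqrt (2 * t) \<in> {- ?z .. ?z}}"
    proof (rule finite_measure_eq_AE)
      show "AE \<omega> in M. (\<omega> \<in> {\<omega> \<in> space M. \<bar>Y t \<omega>\<bar> \<le> a})
          = (\<omega> \<in> {\<omega> \<in> space M. (Y t \<omega> - Y 0 \<omega>) / sqrt (2 * t) \<in> {- ?z .. ?z}})"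
        using Y0
      proof eventually_elim
        case (elim \<omega>)
        have "- ?z \<le> y / sqrt (2 * t) \<longleftrightarrow> - a \<le> y" "y / sqrt (2 * t) \<le> ?z \<longleftrightarrow> y \<le> a" for y
          using divide_le_cancel[of "- a" "sqrt (2 * t)" y] divide_le_cancel[of y "sqrt (2 * t)" a] t
          by simp_all
        then show ?case using elim by auto
      qed
    qed auto
    also have "\<dots> = measure (distr M lborel (\<lambda>\<omega>. (Y t \<omega> - Y 0 \<omega>) / sqrt (2 * t))) {- ?z .. ?z}"
      by (subst measure_distr) (auto simp: vimage_def Int_def conj_commute)
    also have "\<dots> = measure std_normal_distribution {- ?z .. ?z}"
      unfolding d ..
    \<comment> \<open>A difference of two values of a distribution function is the mass of a
      half-open interval; the endpoint dropped here is null.\<close>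
    also have "\<dots> = measure std_normal_distribution {- ?z <.. ?z}"
    proof (rule N.finite_measure_eq_AE)
      have "AE x in lborel. x \<noteq> - ?z" by (rule AE_lborel_singleton)
      then show "AE x in std_normal_distribution. (x \<in> {- ?z .. ?z}) = (x \<in> {- ?z <.. ?z})"
        by (subst AE_density) (auto elim!: eventually_mono)
    qed auto
    also have "\<dots> = (if a \<le> 0 then 0 else cdf std_normal_distribution ?z - cdf std_normal_distribution (- ?z))"
    proof (cases "a \<le> 0")
      case True
      then have "{- ?z <.. ?z} = {}" using t by (auto simp: divide_le_0_iff)
      then show ?thesis using True by simp
    next
      case False
      then have "0 < ?z" using t by (intro divide_pos_pos) auto
      then have "- ?z < ?z" by linarith
      then show ?thesis using False by (simp add: N.cdf_diff_eq)
    qed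
    also have "\<dots> = (if a \<le> 0 then 0 else 2 * gauss_cdf (a / (2 * sqrt t)) - 1)"
    proof -
      \<comment> \<open>This matches the normalisation of \<open>gauss_cdf\<close>, whose variance
        is 1/2, with that of \<open>Y t\<close>, whose variance is \<open>2 * t\<close>.\<close>
      have z: "?z = sqrt 2 * (a / (2 * sqrt t))"
      proof -
        have s2: "sqrt 2 / 2 = 1 / sqrt (2 :: real)" by (subst frac_eq_eq) auto
        have "sqrt 2 * (a / (2 * sqrt t)) = (sqrt 2 / 2) * (a / sqrt t)" by simp
        also have "\<dots> = ?z" unfolding s2 by (simp add: real_sqrt_mult)
        finally show ?thesis by simp
      qed
      have "cdf std_normal_distribution ?z - cdf std_normal_distribution (- ?z)
          = gauss_cdf (a / (2 * sqrt t)) - gauss_cdf (- (a / (2 * sqrt t)))"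
        unfolding gauss_cdf_def z by simp
      then show ?thesis by (simp add: gauss_cdf_minus)
    qed
    finally show "cdf (distr M borel (\<lambda>\<omega>. \<bar>Y t \<omega>\<bar>)) a = cdf (Ioi_density (heat_kernel t)) a"
      by (simp add: cdf_heat_density[OF t])
  qed
qed

section \<open>Measurability of the first passage time\<close>

lemma measurable_path_algebra:
  assumes t: "t \<in> I"
  shows "Z t \<in> path_algebra \<Omega> I Z \<rightarrow>\<^sub>M borel"
proof -
  have "(\<lambda>\<omega>. \<lambda>t\<in>I. Z t \<omega>) \<in> path_algebra \<Omega> I Z \<rightarrow>\<^sub>M (\<Pi>\<^sub>M t\<in>I. borel)"
    unfolding path_algebra_def by (rule measurable_vimage_algebra1) (auto simp: space_PiM)
  from measurable_compose[OF this measurable_component_singleton[OF t]]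
  show "Z t \<in> path_algebra \<Omega> I Z \<rightarrow>\<^sub>M borel" using t by simp
qed

lemma space_path_algebra [simp]: "space (path_algebra \<Omega> I Z) = \<Omega>"
  by (simp add: path_algebra_def)

lemma inverse_process_nonneg: "inverse_process D t \<omega> \<ge> 0"
  by (auto simp: inverse_process_def intro!: cInf_greatest)

lemma inverse_process_le: "x > 0 \<Longrightarrow> D x \<omega> > t \<Longrightarrow> inverse_process D t \<omega> \<le> x"
  by (auto simp: inverse_process_def intro!: cInf_lower bdd_belowI[of _ 0])

text \<open>Strict monotonicity allows a passage time below \<open>a\<close> to be enlarged to a
  rational one, which makes the event a countable union. Existence of some passage excludes the
  conventional value 0.\<close>

lemma inverse_process_less:
  assumes mono: "strict_mono_on {0..} (\<lambda>x. D x \<omega>)" and ex: "\<exists>x>0. D x \<omega> > t"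
  shows "inverse_process D t \<omega> < a \<longleftrightarrow> (\<exists>r::rat. 0 < real_of_rat r \<and> of_rat r < a \<and> D (of_rat r) \<omega> > t)"
proof
  assume "inverse_process D t \<omega> < a"
  then obtain x where x: "x > 0" "D x \<omega> > t" "x < a"
    using ex cInf_lessD[of "{x. x > 0 \<and> D x \<omega> > t}" a] by (auto simp: inverse_process_def)
  obtain r where r: "x < of_rat r" "of_rat r < a" using of_rat_dense[OF x(3)] by auto
  have r0: "0 < real_of_rat r" using r x by linarith
  have "D x \<omega> < D (of_rat r) \<omega>" using r r0 x by (intro strict_mono_onD[OF mono]) auto
  then show "\<exists>r::rat. 0 < real_of_rat r \<and> of_rat r < a \<and> D (of_rat r) \<omega> > t"
    using x r r0 by (intro exI[of _ r]) auto
next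
  assume "\<exists>r::rat. 0 < real_of_rat r \<and> of_rat r < a \<and> D (of_rat r) \<omega> > t"
  then show "inverse_process D t \<omega> < a"
    using inverse_process_le[of _ t D \<omega>] by (meson le_less_trans)
qed

text \<open>The target is the \<sigma>-algebra generated by \<open>D\<close> alone and not just that
  of an ambient measure: the independence of \<open>X\<close> and \<open>D\<close> is a statement
  about the generated \<sigma>-algebras, and it reaches the first passage time only through
  this.\<close>

lemma measurable_inverse_process:
  assumes mono: "\<And>\<omega>. \<omega> \<in> \<Omega> \<Longrightarrow> strict_mono_on {0..} (\<lambda>x. D x \<omega>)"
  shows "inverse_process D t \<in> path_algebra \<Omega> {0..} D \<rightarrow>\<^sub>M borel"
proof (rule borel_measurable_iff_less[THEN iffD2], intro allI)
  fix a
  let ?N = "path_algebra \<Omega> {0..} D"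
  \<comment> \<open>Replacing \<open>x\<close> by \<open>max 0 x\<close> makes the statement true
    for all reals, so that the countable quantifiers below can range over all naturals and
    rationals.\<close>
  have [measurable]: "D (max 0 x) \<in> borel_measurable ?N" for x
    by (rule measurable_path_algebra) simp
  let ?B = "\<lambda>\<omega>. \<exists>n::nat. D (max 0 (real (Suc n))) \<omega> > t"
  let ?C = "\<lambda>\<omega>. \<exists>r::rat. 0 < real_of_rat r \<and> real_of_rat r < a \<and> D (max 0 (of_rat r)) \<omega> > t"
  have B: "?B \<omega> \<longleftrightarrow> (\<exists>x>0. D x \<omega> > t)" if "\<omega> \<in> \<Omega>" for \<omega>
  proof
    assume "\<exists>x>0. D x \<omega> > t"
    then obtain x where x: "x > 0" "D x \<omega> > t" by auto
    obtain n :: nat where n: "x < real n" using reals_Archimedean2 by blast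
    have "D x \<omega> < D (real (Suc n)) \<omega>"
      using x n by (intro strict_mono_onD[OF mono[OF that]]) auto
    then show "?B \<omega>" using x by (intro exI[of _ n]) auto
  next
    assume "?B \<omega>"
    then obtain n :: nat where "D (max 0 (real (Suc n))) \<omega> > t" by auto
    then show "\<exists>x>0. D x \<omega> > t" by (intro exI[of _ "real (Suc n)"]) auto
  qed
  have C: "?C \<omega> \<longleftrightarrow> (\<exists>r::rat. 0 < real_of_rat r \<and> of_rat r < a \<and> D (of_rat r) \<omega> > t)" for \<omega>
    by (intro ex_cong1 conj_cong refl) (simp add: max_absorb2)
  \<comment> \<open>The branch \<open>0 < a\<close> belongs to the paths that never exceed
    \<open>t\<close>, on which the inverse has the conventional value 0.\<close>
  have "{\<omega> \<in> space ?N. inverse_process D t \<omega> < a}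
      = {\<omega> \<in> space ?N. if ?B \<omega> then ?C \<omega> else 0 < a}"
  proof (rule Collect_cong, rule conj_cong[OF refl])
    fix \<omega> assume "\<omega> \<in> space ?N"
    then have \<omega>: "\<omega> \<in> \<Omega>" by simp
    show "(inverse_process D t \<omega> < a) = (if ?B \<omega> then ?C \<omega> else 0 < a)"
    proof (cases "?B \<omega>")
      case True
      then show ?thesis
        using inverse_process_less[where D=D and \<omega>=\<omega>, OF mono[OF \<omega>], of t a] B[OF \<omega>] C[of \<omega>] by simp
    next
      case False
      then have "\<not> (\<exists>x>0. D x \<omega> > t)" using B[OF \<omega>] by blast
      then have "inverse_process D t \<omega> = 0" unfolding inverse_process_def by (rule if_not_P)
      then show ?thesis using False by simp
    qed
  qed
  also have "\<dots> \<in> sets ?N"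
  proof -
    have "Measurable.pred ?N ?B" by (intro pred_intros_countable) measurable
    moreover have "Measurable.pred ?N ?C" by (intro pred_intros_countable) measurable
    ultimately show ?thesis by (intro predE pred_intros_logic) auto
  qed
  finally show "{\<omega> \<in> space ?N. inverse_process D t \<omega> < a} \<in> sets ?N" .
qed

section \<open>The inverse of the 1/2-stable subordinator\<close>

context
  fixes M :: "'w measure" and D :: "real \<Rightarrow> 'w \<Rightarrow> real"
  assumes D: "stable_subordinator M (1/2) D"
begin

lemma subordinator_prob_space: "prob_space M"
  using D by (simp add: stable_subordinator_def levy_process_def)

lemma subordinator_measurable: "t \<ge> 0 \<Longrightarrow> D t \<in> borel_measurable M"
  using D by (simp add: stable_subordinator_def levy_process_def)

lemma subordinator_mono: "\<omega> \<in> space M \<Longrightarrow> strict_mono_on {0..} (\<lambda>x. D x \<omega>)"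
  using D by (simp add: stable_subordinator_def)

lemma subordinator_zero: "AE \<omega> in M. D 0 \<omega> = 0"
  using D by (simp add: stable_subordinator_def levy_process_def)

lemma subordinator_pos: "AE \<omega> in M. \<forall>q>0. D q \<omega> > 0"
  using subordinator_zero AE_space
  by eventually_elim (use strict_mono_onD[OF subordinator_mono, of _ 0] in force)

lemma distr_subordinator:
  assumes q: "q > 0"
  shows "distr M borel (D q) = Ioi_density (hitting_density q)"
proof (rule laplace_transform_unique)
  interpret prob_space M by (rule subordinator_prob_space)
  have m [measurable]: "D q \<in> borel_measurable M" using q by (intro subordinator_measurable) simp
  show "real_distribution (distr M borel (D q))" by (rule real_distribution_distr[OF m])
  show "real_distribution (Ioi_density (hitting_density q))"
    by (rule real_distribution_Ioi_density[OF hitting_density_facts]) (use q in auto)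
  show "AE x in distr M borel (D q). 0 \<le> x"
    using subordinator_pos q by (subst AE_distr_iff) (auto intro: less_imp_le elim!: eventually_mono)
  have "AE s in Ioi_density (hitting_density q). s > 0"
    by (rule AE_Ioi_density[OF hitting_density_facts]) (use q in auto)
  then show "AE s in Ioi_density (hitting_density q). 0 \<le> s"
    by eventually_elim simp
  fix s :: real assume s: "s > 0"
  have "(\<integral>x. exp (- s * x) \<partial>distr M borel (D q)) = exp (- q * s powr (1/2))"
    using D q s by (subst integral_distr) (auto simp: stable_subordinator_def)
  also have "\<dots> = (\<integral>t\<in>{0<..}. exp (- s * t) * hitting_density q t \<partial>lborel)"
    using hitting_density_laplace(2)[OF q s] s by (simp add: powr_half_sqrt)
  also have "\<dots> = (\<integral>x. exp (- s * x) \<partial>Ioi_density (hitting_density q))"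
    by (rule integral_Ioi_density[OF hitting_density_facts, symmetric]) (use q in auto)
  finally show "(\<integral>x. exp (- s * x) \<partial>distr M borel (D q)) = (\<integral>x. exp (- s * x) \<partial>Ioi_density (hitting_density q))" .
qed

lemma prob_subordinator_le:
  assumes "q > 0" "t > 0"
  shows "measure M {\<omega> \<in> space M. D q \<omega> \<le> t} = 2 - 2 * gauss_cdf (q / (2 * sqrt t))"
proof -
  have m [measurable]: "D q \<in> borel_measurable M"
    using assms by (intro subordinator_measurable) simp
  have "measure M {\<omega> \<in> space M. D q \<omega> \<le> t} = cdf (distr M borel (D q)) t"
    by (simp add: cdf_def measure_distr vimage_def Int_def conj_commute)
  then show ?thesis using assms by (simp add: distr_subordinator cdf_hitting_density)
qed

lemma measurable_inverse_subordinator: "inverse_process D t \<in> borel_measurable M"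
proof -
  have "(\<lambda>\<omega>. \<lambda>t\<in>{0..}. D t \<omega>) \<in> M \<rightarrow>\<^sub>M (\<Pi>\<^sub>M t\<in>{0..}. borel)"
    using subordinator_measurable by (intro measurable_restrict) auto
  then have "(\<lambda>\<omega>. \<omega>) \<in> M \<rightarrow>\<^sub>M path_algebra (space M) {0..} D"
    unfolding path_algebra_def by (intro measurable_vimage_algebra2) auto
  from measurable_compose[OF this measurable_inverse_process[OF subordinator_mono]]
  show ?thesis .
qed

text \<open>Almost surely \<open>D\<close> is positive at every positive time, so each
  \<open>e > 0\<close> is a passage time over the level 0.\<close>

lemma inverse_process_at_zero: "AE \<omega> in M. inverse_process D 0 \<omega> = 0"
  using subordinator_pos
proof eventually_elim
  case (elim \<omega>)
  have "inverse_process D 0 \<omega> \<le> 0 + e" if "e > 0" for e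
    using inverse_process_le[of e 0 D \<omega>] elim that by auto
  then have "inverse_process D 0 \<omega> \<le> 0" by (rule field_le_epsilon)
  then show ?case using inverse_process_nonneg[of D 0 \<omega>] by simp
qed

text \<open>The probability of \<open>D q > t\<close>, read as a function of \<open>q > 0\<close>,
  is \<open>?G\<close>, and this is the distribution function that belongs to
  \<open>heat_kernel t\<close>. For \<open>a > 0\<close> the distribution function of the inverse is
  squeezed between \<open>?G a\<close> and the values \<open>?G b\<close> with \<open>b > a\<close>,
  and \<open>?G\<close> is continuous.\<close>

lemma distr_inverse_subordinator:
  assumes t: "t > 0"
  shows "distr M borel (inverse_process D t) = Ioi_density (heat_kernel t)"
proof (rule cdf_unique)
  interpret prob_space M by (rule subordinator_prob_space)
  note [measurable] = measurable_inverse_subordinator[of t]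
  have mD [measurable]: "D q \<in> borel_measurable M" if "q \<ge> 0" for q
    using that by (rule subordinator_measurable)
  show "real_distribution (distr M borel (inverse_process D t))"
    by (rule real_distribution_distr) simp
  show "real_distribution (Ioi_density (heat_kernel t))"
    by (rule real_distribution_heat[OF t])
  let ?G = "\<lambda>q. 2 * gauss_cdf (q / (2 * sqrt t)) - 1"
  have gt: "measure M {\<omega> \<in> space M. D q \<omega> > t} = ?G q" if "q > 0" for q
  proof -
    have "{\<omega> \<in> space M. D q \<omega> > t} = space M - {\<omega> \<in> space M. D q \<omega> \<le> t}" by auto
    then show ?thesis
      using that prob_subordinator_le[OF that t] mD[of q] by (simp add: prob_compl)
  qed
  \<comment> \<open>Paths that stay below \<open>t\<close> have the inverse 0 by convention and
    would count as early passages. They are null: the probability of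
    \<open>D (Suc n) \<le> t\<close> bounds theirs and tends to 0 as \<open>n\<close> grows.\<close>
  have esc: "AE \<omega> in M. \<exists>x>0. D x \<omega> > t"
  proof -
    let ?E = "{\<omega> \<in> space M. \<forall>n::nat. D (max 0 (real (Suc n))) \<omega> \<le> t}"
    have mE: "?E \<in> sets M"
    proof -
      have [measurable]: "D (max 0 x) \<in> borel_measurable M" for x by (rule mD) simp
      show ?thesis by measurable
    qed
    have "measure M ?E \<le> 2 - 2 * gauss_cdf (real (Suc n) / (2 * sqrt t))" for n
    proof -
      have "measure M ?E \<le> measure M {\<omega> \<in> space M. D (Suc n) \<omega> \<le> t}"
        using mD[of "real (Suc n)"] by (intro finite_measure_mono) auto
      then show ?thesis using prob_subordinator_le[of "real (Suc n)" t] t by simp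
    qed
    moreover have "(\<lambda>n. 2 - 2 * gauss_cdf (real (Suc n) / (2 * sqrt t))) \<longlonglongrightarrow> 2 - 2 * 1"
    proof (intro tendsto_intros gauss_cdf_at_top)
      show "filterlim (\<lambda>n. real (Suc n) / (2 * sqrt t)) at_top sequentially"
        using t by real_asymp
    qed
    ultimately have "measure M ?E \<le> 2 - 2 * 1"
      by (intro LIMSEQ_le_const) auto
    then have "measure M ?E = 0" using measure_nonneg[of M ?E] by linarith
    then have "AE \<omega> in M. \<omega> \<notin> ?E"
      using mE by (simp add: AE_iff_measurable[OF _ refl] emeasure_eq_measure)
    then show ?thesis
      using AE_space
    proof eventually_elim
      case (elim \<omega>)
      then obtain n :: nat where "D (max 0 (real (Suc n))) \<omega> > t" by (auto simp: not_le)
      then show ?case by (intro exI[of _ "real (Suc n)"]) auto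
    qed
  qed
  show "cdf (distr M borel (inverse_process D t)) = cdf (Ioi_density (heat_kernel t))"
  proof
    fix a
    have c: "cdf (distr M borel (inverse_process D t)) a = measure M {\<omega> \<in> space M. inverse_process D t \<omega> \<le> a}"
      by (simp add: cdf_def measure_distr vimage_def Int_def conj_commute)
    \<comment> \<open>The infimum of the passage times need not be a passage time itself, so an
      inverse of at most \<open>a\<close> only forces \<open>D b > t\<close> for
      \<open>b > a\<close>. The bound at \<open>a\<close> follows by letting \<open>b\<close>
      decrease to \<open>a\<close>.\<close>
    have up: "cdf (distr M borel (inverse_process D t)) a \<le> ?G a" if "a \<ge> 0"
    proof -
      have "cdf (distr M borel (inverse_process D t)) a \<le> ?G b" if b: "b > a" for b
      proof -
        have "AE \<omega> in M. inverse_process D t \<omega> \<le> a \<longrightarrow> D b \<omega> > t"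
          using esc AE_space
        proof eventually_elim
          case (elim \<omega>)
          show ?case
          proof
            assume "inverse_process D t \<omega> \<le> a"
            then have "inverse_process D t \<omega> < b" using b by simp
            then obtain r :: rat where r: "0 < real_of_rat r" "of_rat r < b" "D (of_rat r) \<omega> > t"
              using inverse_process_less[where D=D and \<omega>=\<omega>, OF subordinator_mono[OF elim(2)] elim(1)] by blast
            have "D (of_rat r) \<omega> < D b \<omega>"
              using r b \<open>a \<ge> 0\<close> by (intro strict_mono_onD[OF subordinator_mono[OF elim(2)]]) auto
            then show "D b \<omega> > t" using r by simp
          qed
        qed
        then have "measure M {\<omega> \<in> space M. inverse_process D t \<omega> \<le> a} \<le> measure M {\<omega> \<in> space M. D b \<omega> > t}"
          using mD[of b] b \<open>a \<ge> 0\<close> by (intro finite_measure_mono_AE) auto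
        then show ?thesis using gt[of b] b \<open>a \<ge> 0\<close> c by simp
      qed
      then have "\<forall>\<^sub>F b in at_right a. cdf (distr M borel (inverse_process D t)) a \<le> ?G b"
        by (auto simp: eventually_at_right_field intro: exI[of _ "a+1"])
      moreover have "(?G \<longlongrightarrow> ?G a) (at_right a)"
        using t by (intro tendsto_intros) auto
      ultimately show ?thesis
        by (intro tendsto_lowerbound[of ?G]) auto
    qed
    have lo: "?G a \<le> cdf (distr M borel (inverse_process D t)) a" if "a > 0"
    proof -
      have "measure M {\<omega> \<in> space M. D a \<omega> > t} \<le> measure M {\<omega> \<in> space M. inverse_process D t \<omega> \<le> a}"
        using that by (intro finite_measure_mono) (auto intro: inverse_process_le)
      then show ?thesis using gt[OF that] c by simp
    qed
    have "cdf (distr M borel (inverse_process D t)) a = (if a \<le> 0 then 0 else ?G a)"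
    proof (cases "a > 0")
      case True
      then show ?thesis using up lo by force
    next
      case False
      \<comment> \<open>At \<open>a = 0\<close> the upper bound is \<open>2 * (1/2) - 1 = 0\<close>;
        below 0 the event is empty because the inverse is nonnegative.\<close>
      have "cdf (distr M borel (inverse_process D t)) a \<le> 0"
      proof (cases "a = 0")
        case True
        then show ?thesis using up by (simp add: gauss_cdf_0)
      next
        case neg: False
        have "\<not> inverse_process D t \<omega> \<le> a" for \<omega>
          using False neg inverse_process_nonneg[of D t \<omega>] by linarith
        then have "{\<omega> \<in> space M. inverse_process D t \<omega> \<le> a} = {}" by simp
        then show ?thesis unfolding c by (simp only: measure_empty order_refl)
      qed
      moreover have "cdf (distr M borel (inverse_process D t)) a \<ge> 0" by (simp add: c)
      ultimately show ?thesis using False by simp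
    qed
    then show "cdf (distr M borel (inverse_process D t)) a = cdf (Ioi_density (heat_kernel t)) a"
      by (simp add: cdf_heat_density[OF t])
  qed
qed

end

section \<open>Markov processes at independent random times\<close>

lemma measurable_ident_path_algebra:
  assumes "\<And>t. t \<in> I \<Longrightarrow> Z t \<in> M \<rightarrow>\<^sub>M borel" "space M = \<Omega>"
  shows "(\<lambda>\<omega>. \<omega>) \<in> M \<rightarrow>\<^sub>M path_algebra \<Omega> I Z"
  unfolding path_algebra_def
  by (intro measurable_vimage_algebra2 measurable_restrict) (use assms in auto)

lemma subalgebra_path_algebra:
  assumes "\<And>t. t \<in> I \<Longrightarrow> Z t \<in> M \<rightarrow>\<^sub>M borel" "space M = \<Omega>"
  shows "subalgebra M (path_algebra \<Omega> I Z)"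
  unfolding subalgebra_def
proof (intro conjI subsetI)
  fix A assume A: "A \<in> sets (path_algebra \<Omega> I Z)"
  have "(\<lambda>\<omega>. \<omega>) -` A \<inter> space M \<in> sets M"
    by (rule measurable_sets[OF measurable_ident_path_algebra[OF assms] A])
  moreover have "A \<subseteq> \<Omega>" using sets.sets_into_space[OF A] by simp
  ultimately show "A \<in> sets M" using assms(2) by (simp add: Int_absorb2)
qed (use assms in simp)

text \<open>An element of \<open>prod_algebra\<close> restricts finitely many coordinates, so these
  generators are the cylinder sets of the process. They form a family stable under intersection, to
  which a \<pi>-\<lambda> argument applies.\<close>

lemma sets_path_algebra:
  "sets (path_algebra \<Omega> I Z) = sigma_sets \<Omega> {(\<lambda>\<omega>. \<lambda>t\<in>I. Z t \<omega>) -` A \<inter> \<Omega> |A. A \<in> prod_algebra I (\<lambda>_. borel)}"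
proof -
  have "sets (path_algebra \<Omega> I Z) = {(\<lambda>\<omega>. \<lambda>t\<in>I. Z t \<omega>) -` A \<inter> \<Omega> |A. A \<in> sets (\<Pi>\<^sub>M t\<in>I. borel)}"
    unfolding path_algebra_def by (rule sets_vimage_algebra2) (auto simp: space_PiM)
  also have "\<dots> = sigma_sets \<Omega> {(\<lambda>\<omega>. \<lambda>t\<in>I. Z t \<omega>) -` A \<inter> \<Omega> |A. A \<in> prod_algebra I (\<lambda>_. borel)}"
    unfolding sets_PiM by (rule sigma_sets_vimage_commute) auto
  finally show ?thesis .
qed

context
  fixes S :: "'w measure" and P :: "'a::euclidean_space \<Rightarrow> 'w measure" and X :: "real \<Rightarrow> 'w \<Rightarrow> 'a"
  assumes markov: "markov_process S P X"
begin

lemma markov_prob: "prob_space (P x)"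
  using markov by (simp add: markov_process_def)

lemma markov_sets [simp, measurable_cong]: "sets (P x) = sets S"
  using markov by (simp add: markov_process_def)

lemma markov_space [simp]: "space (P x) = space S"
  by (rule sets_eq_imp_space_eq) simp

lemma markov_measurable: "t \<ge> 0 \<Longrightarrow> X t \<in> S \<rightarrow>\<^sub>M borel"
  using markov by (simp add: markov_process_def)

definition law :: "real \<Rightarrow> 'a \<Rightarrow> 'a measure" where
  "law t x = distr (P x) borel (X t)"

lemma prob_law: "t \<ge> 0 \<Longrightarrow> prob_space (law t x)"
  unfolding law_def using markov_measurable
  by (intro prob_space.prob_space_distr markov_prob) simp

lemma sets_law [simp, measurable_cong]: "sets (law t x) = sets borel"
  by (simp add: law_def)

lemma emeasure_law:
  "t \<ge> 0 \<Longrightarrow> A \<in> sets borel \<Longrightarrow> emeasure (law t x) A = ennreal (measure (P x) (X t -` A \<inter> space S))"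
  using markov_measurable[of t]
  by (simp add: law_def emeasure_distr finite_measure.emeasure_eq_measure[OF prob_space.finite_measure[OF markov_prob]])

lemma measurable_law: "t \<ge> 0 \<Longrightarrow> law t \<in> borel \<rightarrow>\<^sub>M prob_algebra borel"
proof (intro measurable_prob_algebraI measurable_subprob_algebra)
  assume t: "t \<ge> 0"
  fix A :: "'a set" assume A: "A \<in> sets borel"
  have "(\<lambda>x. measure (P x) (X t -` A \<inter> space S)) \<in> borel_measurable borel"
    using markov t A by (simp add: markov_process_def)
  then show "(\<lambda>a. emeasure (law t a) A) \<in> borel_measurable borel"
    by (subst measurable_cong[OF emeasure_law[OF t A]]) auto
qed (auto intro: prob_law prob_space_imp_subprob_space)

text \<open>The Markov property is assumed for the events \<open>X (s + t) \<in> A\<close> only.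
  With \<open>P x\<close> weighted by the indicator of \<open>B\<close>, it becomes an equality of
  two measures in \<open>A\<close>: the law of \<open>X (s + t)\<close>, and the law of
  \<open>X s\<close> followed by the kernel \<open>law t\<close>. Equal measures integrate every
  nonnegative \<open>\<psi>\<close> alike.\<close>

lemma markov_nn_integral:
  assumes s: "s \<ge> 0" and t: "t \<ge> 0" and B: "B \<in> sets (path_algebra (space S) {0..s} X)"
    and \<psi> [measurable]: "\<psi> \<in> borel_measurable borel"
  shows "(\<integral>\<^sup>+\<omega>. indicator B \<omega> * \<psi> (X (s + t) \<omega>) \<partial>P x)
      = (\<integral>\<^sup>+\<omega>. indicator B \<omega> * (\<integral>\<^sup>+y. \<psi> y \<partial>law t (X s \<omega>)) \<partial>P x)"
proof -
  interpret prob_space "P x" by (rule markov_prob)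
  have Xm [measurable]: "X s \<in> P x \<rightarrow>\<^sub>M borel" "X (s + t) \<in> P x \<rightarrow>\<^sub>M borel"
    using s t markov_measurable by auto
  have sub: "subalgebra (P x) (path_algebra (space S) {0..s} X)"
    by (rule subalgebra_path_algebra) (use markov_measurable in auto)
  interpret F: finite_measure_subalgebra "P x" "path_algebra (space S) {0..s} X"
    by unfold_locales (rule sub)
  have Bm [measurable]: "B \<in> sets (P x)" using sub B by (auto simp: subalgebra_def)
  note lm [measurable] = measurable_prob_algebraD[OF measurable_law[OF t]]
  define \<mu> where "\<mu> = density (P x) (indicator B)"
  have sm [simp, measurable_cong]: "sets \<mu> = sets S" by (simp add: \<mu>_def)
  have Xm' [measurable]: "X s \<in> \<mu> \<rightarrow>\<^sub>M borel" "X (s + t) \<in> \<mu> \<rightarrow>\<^sub>M borel"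
    using s t markov_measurable by auto
  have "distr \<mu> borel (X (s + t)) = distr \<mu> borel (X s) \<bind> law t"
  proof (rule measure_eqI)
    show "sets (distr \<mu> borel (X (s + t))) = sets (distr \<mu> borel (X s) \<bind> law t)"
      by (subst sets_bind[where N=borel]) auto
    fix A assume "A \<in> sets (distr \<mu> borel (X (s + t)))"
    then have A [measurable]: "A \<in> sets borel" by simp
    let ?C = "X (s + t) -` A \<inter> space S"
    have C [measurable]: "?C \<in> sets (P x)" using measurable_sets[OF Xm(2) A] by simp
    have lawA: "(\<lambda>\<omega>. measure (P (X s \<omega>)) (X t -` A \<inter> space S)) \<in> borel_measurable (P x)"
    proof -
      have "(\<lambda>y. measure (P y) (X t -` A \<inter> space S)) \<in> borel_measurable borel"
        using markov t A by (simp add: markov_process_def)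
      from measurable_compose[OF Xm(1) this] show ?thesis .
    qed
    have intA: "integrable (P x) (\<lambda>\<omega>. indicator B \<omega> * measure (P (X s \<omega>)) (X t -` A \<inter> space S))"
    proof (rule integrable_const_bound[of _ 1])
      show "AE \<omega> in P x. norm (indicator B \<omega> * measure (P (X s \<omega>)) (X t -` A \<inter> space S)) \<le> 1"
        using prob_space.prob_le_1[OF markov_prob]
        by (auto simp: abs_mult indicator_def intro!: AE_I2)
    qed (use lawA in simp)
    have "emeasure (distr \<mu> borel (X (s + t))) A = (\<integral>\<^sup>+\<omega>. indicator B \<omega> * indicator ?C \<omega> \<partial>P x)"
      unfolding \<mu>_def using C by (subst emeasure_distr) (auto simp: emeasure_density)
    also have "\<dots> = ennreal (\<integral>\<omega>\<in>B. indicator ?C \<omega> \<partial>P x)"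
    proof -
      have "integrable (P x) (\<lambda>\<omega>. indicator (B \<inter> ?C) \<omega> :: real)"
        by (rule integrable_real_indicator[OF sets.Int[OF Bm C]]) (simp add: emeasure_eq_measure)
      then have "ennreal (\<integral>\<omega>. indicator (B \<inter> ?C) \<omega> \<partial>P x) = (\<integral>\<^sup>+\<omega>. ennreal (indicator (B \<inter> ?C) \<omega>) \<partial>P x)"
        by (intro nn_integral_eq_integral[symmetric]) auto
      then show ?thesis
        by (simp add: set_lebesgue_integral_def indicator_inter_arith ennreal_mult flip: ennreal_indicator)
    qed
    \<comment> \<open>\<open>B\<close> belongs to the past up to time \<open>s\<close>, so over
      \<open>B\<close> the indicator may be replaced by its conditional expectation, which the
      Markov property identifies.\<close>
    also have "(\<integral>\<omega>\<in>B. indicator ?C \<omega> \<partial>P x)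
        = (\<integral>\<omega>\<in>B. real_cond_exp (P x) (path_algebra (space S) {0..s} X) (indicator ?C) \<omega> \<partial>P x)"
      by (rule F.real_cond_exp_intA[OF integrable_real_indicator[OF C] B]) (simp add: emeasure_eq_measure)
    also have "\<dots> = (\<integral>\<omega>. indicator B \<omega> * measure (P (X s \<omega>)) (X t -` A \<inter> space S) \<partial>P x)"
      unfolding set_lebesgue_integral_def
    proof (rule integral_cong_AE)
      have "AE \<omega> in P x. real_cond_exp (P x) (path_algebra (space S) {0..s} X) (indicator ?C) \<omega> =
          measure (P (X s \<omega>)) (X t -` A \<inter> space S)"
        using markov s t A unfolding markov_process_def by blast
      then show "AE \<omega> in P x. indicator B \<omega> *\<^sub>R real_cond_exp (P x) (path_algebra (space S) {0..s} X) (indicator ?C) \<omega> =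
          indicator B \<omega> * measure (P (X s \<omega>)) (X t -` A \<inter> space S)"
        by eventually_elim simp
    qed (use lawA in auto)
    also have "ennreal \<dots> = (\<integral>\<^sup>+\<omega>. ennreal (indicator B \<omega> * measure (P (X s \<omega>)) (X t -` A \<inter> space S)) \<partial>P x)"
      by (rule nn_integral_eq_integral[OF intA, symmetric]) simp
    also have "\<dots> = (\<integral>\<^sup>+\<omega>. indicator B \<omega> * emeasure (law t (X s \<omega>)) A \<partial>P x)"
      by (simp add: emeasure_law[OF t A] ennreal_mult flip: ennreal_indicator)
    also have "\<dots> = (\<integral>\<^sup>+\<omega>. emeasure (law t (X s \<omega>)) A \<partial>\<mu>)"
      unfolding \<mu>_def by (subst nn_integral_density) auto
    also have "\<dots> = (\<integral>\<^sup>+y. emeasure (law t y) A \<partial>distr \<mu> borel (X s))"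
      by (subst nn_integral_distr) auto
    also have "\<dots> = emeasure (distr \<mu> borel (X s) \<bind> law t) A"
      by (rule emeasure_bind[symmetric, where N=borel]) auto
    finally show "emeasure (distr \<mu> borel (X (s + t))) A = emeasure (distr \<mu> borel (X s) \<bind> law t) A" .
  qed
  then have "(\<integral>\<^sup>+y. \<psi> y \<partial>distr \<mu> borel (X (s + t))) = (\<integral>\<^sup>+y. \<psi> y \<partial>(distr \<mu> borel (X s) \<bind> law t))"
    by simp
  also have "\<dots> = (\<integral>\<^sup>+z. \<integral>\<^sup>+y. \<psi> y \<partial>law t z \<partial>distr \<mu> borel (X s))"
    by (rule nn_integral_bind[where B=borel]) auto
  also have "\<dots> = (\<integral>\<^sup>+\<omega>. \<integral>\<^sup>+y. \<psi> y \<partial>law t (X s \<omega>) \<partial>\<mu>)"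
    by (subst nn_integral_distr) auto
  finally show ?thesis
    unfolding \<mu>_def by (simp add: nn_integral_distr nn_integral_density)
qed

text \<open>The factor \<open>\<psi> (X s)\<close> makes the induction on the set of times work: the Markov property at the
  largest time \<open>b\<close> turns it into a function of \<open>X b\<close>.\<close>

lemma measurable_cylinder:
  assumes "finite J" "J \<subseteq> {0..}" "\<And>j. j \<in> J \<Longrightarrow> A j \<in> sets borel"
    and "s \<ge> 0" "\<And>j. j \<in> J \<Longrightarrow> j \<le> s" "\<psi> \<in> borel_measurable borel"
  shows "(\<lambda>x. \<integral>\<^sup>+\<omega>. indicator {\<omega> \<in> space S. \<forall>j\<in>J. X j \<omega> \<in> A j} \<omega> * \<psi> (X s \<omega>) \<partial>P x) \<in> borel_measurable borel"
  using assms
proof (induction J arbitrary: s \<psi> rule: finite_linorder_max_induct)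
  case empty
  note [measurable] = measurable_prob_algebraD[OF measurable_law[OF empty(3)]] empty(5) markov_measurable[OF empty(3)]
  have "(\<integral>\<^sup>+\<omega>. indicator {\<omega> \<in> space S. \<forall>j\<in>{}. X j \<omega> \<in> A j} \<omega> * \<psi> (X s \<omega>) \<partial>P x) = (\<integral>\<^sup>+y. \<psi> y \<partial>law s x)" for x
  proof -
    have "(\<integral>\<^sup>+\<omega>. indicator {\<omega> \<in> space S. \<forall>j\<in>{}. X j \<omega> \<in> A j} \<omega> * \<psi> (X s \<omega>) \<partial>P x) = (\<integral>\<^sup>+\<omega>. \<psi> (X s \<omega>) \<partial>P x)"
      by (intro nn_integral_cong) (auto simp: indicator_def)
    also have "\<dots> = (\<integral>\<^sup>+y. \<psi> y \<partial>law s x)"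
      unfolding law_def by (subst nn_integral_distr) auto
    finally show ?thesis .
  qed
  then show ?case
    using measurable_compose[OF measurable_prob_algebraD[OF measurable_law[OF empty(3)]]
        nn_integral_measurable_subprob_algebra[OF empty(5)]] by simp
next
  case (insert b J)
  have b: "b \<ge> 0" and sb: "s - b \<ge> 0" using insert.prems by auto
  note lm = measurable_prob_algebraD[OF measurable_law[OF sb]]
  \<comment> \<open>\<open>\<phi>\<close> absorbs both the constraint at time \<open>b\<close> and
    the mean of \<open>\<psi> (X s)\<close> given \<open>X b\<close>, so that only the constraints
    in \<open>J\<close> remain.\<close>
  define \<phi> where "\<phi> y = indicator (A b) y * (\<integral>\<^sup>+z. \<psi> z \<partial>law (s - b) y)" for y
  have \<phi>: "\<phi> \<in> borel_measurable borel"
    unfolding \<phi>_def using insert.prems(2)[of b]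
    by (intro borel_measurable_times_ennreal borel_measurable_indicator
        measurable_compose[OF lm nn_integral_measurable_subprob_algebra[OF insert.prems(5)]]) auto
  let ?B = "{\<omega> \<in> space S. \<forall>j\<in>insert b J. X j \<omega> \<in> A j}"
  have B: "?B \<in> sets (path_algebra (space S) {0..b} X)"
  proof -
    let ?F = "path_algebra (space S) {0..b} X"
    have "{\<omega> \<in> space ?F. \<forall>j\<in>insert b J. X j \<omega> \<in> A j} \<in> sets ?F"
    proof (rule sets.sets_Collect_finite_All)
      fix j assume j: "j \<in> insert b J"
      then have "X j \<in> ?F \<rightarrow>\<^sub>M borel"
        using insert by (intro measurable_path_algebra) auto
      from measurable_sets[OF this insert.prems(2)[OF j]]
      show "{\<omega> \<in> space ?F. X j \<omega> \<in> A j} \<in> sets ?F"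
        by (simp add: vimage_def Int_def conj_commute)
    qed (use insert in auto)
    then show ?thesis by simp
  qed
  have "(\<integral>\<^sup>+\<omega>. indicator ?B \<omega> * \<psi> (X s \<omega>) \<partial>P x)
      = (\<integral>\<^sup>+\<omega>. indicator {\<omega> \<in> space S. \<forall>j\<in>J. X j \<omega> \<in> A j} \<omega> * \<phi> (X b \<omega>) \<partial>P x)" for x
  proof -
    have "(\<integral>\<^sup>+\<omega>. indicator ?B \<omega> * \<psi> (X s \<omega>) \<partial>P x)
        = (\<integral>\<^sup>+\<omega>. indicator ?B \<omega> * (\<integral>\<^sup>+z. \<psi> z \<partial>law (s - b) (X b \<omega>)) \<partial>P x)"
      using markov_nn_integral[OF b sb B insert.prems(5), of x] by simp
    also have "\<dots> = (\<integral>\<^sup>+\<omega>. indicator {\<omega> \<in> space S. \<forall>j\<in>J. X j \<omega> \<in> A j} \<omega> * \<phi> (X b \<omega>) \<partial>P x)"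
      by (intro nn_integral_cong) (auto simp: \<phi>_def indicator_def)
    finally show ?thesis .
  qed
  moreover have "(\<lambda>x. \<integral>\<^sup>+\<omega>. indicator {\<omega> \<in> space S. \<forall>j\<in>J. X j \<omega> \<in> A j} \<omega> * \<phi> (X b \<omega>) \<partial>P x) \<in> borel_measurable borel"
    by (rule insert.IH) (use insert b \<phi> in \<open>auto intro: less_imp_le\<close>)
  ultimately show ?case by simp
qed

section \<open>The law of the whole path\<close>

text \<open>This is \<open>P x\<close> restricted to the events of \<open>X\<close>. The restriction
  matters: the hypotheses say how the probability depends on \<open>x\<close> for such events, while
  \<open>S\<close> may contain others.\<close>

definition path_law :: "'a \<Rightarrow> 'w measure" where
  "path_law x = distr (P x) (path_algebra (space S) {0..} X) (\<lambda>\<omega>. \<omega>)"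

lemma measurable_ident_paths: "(\<lambda>\<omega>. \<omega>) \<in> P x \<rightarrow>\<^sub>M path_algebra (space S) {0..} X"
  by (rule measurable_ident_path_algebra) (use markov_measurable in auto)

lemma prob_path_law: "prob_space (path_law x)"
  unfolding path_law_def by (intro prob_space.prob_space_distr markov_prob measurable_ident_paths)

lemma sets_path_law [simp, measurable_cong]: "sets (path_law x) = sets (path_algebra (space S) {0..} X)"
  by (simp add: path_law_def)

text \<open>It is enough to look at cylinder sets, and for these \<open>measurable_cylinder\<close>
  with the constant test function 1 gives the probability. The result makes the law of the path a
  kernel that can be integrated over the starting point.\<close>

lemma measurable_path_law: "path_law \<in> borel \<rightarrow>\<^sub>M prob_algebra (path_algebra (space S) {0..} X)"
proof (rule measurable_prob_algebra_generated[OF sets_path_algebra])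
  let ?p = "\<lambda>\<omega>. \<lambda>t\<in>{0..}. X t \<omega>"
  let ?G = "{?p -` A \<inter> space S |A. A \<in> prod_algebra {0..} (\<lambda>_. borel)}"
  show "Int_stable ?G"
  proof (rule Int_stableI)
    fix a b assume "a \<in> ?G" "b \<in> ?G"
    then obtain A B where AB: "a = ?p -` A \<inter> space S" "b = ?p -` B \<inter> space S"
      "A \<in> prod_algebra {0..} (\<lambda>_. borel)" "B \<in> prod_algebra {0..} (\<lambda>_. borel)" by auto
    then have "A \<inter> B \<in> prod_algebra {0..} (\<lambda>_. borel)"
      using Int_stable_prod_algebra by (auto simp: Int_stable_def)
    then show "a \<inter> b \<in> ?G" using AB by (intro CollectI exI[of _ "A \<inter> B"]) auto
  qed
  show "?G \<subseteq> Pow (space S)" by auto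
  show "prob_space (path_law x)" for x by (rule prob_path_law)
  show "sets (path_law x) = sets (path_algebra (space S) {0..} X)" for x by simp
  fix a assume a: "a \<in> ?G"
  then obtain A where A: "a = ?p -` A \<inter> space S" "A \<in> prod_algebra {0..} (\<lambda>_. borel)" by auto
  have aS: "a \<in> sets (path_algebra (space S) {0..} X)"
    unfolding sets_path_algebra using a by (rule sigma_sets.Basic)
  from A(2) obtain J E where J: "A = prod_emb {0..} (\<lambda>_. borel) J (Pi\<^sub>E J E)" "finite J" "J \<subseteq> {0..}"
    "\<And>i. i \<in> J \<Longrightarrow> E i \<in> sets borel"
    by (elim prod_algebraE) auto
  have aeq: "a = {\<omega> \<in> space S. \<forall>j\<in>J. X j \<omega> \<in> E j}"
    unfolding A(1) J(1) prod_emb_def using J(3)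
    by (auto simp: PiE_iff subset_iff)
  \<comment> \<open>Inserting 0 covers the empty \<open>J\<close> and gives
    \<open>s \<ge> 0\<close>.\<close>
  define s where "s = Max (insert 0 J)"
  have "emeasure (path_law x) a = (\<integral>\<^sup>+\<omega>. indicator {\<omega> \<in> space S. \<forall>j\<in>J. X j \<omega> \<in> E j} \<omega> * 1 \<partial>P x)" for x
  proof -
    have sub: "subalgebra (P x) (path_algebra (space S) {0..} X)"
      by (rule subalgebra_path_algebra) (use markov_measurable in auto)
    then have aP: "a \<in> sets (P x)" using aS by (auto simp: subalgebra_def)
    have "emeasure (path_law x) a = emeasure (P x) a"
      unfolding path_law_def using aS aP sets.sets_into_space[OF aP] measurable_ident_paths[of x]
      by (subst emeasure_distr) (auto simp: Int_absorb2)
    then show ?thesis using aP by (simp add: aeq[symmetric])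
  qed
  moreover have "(\<lambda>x. \<integral>\<^sup>+\<omega>. indicator {\<omega> \<in> space S. \<forall>j\<in>J. X j \<omega> \<in> E j} \<omega> * (\<lambda>_. 1) (X s \<omega>) \<partial>P x) \<in> borel_measurable borel"
    using J by (intro measurable_cylinder[where s=s and \<psi>="\<lambda>_. 1"]) (auto simp: s_def)
  ultimately show "(\<lambda>x. emeasure (path_law x) a) \<in> borel_measurable borel" by simp
qed

text \<open>Cutting off negative times extends the process to a jointly measurable one on the whole line;
  the values at negative times never matter.\<close>

lemma measurable_process:
  "(\<lambda>(s, \<omega>). X (max 0 s) \<omega>) \<in> borel \<Otimes>\<^sub>M path_algebra (space S) {0..} X \<rightarrow>\<^sub>M borel"
proof -
  have 1: "(\<lambda>(t, \<omega>). X t \<omega>) \<in> restrict_space borel {0..} \<Otimes>\<^sub>M path_algebra (space S) {0..} X \<rightarrow>\<^sub>M borel"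
    using markov by (simp add: markov_process_def)
  have "(\<lambda>p. (max 0 (fst p :: real), snd p)) \<in> borel \<Otimes>\<^sub>M path_algebra (space S) {0..} X
      \<rightarrow>\<^sub>M restrict_space borel {0..} \<Otimes>\<^sub>M path_algebra (space S) {0..} X"
    by (intro measurable_Pair measurable_restrict_space2 borel_measurable_max borel_measurable_const)
      (auto simp: le_max_iff_disj)
  from measurable_compose[OF this 1] show ?thesis by (simp add: case_prod_beta')
qed

lemma law_eq_path_law:
  "s \<ge> 0 \<Longrightarrow> law s x = distr (path_law x) borel (X s)"
  unfolding law_def path_law_def
  by (subst distr_distr) (auto simp: o_def intro: measurable_path_algebra measurable_ident_paths)

text \<open>The kernel \<open>path_law\<close> is pushed forward along the map that evaluates a path
  at a time. As that map is jointly measurable in time and path, the result is jointly measurable in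
  time and starting point.\<close>

lemma measurable_law_joint:
  "(\<lambda>(s, x). law (max 0 s) x) \<in> borel \<Otimes>\<^sub>M borel \<rightarrow>\<^sub>M prob_algebra borel"
proof -
  have 1: "(\<lambda>p. path_law (snd p)) \<in> borel \<Otimes>\<^sub>M borel \<rightarrow>\<^sub>M prob_algebra (path_algebra (space S) {0..} X)"
    by (rule measurable_compose[OF measurable_snd measurable_path_law])
  have "(\<lambda>q. (fst (fst q), snd q)) \<in> (borel \<Otimes>\<^sub>M borel) \<Otimes>\<^sub>M path_algebra (space S) {0..} X
      \<rightarrow>\<^sub>M (borel :: real measure) \<Otimes>\<^sub>M path_algebra (space S) {0..} X"
    by measurable
  from measurable_compose[OF this measurable_process]
  have 2: "(\<lambda>(p, \<omega>). X (max 0 (fst p)) \<omega>) \<in> (borel \<Otimes>\<^sub>M borel) \<Otimes>\<^sub>M path_algebra (space S) {0..} X \<rightarrow>\<^sub>M borel"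
    by (simp add: case_prod_beta')
  from measurable_distr_prob_space2[OF 1 2] show ?thesis
    by (simp add: law_eq_path_law case_prod_beta')
qed

section \<open>The law at an independent random time\<close>

definition mixture :: "real measure \<Rightarrow> 'a \<Rightarrow> 'a measure" where
  "mixture \<mu> x = distr (\<mu> \<Otimes>\<^sub>M path_law x) borel (\<lambda>(s, \<omega>). X (max 0 s) \<omega>)"

text \<open>Independence says that the pair of \<open>\<tau> \<omega>\<close> and
  \<open>\<omega>\<close> has a product law, provided that the second component is seen only through
  the \<sigma>-algebra of \<open>X\<close>. The value of \<open>X\<close> at time
  \<open>\<tau>\<close> is a measurable function of this pair.\<close>

lemma distr_at_random_time:
  assumes \<tau>: "\<tau> \<in> path_algebra (space S) {0..} W \<rightarrow>\<^sub>M borel" and \<tau>0: "\<And>\<omega>. \<omega> \<in> space S \<Longrightarrow> \<tau> \<omega> \<ge> 0"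
    and indep: "independent_processes (P x) X W"
  shows "(\<lambda>\<omega>. X (\<tau> \<omega>) \<omega>) \<in> P x \<rightarrow>\<^sub>M borel"
    and "distr (P x) borel (\<lambda>\<omega>. X (\<tau> \<omega>) \<omega>) = mixture (distr (P x) borel \<tau>) x"
proof -
  interpret prob_space "P x" by (rule markov_prob)
  let ?N = "path_algebra (space S) {0..} X" and ?W = "path_algebra (space S) {0..} W"
  have ind: "indep_set (sets ?N) (sets ?W)"
    using indep by (simp add: independent_processes_def)
  have WS: "sets ?W \<subseteq> sets (P x)" using ind by (simp add: indep_sets2_eq)
  have \<tau>m: "\<tau> \<in> P x \<rightarrow>\<^sub>M borel"
    using \<tau> WS by (auto simp: measurable_def)
  have pm: "(\<lambda>\<omega>. (\<tau> \<omega>, \<omega>)) \<in> P x \<rightarrow>\<^sub>M borel \<Otimes>\<^sub>M ?N"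
    using \<tau>m measurable_ident_paths by (rule measurable_Pair)
  interpret T: prob_space "distr (P x) borel \<tau>" by (rule prob_space_distr[OF \<tau>m])
  interpret L: prob_space "path_law x" by (rule prob_path_law)
  have eq: "distr (P x) borel \<tau> \<Otimes>\<^sub>M path_law x = distr (P x) (borel \<Otimes>\<^sub>M ?N) (\<lambda>\<omega>. (\<tau> \<omega>, \<omega>))"
  proof (rule pair_measure_eqI)
    show "sets (distr (P x) borel \<tau> \<Otimes>\<^sub>M path_law x) = sets (distr (P x) (borel \<Otimes>\<^sub>M ?N) (\<lambda>\<omega>. (\<tau> \<omega>, \<omega>)))"
      by (simp cong: sets_pair_measure_cong)
    fix A B assume "A \<in> sets (distr (P x) borel \<tau>)" and "B \<in> sets (path_law x)"
    then have A: "A \<in> sets borel" and B: "B \<in> sets ?N" by auto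
    have W: "\<tau> -` A \<inter> space S \<in> sets ?W" using measurable_sets[OF \<tau> A] by simp
    have BS: "B \<subseteq> space S" using sets.sets_into_space[OF B] by simp
    have "emeasure (distr (P x) borel \<tau>) A * emeasure (path_law x) B
        = ennreal (prob (\<tau> -` A \<inter> space S) * prob B)"
      using A B \<tau>m measurable_ident_paths[of x] BS
      by (simp add: path_law_def emeasure_distr emeasure_eq_measure Int_absorb2 ennreal_mult)
    also have "\<dots> = ennreal (prob (B \<inter> (\<tau> -` A \<inter> space S)))"
      using indep_setD[OF ind B W] by (simp add: mult.commute)
    also have "\<dots> = emeasure (P x) ((\<lambda>\<omega>. (\<tau> \<omega>, \<omega>)) -` (A \<times> B) \<inter> space (P x))"
      unfolding emeasure_eq_measure using BS by (intro arg_cong[where f="\<lambda>C. ennreal (prob C)"]) auto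
    also have "\<dots> = emeasure (distr (P x) (borel \<Otimes>\<^sub>M ?N) (\<lambda>\<omega>. (\<tau> \<omega>, \<omega>))) (A \<times> B)"
      by (rule emeasure_distr[OF pm, symmetric]) (use A B in simp)
    finally show "emeasure (distr (P x) borel \<tau>) A * emeasure (path_law x) B
        = emeasure (distr (P x) (borel \<Otimes>\<^sub>M ?N) (\<lambda>\<omega>. (\<tau> \<omega>, \<omega>))) (A \<times> B)" .
  qed (rule T.sigma_finite_measure_axioms L.sigma_finite_measure_axioms)+
  have Z: "X (\<tau> \<omega>) \<omega> = (\<lambda>(s, \<omega>). X (max 0 s) \<omega>) (\<tau> \<omega>, \<omega>)" if "\<omega> \<in> space (P x)" for \<omega>
    using \<tau>0[of \<omega>] that by (simp add: max_def)
  show "(\<lambda>\<omega>. X (\<tau> \<omega>) \<omega>) \<in> P x \<rightarrow>\<^sub>M borel"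
    using measurable_compose[OF pm measurable_process] by (subst measurable_cong[OF Z]) auto
  show "distr (P x) borel (\<lambda>\<omega>. X (\<tau> \<omega>) \<omega>) = mixture (distr (P x) borel \<tau>) x"
    unfolding mixture_def eq
    by (subst distr_distr[OF measurable_process pm]) (auto intro!: distr_cong simp: Z)
qed

lemma measurable_mixture:
  assumes "real_distribution \<mu>"
  shows "mixture \<mu> \<in> borel \<rightarrow>\<^sub>M prob_algebra borel"
proof -
  interpret real_distribution \<mu> by fact
  have "\<mu> \<in> space (prob_algebra borel)" by (simp add: space_prob_algebra prob_space_axioms)
  then have "(\<lambda>x. \<mu> \<Otimes>\<^sub>M path_law x) \<in> borel \<rightarrow>\<^sub>M prob_algebra (borel \<Otimes>\<^sub>M path_algebra (space S) {0..} X)"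
    by (intro measurable_pair_prob measurable_path_law measurable_const)
  from measurable_compose[OF this measurable_distr_prob_space[OF measurable_process]]
  show ?thesis by (simp add: mixture_def[abs_def])
qed

lemma nn_integral_mixture:
  assumes "real_distribution \<mu>" and f [measurable]: "f \<in> borel_measurable borel"
  shows "(\<integral>\<^sup>+y. f y \<partial>mixture \<mu> x) = (\<integral>\<^sup>+s. \<integral>\<^sup>+y. f y \<partial>law (max 0 s) x \<partial>\<mu>)"
proof -
  interpret M: real_distribution \<mu> by fact
  interpret L: prob_space "path_law x" by (rule prob_path_law)
  have m: "(\<lambda>(s, \<omega>). X (max 0 s) \<omega>) \<in> \<mu> \<Otimes>\<^sub>M path_law x \<rightarrow>\<^sub>M borel"
    using measurable_process by (simp cong: measurable_cong_sets)
  have "(\<integral>\<^sup>+y. f y \<partial>mixture \<mu> x) = (\<integral>\<^sup>+p. f (case p of (s, \<omega>) \<Rightarrow> X (max 0 s) \<omega>) \<partial>(\<mu> \<Otimes>\<^sub>M path_law x))"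
    unfolding mixture_def by (rule nn_integral_distr[OF m]) simp
  also have "\<dots> = (\<integral>\<^sup>+s. \<integral>\<^sup>+\<omega>. f (X (max 0 s) \<omega>) \<partial>path_law x \<partial>\<mu>)"
    using measurable_compose[OF m f] by (subst L.nn_integral_fst[symmetric]) auto
  also have "\<dots> = (\<integral>\<^sup>+s. \<integral>\<^sup>+y. f y \<partial>law (max 0 s) x \<partial>\<mu>)"
    by (intro nn_integral_cong)
      (simp add: law_eq_path_law nn_integral_distr measurable_path_algebra cong: measurable_cong_sets)
  finally show ?thesis .
qed

lemma integral_mixture:
  fixes f :: "'a \<Rightarrow> real"
  assumes "real_distribution \<mu>" and f [measurable]: "f \<in> borel_measurable borel" and int: "integrable (mixture \<mu> x) f"
  shows "(\<integral>y. f y \<partial>mixture \<mu> x) = (\<integral>s. \<integral>y. f y \<partial>law (max 0 s) x \<partial>\<mu>)"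
proof -
  interpret M: real_distribution \<mu> by fact
  interpret L: prob_space "path_law x" by (rule prob_path_law)
  interpret pair_sigma_finite \<mu> "path_law x" ..
  have m: "(\<lambda>(s, \<omega>). X (max 0 s) \<omega>) \<in> \<mu> \<Otimes>\<^sub>M path_law x \<rightarrow>\<^sub>M borel"
    using measurable_process by (simp cong: measurable_cong_sets)
  have int': "integrable (\<mu> \<Otimes>\<^sub>M path_law x) (\<lambda>p. f (case p of (s, \<omega>) \<Rightarrow> X (max 0 s) \<omega>))"
    using int unfolding mixture_def by (subst (asm) integrable_distr_eq[OF m]) auto
  have "(\<integral>y. f y \<partial>mixture \<mu> x) = (\<integral>p. f (case p of (s, \<omega>) \<Rightarrow> X (max 0 s) \<omega>) \<partial>(\<mu> \<Otimes>\<^sub>M path_law x))"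
    unfolding mixture_def by (rule integral_distr[OF m]) simp
  also have "\<dots> = (\<integral>s. \<integral>\<omega>. f (X (max 0 s) \<omega>) \<partial>path_law x \<partial>\<mu>)"
    using integral_fst'[OF int'] by simp
  also have "\<dots> = (\<integral>s. \<integral>y. f y \<partial>law (max 0 s) x \<partial>\<mu>)"
    by (intro Bochner_Integration.integral_cong)
      (auto simp: law_eq_path_law integral_distr measurable_path_algebra cong: measurable_cong_sets)
  finally show ?thesis .
qed

end

section \<open>Integrals over the orbits of a semigroup\<close>

text \<open>The Cauchy criterion over nested boxes transfers from \<open>g\<close> to
  \<open>F\<close>: what \<open>F\<close> contributes between two boxes is bounded in norm by the
  contribution of \<open>g\<close>. Continuity supplies integrability on each box.\<close>

lemma integrable_on_Ici_dominated:
  fixes F :: "real \<Rightarrow> 'b::banach"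
  assumes cont: "continuous_on {0..} F" and g: "g integrable_on {0..}"
    and le: "\<And>x. x \<ge> 0 \<Longrightarrow> norm (F x) \<le> g x"
  shows "F integrable_on {0..}"
proof (rule integrable_alt_subset[THEN iffD2], intro conjI allI impI)
  let ?F = "\<lambda>x. if x \<in> {0..} then F x else 0" and ?g = "\<lambda>x. if x \<in> {0..} then g x else 0"
  show Fi: "?F integrable_on cbox a b" for a b
  proof -
    have "{0..} \<inter> cbox a b = {max 0 a..b}" by auto
    moreover have "F integrable_on {max 0 a..b}"
      by (rule integrable_continuous_interval[OF continuous_on_subset[OF cont]]) auto
    ultimately show ?thesis unfolding integrable_restrict_Int by simp
  qed
  fix e :: real assume "e > 0"
  note g_alt = g[THEN integrable_alt_subset[THEN iffD1]]
  have gi: "?g integrable_on cbox a b" for a b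
    by (rule conjunct1[OF g_alt, rule_format])
  from conjunct2[OF g_alt, rule_format, OF \<open>e > 0\<close>]
  obtain B where B: "B > 0" and gB: "\<And>a b c d. ball 0 B \<subseteq> cbox a b \<Longrightarrow> cbox a b \<subseteq> cbox c d \<Longrightarrow>
      norm (integral (cbox a b) ?g - integral (cbox c d) ?g) < e"
    by (elim exE conjE) (rule that, auto)
  have "norm (integral (cbox a b) ?F - integral (cbox c d) ?F) < e"
    if ab: "ball 0 B \<subseteq> cbox a b" and cd: "cbox a b \<subseteq> cbox c d" for a b c d :: real
  proof -
    have abcd: "cbox a b \<inter> cbox c d = cbox a b" using cd by blast
    \<comment> \<open>The difference of the integrals over two nested boxes is written as one
      integral over the larger box, of a function that vanishes on the smaller one; in this form
      \<open>F\<close> and \<open>g\<close> can be compared pointwise.\<close>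
    have split: "integral (cbox c d) H - integral (cbox a b) H = integral (cbox c d) (\<lambda>x. H x - (if x \<in> cbox a b then H x else 0))"
      and int: "(\<lambda>x. H x - (if x \<in> cbox a b then H x else 0)) integrable_on cbox c d"
      if H: "\<And>a b. H integrable_on cbox a b" for H :: "real \<Rightarrow> 'c::banach"
    proof -
      have r: "(\<lambda>x. if x \<in> cbox a b then H x else 0) integrable_on cbox c d"
        unfolding integrable_restrict_Int abcd by (rule H)
      show "(\<lambda>x. H x - (if x \<in> cbox a b then H x else 0)) integrable_on cbox c d"
        by (rule integrable_diff[OF H r])
      have "integral (cbox c d) (\<lambda>x. if x \<in> cbox a b then H x else 0) = integral (cbox a b) H"
        unfolding integral_restrict_Int abcd ..
      then show "integral (cbox c d) H - integral (cbox a b) H = integral (cbox c d) (\<lambda>x. H x - (if x \<in> cbox a b then H x else 0))"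
        using integral_diff[OF H r] by simp
    qed
    have "norm (integral (cbox c d) ?F - integral (cbox a b) ?F) \<le> integral (cbox c d) ?g - integral (cbox a b) ?g"
      unfolding split[OF Fi] split[OF gi]
      by (rule integral_norm_bound_integral[OF int[OF Fi] int[OF gi]]) (use le in auto)
    also have "\<dots> < e" using gB[OF ab cd] by (simp add: norm_minus_commute abs_less_iff)
    finally show ?thesis by (simp add: norm_minus_commute)
  qed
  then show "\<exists>B>0. \<forall>a b c d. ball 0 B \<subseteq> cbox a b \<and> cbox a b \<subseteq> cbox c d \<longrightarrow>
      norm (integral (cbox a b) ?F - integral (cbox c d) ?F) < e"
    using B by blast
qed

lemma integral_Ici_limit:
  fixes F :: "real \<Rightarrow> 'b::banach"
  assumes "F integrable_on {0..}"
  shows "(\<lambda>n::nat. integral {0..real n} F) \<longlonglongrightarrow> integral {0..} F"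
proof (rule LIMSEQ_I)
  fix e :: real assume e: "e > 0"
  have "(F has_integral integral {0..} F) {0..}" using assms by (rule integrable_integral)
  then obtain B where B: "B > 0" "\<And>a b. ball 0 B \<subseteq> cbox a b \<Longrightarrow>
      norm (integral (cbox a b) (\<lambda>x. if x \<in> {0..} then F x else 0) - integral {0..} F) < e"
    unfolding has_integral_alt' using e by blast
  obtain N :: nat where N: "B < real N" using reals_Archimedean2 by blast
  have "norm (integral {0..real n} F - integral {0..} F) < e" if "n \<ge> N" for n
  proof -
    have "ball 0 B \<subseteq> cbox (- real n) (real n)"
      using N that by (auto simp: ball_def dist_norm)
    moreover have "{0..} \<inter> cbox (- real n) (real n) = {0..real n}" by auto
    ultimately show ?thesis
      using B(2)[of "- real n" "real n"] unfolding integral_restrict_Int by simp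
  qed
  then show "\<exists>no. \<forall>n\<ge>no. norm (integral {0..real n} F - integral {0..} F) < e" by blast
qed

text \<open>The real-valued theorem is applied to \<open>norm (F n x - G x)\<close>, which is
  dominated by \<open>g x + g x\<close> and bounds the difference of the integrals.\<close>

lemma dominated_convergence_Ici:
  fixes F :: "nat \<Rightarrow> real \<Rightarrow> 'b::banach"
  assumes cont: "\<And>n. continuous_on {0..} (F n)" "continuous_on {0..} G" and g: "g integrable_on {0..}"
    and le: "\<And>n x. x \<ge> 0 \<Longrightarrow> norm (F n x) \<le> g x" and lim: "\<And>x. x \<ge> 0 \<Longrightarrow> (\<lambda>n. F n x) \<longlonglongrightarrow> G x"
  shows "(\<lambda>n. integral {0..} (F n)) \<longlonglongrightarrow> integral {0..} G"
proof -
  have leG: "norm (G x) \<le> g x" if "x \<ge> 0" for x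
    by (rule LIMSEQ_le_const2[OF tendsto_norm[OF lim[OF that]]]) (use le[OF that] in auto)
  have Fi: "F n integrable_on {0..}" for n by (rule integrable_on_Ici_dominated[OF cont(1) g le])
  have Gi: "G integrable_on {0..}" by (rule integrable_on_Ici_dominated[OF cont(2) g leG])
  have g2: "(\<lambda>x. g x + g x) integrable_on {0..}" by (rule integrable_add[OF g g])
  have le2: "norm (norm (F n x - G x)) \<le> g x + g x" if "x \<ge> 0" for n x
    using norm_triangle_ineq4[of "F n x" "G x"] le[OF that, of n] leG[OF that] by simp
  have di: "(\<lambda>x. norm (F n x - G x)) integrable_on {0..}" for n
    by (rule integrable_on_Ici_dominated[OF _ g2 le2]) (intro continuous_intros cont)
  have "(\<lambda>n. integral {0..} (\<lambda>x. norm (F n x - G x))) \<longlonglongrightarrow> integral {0..} (\<lambda>x::real. 0::real)"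
  proof (rule dominated_convergence(2)[OF di g2])
    show "norm (norm (F n x - G x)) \<le> g x + g x" if "x \<in> {0..}" for n x
      using that by (intro le2) simp
    show "(\<lambda>n. norm (F n x - G x)) \<longlonglongrightarrow> 0" if "x \<in> {0..}" for x
      using that by (intro tendsto_norm_zero LIM_zero lim) simp
  qed
  then have lim0: "(\<lambda>n. integral {0..} (\<lambda>x. norm (F n x - G x))) \<longlonglongrightarrow> 0" by simp
  have "norm (integral {0..} (F n) - integral {0..} G) \<le> integral {0..} (\<lambda>x. norm (F n x - G x))" for n
  proof -
    have "norm (integral {0..} (\<lambda>x. F n x - G x)) \<le> integral {0..} (\<lambda>x. norm (F n x - G x))"
      by (rule integral_norm_bound_integral[OF integrable_diff[OF Fi Gi] di]) simp
    then show ?thesis using integral_diff[OF Fi Gi] by simp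
  qed
  then have "(\<lambda>n. integral {0..} (F n) - integral {0..} G) \<longlonglongrightarrow> 0"
    by (rule Lim_null_comparison[OF always_eventually[OF allI] lim0])
  then show ?thesis by (rule LIM_zero_cancel)
qed

text \<open>It reduces limits at \<open>t\<close>, from either side, to the limit at 0 from the
  right, the only one in which the semigroup is assumed continuous.\<close>

lemma filterlim_abs_diff_at_right:
  fixes t :: real
  shows "filterlim (\<lambda>s. \<bar>s - t\<bar>) (at_right 0) (at t within A)"
  unfolding filterlim_at
proof
  have "((\<lambda>s. \<bar>s - t\<bar>) \<longlongrightarrow> \<bar>t - t\<bar>) (at t within A)" by (intro tendsto_intros)
  then show "((\<lambda>s. \<bar>s - t\<bar>) \<longlongrightarrow> 0) (at t within A)" by simp
  show "\<forall>\<^sub>F s in at t within A. \<bar>s - t\<bar> \<in> {0<..} \<and> \<bar>s - t\<bar> \<noteq> 0"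
    by (auto simp: eventually_at intro: exI[of _ 1])
qed

section \<open>Orbits of a bounded semigroup\<close>

locale c0_semigroup =
  fixes T :: "real \<Rightarrow> 'b::banach \<Rightarrow> 'b" and C :: real
  assumes linear: "\<And>t. t \<ge> 0 \<Longrightarrow> bounded_linear (T t)"
    and zero: "T 0 f = f"
    and add: "\<And>s t. s \<ge> 0 \<Longrightarrow> t \<ge> 0 \<Longrightarrow> T (s + t) f = T s (T t f)"
    and bound: "\<And>t. t \<ge> 0 \<Longrightarrow> norm (T t f) \<le> C * norm f"
    and C_nonneg: "C \<ge> 0"
    and strong: "((\<lambda>t. T t f) \<longlongrightarrow> f) (at_right 0)"
begin

abbreviation dom :: "'b set" where "dom \<equiv> generator_domain T"
abbreviation gen :: "'b \<Rightarrow> 'b" where "gen \<equiv> generator T"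

lemma domI:
  assumes "((\<lambda>h. (T h f - f) /\<^sub>R h) \<longlongrightarrow> g) (at_right 0)"
  shows "f \<in> dom" "gen f = g"
  using assms by (auto simp: generator_domain_def generator_def intro: tendsto_Lim)

lemma gen_tendsto: "f \<in> dom \<Longrightarrow> ((\<lambda>h. (T h f - f) /\<^sub>R h) \<longlongrightarrow> gen f) (at_right 0)"
  by (auto simp: generator_domain_def domI)

lemma T_diff: "t \<ge> 0 \<Longrightarrow> T t (f - g) = T t f - T t g"
  using linear by (intro linear_diff bounded_linear.linear)

lemma T_add: "t \<ge> 0 \<Longrightarrow> T t (f + g) = T t f + T t g"
  using linear by (intro linear_add bounded_linear.linear)

lemma T_scaleR: "t \<ge> 0 \<Longrightarrow> T t (c *\<^sub>R f) = c *\<^sub>R T t f"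
  using linear by (intro linear_scale bounded_linear.linear)

lemma gen_diff:
  assumes "f \<in> dom" "g \<in> dom"
  shows "f - g \<in> dom" "gen (f - g) = gen f - gen g"
proof -
  have "((\<lambda>h. (T h f - f) /\<^sub>R h - (T h g - g) /\<^sub>R h) \<longlongrightarrow> gen f - gen g) (at_right 0)"
    by (intro tendsto_diff gen_tendsto assms)
  moreover have "\<forall>\<^sub>F h in at_right 0. (T h f - f) /\<^sub>R h - (T h g - g) /\<^sub>R h = (T h (f - g) - (f - g)) /\<^sub>R h"
    using eventually_at_right_less[of "0::real"]
    by eventually_elim (simp add: T_diff scaleR_diff_right)
  ultimately have *: "((\<lambda>h. (T h (f - g) - (f - g)) /\<^sub>R h) \<longlongrightarrow> gen f - gen g) (at_right 0)"
    by (rule Lim_transform_eventually)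
  show "f - g \<in> dom" "gen (f - g) = gen f - gen g" by (rule domI[OF *])+
qed

lemma gen_scaleR:
  assumes "f \<in> dom"
  shows "c *\<^sub>R f \<in> dom" "gen (c *\<^sub>R f) = c *\<^sub>R gen f"
proof -
  have "((\<lambda>h. c *\<^sub>R ((T h f - f) /\<^sub>R h)) \<longlongrightarrow> c *\<^sub>R gen f) (at_right 0)"
    by (intro tendsto_scaleR tendsto_const gen_tendsto assms)
  moreover have "\<forall>\<^sub>F h in at_right 0. c *\<^sub>R ((T h f - f) /\<^sub>R h) = (T h (c *\<^sub>R f) - c *\<^sub>R f) /\<^sub>R h"
    using eventually_at_right_less[of "0::real"]
    by eventually_elim (simp add: T_scaleR scaleR_diff_right mult.commute)
  ultimately have *: "((\<lambda>h. (T h (c *\<^sub>R f) - c *\<^sub>R f) /\<^sub>R h) \<longlongrightarrow> c *\<^sub>R gen f) (at_right 0)"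
    by (rule Lim_transform_eventually)
  show "c *\<^sub>R f \<in> dom" "gen (c *\<^sub>R f) = c *\<^sub>R gen f" by (rule domI[OF *])+
qed

lemma strong_diff: "((\<lambda>h. T h f - f) \<longlongrightarrow> 0) (at_right 0)"
  using tendsto_diff[OF strong tendsto_const, of f f] by simp

text \<open>The operator of the earlier time is factored out of the difference, and its norm is at
  most \<open>C\<close>.\<close>

lemma T_diff_bound:
  assumes "s \<ge> 0" "t \<ge> 0"
  shows "norm (T s f - T t f) \<le> C * norm (T \<bar>s - t\<bar> f - f)"
proof -
  have *: "norm (T s f - T t f) \<le> C * norm (T (s - t) f - f)" if "s \<ge> t" "t \<ge> 0" for s t
  proof -
    have "T s f - T t f = T t (T (s - t) f - f)"
      using add[of t "s - t" f] that by (simp add: T_diff)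
    then show ?thesis using bound[OF that(2)] by simp
  qed
  show ?thesis
  proof (cases "s \<ge> t")
    case True then show ?thesis using *[of t s] assms by simp
  next
    case False then show ?thesis using *[of s t] assms by (simp add: norm_minus_commute)
  qed
qed

lemma continuous_orbit: "continuous_on {0..} (\<lambda>t. T t f)"
  unfolding continuous_on_def
proof
  fix t :: real assume t: "t \<in> {0..}"
  have "((\<lambda>s. T s f - T t f) \<longlongrightarrow> 0) (at t within {0..})"
  proof (rule Lim_null_comparison)
    show "\<forall>\<^sub>F s in at t within {0..}. norm (T s f - T t f) \<le> C * norm (T \<bar>s - t\<bar> f - f)"
      using t by (auto simp: eventually_at_filter intro!: always_eventually T_diff_bound)
    have "((\<lambda>s. T \<bar>s - t\<bar> f - f) \<longlongrightarrow> 0) (at t within {0..})"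
      by (rule filterlim_compose[OF strong_diff filterlim_abs_diff_at_right])
    from tendsto_mult_right_zero[OF tendsto_norm_zero[OF this]]
    show "((\<lambda>s. C * norm (T \<bar>s - t\<bar> f - f)) \<longlongrightarrow> 0) (at t within {0..})" .
  qed
  then show "((\<lambda>s. T s f) \<longlongrightarrow> T t f) (at t within {0..})" by (rule LIM_zero_cancel)
qed

text \<open>To the right of \<open>t\<close> the quotient is \<open>T t\<close> applied to the
  quotient at 0. To the left the operator that is factored out belongs to the moving point
  \<open>s\<close>; replacing \<open>T s\<close> by \<open>T t\<close> in the derivative costs the
  second summand of the majorant.\<close>

lemma orbit_derivative:
  assumes f: "f \<in> dom" and t: "t \<ge> 0"
  shows "((\<lambda>s. T s f) has_vector_derivative T t (gen f)) (at t within {0..})"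
  unfolding has_vector_derivative_def has_derivative_iff_norm
proof
  show "bounded_linear (\<lambda>x. x *\<^sub>R T t (gen f))" by (rule bounded_linear_scaleR_left)
  let ?g = "gen f"
  let ?r = "\<lambda>h. norm ((T h f - f) /\<^sub>R h - ?g)"
  show "((\<lambda>y. norm (T y f - T t f - (y - t) *\<^sub>R T t ?g) / norm (y - t)) \<longlongrightarrow> 0) (at t within {0..})"
  proof (rule Lim_null_comparison)
    have r0: "((\<lambda>h. (T h f - f) /\<^sub>R h - ?g) \<longlongrightarrow> 0) (at_right 0)"
      using gen_tendsto[OF f] by (rule LIM_zero)
    have "((\<lambda>s. C * ?r \<bar>s - t\<bar> + C * norm (T \<bar>s - t\<bar> ?g - ?g)) \<longlongrightarrow> C * 0 + C * 0) (at t within {0..})"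
      by (intro tendsto_intros tendsto_norm_zero filterlim_compose[OF r0 filterlim_abs_diff_at_right]
          filterlim_compose[OF strong_diff filterlim_abs_diff_at_right])
    then show "((\<lambda>s. C * ?r \<bar>s - t\<bar> + C * norm (T \<bar>s - t\<bar> ?g - ?g)) \<longlongrightarrow> 0) (at t within {0..})" by simp
    have rem: "norm (T (a + h) f - T a f - h *\<^sub>R T a ?g) / h \<le> C * ?r h" if "a \<ge> 0" "h > 0" for a h
    proof -
      have "T (a + h) f - T a f - h *\<^sub>R T a ?g = T a (h *\<^sub>R ((T h f - f) /\<^sub>R h - ?g))"
        using that add[of a h f] by (simp add: T_diff T_scaleR scaleR_diff_right)
      then have "norm (T (a + h) f - T a f - h *\<^sub>R T a ?g) \<le> C * (h * ?r h)"
        using bound[OF that(1), of "h *\<^sub>R ((T h f - f) /\<^sub>R h - ?g)"] that by simp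
      then show ?thesis using that by (simp add: divide_le_eq mult_ac)
    qed
    have "norm (norm (T s f - T t f - (s - t) *\<^sub>R T t ?g) / norm (s - t))
        \<le> C * ?r \<bar>s - t\<bar> + C * norm (T \<bar>s - t\<bar> ?g - ?g)" if s: "s \<ge> 0" "s \<noteq> t" for s
    proof (cases "s > t")
      case True
      then show ?thesis
        using rem[of t "s - t"] t C_nonneg by (simp add: add_increasing2)
    next
      case False
      \<comment> \<open>The quotient is expanded at the earlier point \<open>s\<close>, so that
        \<open>rem\<close> applies with \<open>a = s\<close>.\<close>
      define h where "h = t - s"
      have h: "h > 0" "t = s + h" using False s by (auto simp: h_def)
      have "T s f - T t f - (s - t) *\<^sub>R T t ?g
          = - (T (s + h) f - T s f - h *\<^sub>R T s ?g) + h *\<^sub>R (T t ?g - T s ?g)"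
        using h by (simp add: algebra_simps)
      then have "norm (T s f - T t f - (s - t) *\<^sub>R T t ?g)
          \<le> norm (T (s + h) f - T s f - h *\<^sub>R T s ?g) + h * norm (T t ?g - T s ?g)"
        using norm_triangle_ineq[of "- (T (s + h) f - T s f - h *\<^sub>R T s ?g)" "h *\<^sub>R (T t ?g - T s ?g)"] h
        by (simp only: norm_minus_cancel norm_scaleR abs_of_pos)
      then have "norm (T s f - T t f - (s - t) *\<^sub>R T t ?g) / h
          \<le> norm (T (s + h) f - T s f - h *\<^sub>R T s ?g) / h + norm (T t ?g - T s ?g)"
        using h divide_right_mono[of _ _ h] by (fastforce simp: add_divide_distrib)
      also have "\<dots> \<le> C * ?r h + C * norm (T h ?g - ?g)"
        using rem[OF s(1) h(1)] T_diff_bound[OF t s(1), of ?g] h by (intro add_mono) auto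
      finally show ?thesis using h by simp
    qed
    then show "\<forall>\<^sub>F s in at t within {0..}. norm (norm (T s f - T t f - (s - t) *\<^sub>R T t ?g) / norm (s - t))
        \<le> C * ?r \<bar>s - t\<bar> + C * norm (T \<bar>s - t\<bar> ?g - ?g)"
      unfolding eventually_at_filter by (intro always_eventually) auto
  qed
qed

section \<open>Operators obtained by integrating orbits against a kernel\<close>

text \<open>A functional calculus for the generator: the heat kernel gives the solution, derivatives
  of the kernel give derivatives of the solution, and \<open>exp (- s * a)\<close> gives the
  resolvent at \<open>a\<close>.\<close>

definition orbit_integral :: "(real \<Rightarrow> real) \<Rightarrow> 'b \<Rightarrow> 'b" where
  "orbit_integral k f = integral {0..} (\<lambda>s. k s *\<^sub>R T s f)"

definition kernel :: "(real \<Rightarrow> real) \<Rightarrow> bool" where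
  "kernel k \<longleftrightarrow> continuous_on {0..} k \<and> (\<lambda>s. \<bar>k s\<bar>) integrable_on {0..}"

lemma kernel_integrable:
  assumes "kernel k"
  shows "(\<lambda>s. k s *\<^sub>R T s f) integrable_on {0..}"
proof (rule integrable_on_Ici_dominated)
  show "continuous_on {0..} (\<lambda>s. k s *\<^sub>R T s f)"
    using assms by (intro continuous_intros continuous_orbit) (simp add: kernel_def)
  show "(\<lambda>s. \<bar>k s\<bar> * (C * norm f)) integrable_on {0..}"
    by (rule integrable_on_mult_left) (use assms in \<open>simp add: kernel_def\<close>)
  show "norm (k x *\<^sub>R T x f) \<le> \<bar>k x\<bar> * (C * norm f)" if "x \<ge> 0" for x
    using bound[OF that] by (simp add: mult_left_mono)
qed

lemma orbit_integral_has_integral: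
  "kernel k \<Longrightarrow> ((\<lambda>s. k s *\<^sub>R T s f) has_integral orbit_integral k f) {0..}"
  unfolding orbit_integral_def by (rule integrable_integral[OF kernel_integrable])

lemma orbit_integral_bound:
  assumes "kernel k"
  shows "norm (orbit_integral k f) \<le> integral {0..} (\<lambda>s. \<bar>k s\<bar>) * C * norm f"
proof -
  have "norm (orbit_integral k f) \<le> integral {0..} (\<lambda>s. \<bar>k s\<bar> * (C * norm f))"
    unfolding orbit_integral_def
  proof (rule integral_norm_bound_integral[OF kernel_integrable[OF assms, of f]])
    show "(\<lambda>s. \<bar>k s\<bar> * (C * norm f)) integrable_on {0..}"
      by (rule integrable_on_mult_left) (use assms in \<open>simp add: kernel_def\<close>)
    show "norm (k x *\<^sub>R T x f) \<le> \<bar>k x\<bar> * (C * norm f)" if "x \<in> {0..}" for x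
      using bound[of x] that by (simp add: mult_left_mono)
  qed
  then show ?thesis by (simp add: mult.assoc)
qed

lemma orbit_integral_linear:
  assumes k: "kernel k"
  shows "bounded_linear (orbit_integral k)"
proof (rule bounded_linear_intro)
  fix f g and r :: real
  show "orbit_integral k (f + g) = orbit_integral k f + orbit_integral k g"
  proof -
    have "orbit_integral k (f + g) = integral {0..} (\<lambda>s. k s *\<^sub>R T s f + k s *\<^sub>R T s g)"
      unfolding orbit_integral_def by (intro integral_cong) (simp add: T_add scaleR_add_right)
    then show ?thesis
      unfolding orbit_integral_def using kernel_integrable[OF k] by (simp add: integral_add)
  qed
  show "orbit_integral k (r *\<^sub>R f) = r *\<^sub>R orbit_integral k f"
  proof -
    have "orbit_integral k (r *\<^sub>R f) = integral {0..} (\<lambda>s. r *\<^sub>R (k s *\<^sub>R T s f))"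
      unfolding orbit_integral_def by (intro integral_cong) (simp add: T_scaleR mult.commute)
    also have "\<dots> = r *\<^sub>R orbit_integral k f"
      unfolding orbit_integral_def by (rule integral_cmul)
    finally show ?thesis .
  qed
  show "norm (orbit_integral k f) \<le> norm f * (integral {0..} (\<lambda>s. \<bar>k s\<bar>) * C)"
    using orbit_integral_bound[OF k, of f] by (simp add: mult_ac)
qed

lemma T_orbit_integral:
  assumes k: "kernel k" and h: "h \<ge> 0"
  shows "T h (orbit_integral k f) = orbit_integral k (T h f)"
proof -
  have "orbit_integral k (T h f) = integral {0..} (T h \<circ> (\<lambda>s. k s *\<^sub>R T s f))"
    unfolding orbit_integral_def
  proof (rule integral_cong)
    fix s :: real assume "s \<in> {0..}"
    then show "k s *\<^sub>R T s (T h f) = (T h \<circ> (\<lambda>s. k s *\<^sub>R T s f)) s"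
      using add[of s h f] add[of h s f] h by (simp add: T_scaleR add.commute)
  qed
  also have "\<dots> = T h (orbit_integral k f)"
    unfolding orbit_integral_def by (rule integral_linear[OF kernel_integrable[OF k] linear[OF h]])
  finally show ?thesis by simp
qed

text \<open>The operator commutes with every \<open>T h\<close>, hence with the difference quotient,
  and being bounded it may be applied to the limit.\<close>

lemma gen_orbit_integral:
  assumes k: "kernel k" and f: "f \<in> dom"
  shows "orbit_integral k f \<in> dom" "gen (orbit_integral k f) = orbit_integral k (gen f)"
proof -
  interpret I: bounded_linear "orbit_integral k" by (rule orbit_integral_linear[OF k])
  have "((\<lambda>h. orbit_integral k ((T h f - f) /\<^sub>R h)) \<longlongrightarrow> orbit_integral k (gen f)) (at_right 0)"
    by (rule I.tendsto[OF gen_tendsto[OF f]])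
  moreover have "\<forall>\<^sub>F h in at_right 0. orbit_integral k ((T h f - f) /\<^sub>R h)
      = (T h (orbit_integral k f) - orbit_integral k f) /\<^sub>R h"
    using eventually_at_right_less[of "0::real"]
    by eventually_elim (simp add: T_orbit_integral[OF k] I.scaleR I.diff)
  ultimately have *: "((\<lambda>h. (T h (orbit_integral k f) - orbit_integral k f) /\<^sub>R h) \<longlongrightarrow> orbit_integral k (gen f)) (at_right 0)"
    by (rule Lim_transform_eventually)
  show "orbit_integral k f \<in> dom" "gen (orbit_integral k f) = orbit_integral k (gen f)"
    by (rule domI[OF *])+
qed

text \<open>The fundamental theorem for \<open>k s *\<^sub>R T s f\<close> on the interval from 0 to
  n, with n tending to infinity. The generator leaves \<open>f\<close> and becomes a derivative of
  the kernel, so the right-hand side can again be put into the domain.\<close>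

lemma orbit_integral_by_parts:
  assumes k: "kernel k" and k': "kernel k'" and f: "f \<in> dom"
    and d: "\<And>s. s \<ge> 0 \<Longrightarrow> (k has_real_derivative k' s) (at s)"
    and lim: "(\<lambda>n. k (real n)) \<longlonglongrightarrow> 0"
  shows "orbit_integral k (gen f) = - (k 0 *\<^sub>R f) - orbit_integral k' f"
proof -
  let ?H = "\<lambda>s. k s *\<^sub>R T s (gen f) + k' s *\<^sub>R T s f"
  have Hi: "?H integrable_on {0..}"
    by (intro integrable_add kernel_integrable k k')
  have "(?H has_integral (k (real n) *\<^sub>R T n f - k 0 *\<^sub>R T 0 f)) {0..real n}" for n :: nat
  proof (rule fundamental_theorem_of_calculus)
    fix s assume s: "s \<in> {0..real n}"
    have "((\<lambda>s. k s *\<^sub>R T s f) has_vector_derivative ?H s) (at s within {0..})"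
      by (rule has_vector_derivative_scaleR[OF has_field_derivative_at_within[OF d] orbit_derivative[OF f]])
        (use s in auto)
    then show "((\<lambda>s. k s *\<^sub>R T s f) has_vector_derivative ?H s) (at s within {0..real n})"
      by (rule has_vector_derivative_within_subset) auto
  qed simp
  then have "integral {0..real n} ?H = k (real n) *\<^sub>R T n f - k 0 *\<^sub>R f" for n :: nat
    by (simp add: integral_unique zero)
  then have "(\<lambda>n. k (real n) *\<^sub>R T n f - k 0 *\<^sub>R f) \<longlonglongrightarrow> integral {0..} ?H"
    using integral_Ici_limit[OF Hi] by simp
  moreover have "(\<lambda>n. k (real n) *\<^sub>R T n f - k 0 *\<^sub>R f) \<longlonglongrightarrow> 0 - k 0 *\<^sub>R f"
  proof (intro tendsto_diff tendsto_const)
    show "(\<lambda>n. k (real n) *\<^sub>R T (real n) f) \<longlonglongrightarrow> 0"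
    proof (rule Lim_null_comparison[OF always_eventually[OF allI]])
      show "norm (k (real n) *\<^sub>R T (real n) f) \<le> norm (k (real n)) * (C * norm f)" for n
        using bound[of "real n" f] by (simp add: mult_left_mono)
      show "(\<lambda>n. norm (k (real n)) * (C * norm f)) \<longlonglongrightarrow> 0"
        by (intro tendsto_mult_left_zero tendsto_norm_zero lim)
    qed
  qed
  ultimately have "integral {0..} ?H = 0 - k 0 *\<^sub>R f" by (rule LIMSEQ_unique)
  moreover have "integral {0..} ?H = orbit_integral k (gen f) + orbit_integral k' f"
    unfolding orbit_integral_def by (intro integral_add kernel_integrable k k')
  ultimately show ?thesis by (simp add: algebra_simps)
qed

end

lemma c0_semigroup_of_bounded:
  fixes T :: "real \<Rightarrow> 'b::banach \<Rightarrow> 'b"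
  assumes "bounded_C0_semigroup T"
  obtains C where "c0_semigroup T C"
proof -
  obtain C where C: "\<And>t f. t \<ge> 0 \<Longrightarrow> norm (T t f) \<le> C * norm f"
    using assms unfolding bounded_C0_semigroup_def by (elim conjE exE) (rule that, blast)
  \<comment> \<open>On the zero space the constant of the hypothesis could be negative, hence the
    maximum.\<close>
  have "c0_semigroup T (max C 0)"
  proof (rule c0_semigroup.intro)
    fix s t :: real and f
    show "bounded_linear (T t)" if "t \<ge> 0" using assms that by (simp add: bounded_C0_semigroup_def)
    show "norm (T t f) \<le> max C 0 * norm f" if "t \<ge> 0"
      using C[OF that, of f] by (rule order.trans) (intro mult_right_mono, auto)
    show "T 0 f = f" using assms by (simp add: bounded_C0_semigroup_def)
    show "T (s + t) f = T s (T t f)" if "s \<ge> 0" "t \<ge> 0"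
      using assms that by (simp add: bounded_C0_semigroup_def)
    show "((\<lambda>t. T t f) \<longlongrightarrow> f) (at_right 0)" using assms by (simp add: bounded_C0_semigroup_def)
  qed auto
  then show ?thesis by (rule that)
qed


section \<open>Moments and derivatives of the heat kernel\<close>

text \<open>It makes the moments of the normal law available, which are used to dominate the
  derivatives of the kernel.\<close>

lemma heat_kernel_eq_normal_density:
  "t > 0 \<Longrightarrow> heat_kernel t s = 2 * normal_density 0 (sqrt (2 * t)) s"
proof -
  assume t: "t > 0"
  have "sqrt (2 * pi * (sqrt (2 * t))\<^sup>2) = sqrt (4 * (pi * t))"
    using t by simp
  also have "\<dots> = 2 * sqrt (pi * t)" by (subst real_sqrt_mult) simp
  finally show ?thesis
    using t by (simp add: heat_kernel_def normal_density_def)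
qed

lemma heat_kernel_moment_integrable:
  assumes "t > 0"
  shows "(\<lambda>s. heat_kernel t s * s ^ n) integrable_on {0..}"
proof -
  have "integrable lborel (\<lambda>s. 2 * (normal_density 0 (sqrt (2 * t)) s * (s - 0) ^ n))"
    using assms by (intro integrable_mult_right integrable_normal_moment) simp
  then have "integrable lborel (\<lambda>s. heat_kernel t s * s ^ n)"
    using assms by (simp add: heat_kernel_eq_normal_density mult.assoc)
  then have "set_integrable lborel {0..} (\<lambda>s. heat_kernel t s * s ^ n)"
    unfolding set_integrable_def by (intro integrable_mult_indicator) auto
  then show ?thesis by (rule set_borel_integral_eq_integral(1))
qed

text \<open>The right-hand sides of the second and the third claim coincide, which is the heat
  equation. The first derivative carries the factor \<open>s\<close> and so vanishes at 0.\<close>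

lemma heat_kernel_derivs:
  assumes "t > 0"
  shows "(heat_kernel t has_real_derivative - (s / (2 * t)) * heat_kernel t s) (at s)"
    and "((\<lambda>s. - (s / (2 * t)) * heat_kernel t s) has_real_derivative (s\<^sup>2 / (4 * t\<^sup>2) - 1 / (2 * t)) * heat_kernel t s) (at s)"
    and "((\<lambda>t. heat_kernel t s) has_real_derivative (s\<^sup>2 / (4 * t\<^sup>2) - 1 / (2 * t)) * heat_kernel t s) (at t)"
proof -
  show 1: "(heat_kernel t has_real_derivative - (s / (2 * t)) * heat_kernel t s) (at s)" for s
  proof -
    have "((\<lambda>s. exp (- s\<^sup>2 / (4 * t))) has_real_derivative exp (- s\<^sup>2 / (4 * t)) * - (s / (2 * t))) (at s)"
      using assms by (auto intro!: derivative_eq_intros)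
    from DERIV_cdivide[OF this, of "sqrt (pi * t)"]
    show ?thesis unfolding heat_kernel_def[abs_def] by (simp add: mult.commute)
  qed
  have "((\<lambda>s. - (s / (2 * t)) * heat_kernel t s) has_real_derivative
      - (1 / (2 * t)) * heat_kernel t s + - (s / (2 * t)) * heat_kernel t s * - (s / (2 * t))) (at s)"
    using assms by (auto intro!: derivative_eq_intros 1 simp: field_simps)
  then show "((\<lambda>s. - (s / (2 * t)) * heat_kernel t s) has_real_derivative (s\<^sup>2 / (4 * t\<^sup>2) - 1 / (2 * t)) * heat_kernel t s) (at s)"
    by (rule DERIV_cong) (simp add: power2_eq_square algebra_simps)
  have q: "((\<lambda>t. - s\<^sup>2 / (4 * t)) has_real_derivative s\<^sup>2 / (4 * t\<^sup>2)) (at t)"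
    using assms by (auto intro!: derivative_eq_intros simp: power2_eq_square)
  have r: "((\<lambda>t. sqrt (pi * t)) has_real_derivative sqrt (pi * t) / (2 * t)) (at t)"
  proof -
    have "((\<lambda>t. sqrt (pi * t)) has_real_derivative pi * inverse (sqrt (pi * t)) / 2) (at t)"
      using assms by (auto intro!: derivative_eq_intros simp: mult_less_0_iff)
    moreover have "pi * inverse (sqrt (pi * t)) / 2 = sqrt (pi * t) / (2 * t)"
    proof -
      have "pi * t = sqrt (pi * t) * sqrt (pi * t)" using assms by simp
      then show ?thesis using assms by (simp add: divide_simps mult_less_0_iff)
    qed
    ultimately show ?thesis by simp
  qed
  have "((\<lambda>t. heat_kernel t s) has_real_derivative
      (exp (- s\<^sup>2 / (4 * t)) * (s\<^sup>2 / (4 * t\<^sup>2)) * sqrt (pi * t) - exp (- s\<^sup>2 / (4 * t)) * (sqrt (pi * t) / (2 * t)))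
        / (sqrt (pi * t) * sqrt (pi * t))) (at t)"
    unfolding heat_kernel_def using assms
    by (intro DERIV_divide DERIV_chain2[OF DERIV_exp q] r) auto
  then show "((\<lambda>t. heat_kernel t s) has_real_derivative (s\<^sup>2 / (4 * t\<^sup>2) - 1 / (2 * t)) * heat_kernel t s) (at t)"
  proof (rule DERIV_cong)
    have "(e * a * w - e * (w / b)) / (w * w) = (a - 1 / b) * (e / w)" if "w > 0" for e a w b :: real
      using that by (simp add: field_simps)
    from this[of "sqrt (pi * t)"]
    show "(exp (- s\<^sup>2 / (4 * t)) * (s\<^sup>2 / (4 * t\<^sup>2)) * sqrt (pi * t) - exp (- s\<^sup>2 / (4 * t)) * (sqrt (pi * t) / (2 * t)))
        / (sqrt (pi * t) * sqrt (pi * t)) = (s\<^sup>2 / (4 * t\<^sup>2) - 1 / (2 * t)) * heat_kernel t s"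
      unfolding heat_kernel_def using assms by (simp only: real_sqrt_gt_0_iff mult_pos_pos pi_gt_zero)
  qed
qed

lemma continuous_on_heat_kernel [continuous_intros]: "t > 0 \<Longrightarrow> continuous_on A (heat_kernel t)"
  unfolding heat_kernel_def by (intro continuous_intros) auto

lemma has_integral_Ioi_iff_Ici:
  fixes f :: "real \<Rightarrow> 'b::banach"
  shows "(f has_integral y) {0<..} \<longleftrightarrow> (f has_integral y) {0..}"
  by (rule has_integral_spike_set_eq) (auto intro: negligible_subset[of "{0}"])

lemma set_integrable_imp_has_integral_Ici:
  fixes f :: "real \<Rightarrow> real"
  assumes "set_integrable lborel {0<..} f"
  shows "(f has_integral (\<integral>s\<in>{0<..}. f s \<partial>lborel)) {0..}"
  using set_borel_integral_eq_integral[OF assms] has_integral_Ioi_iff_Ici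
  by (metis integrable_integral)

lemma heat_kernel_has_integral: "t > 0 \<Longrightarrow> (heat_kernel t has_integral 1) {0..}"
  using set_integrable_imp_has_integral_Ici[OF heat_kernel_integral(1)] heat_kernel_integral(2) by simp

text \<open>By the formula for the first derivative, \<open>- (2 * t) * heat_kernel t\<close> is a
  primitive. The moment is of order \<open>sqrt t\<close>, which expresses that the random time
  tends to 0 with \<open>t\<close>.\<close>

lemma heat_kernel_first_moment:
  assumes t: "t > 0"
  shows "((\<lambda>s. s * heat_kernel t s) has_integral 2 * t / sqrt (pi * t)) {0..}"
proof -
  have D: "DERIV (\<lambda>s. - (2 * t) * heat_kernel t s) s :> s * heat_kernel t s" for s
    using DERIV_cmult[OF heat_kernel_derivs(1)[OF t], of "- (2 * t)" s] t by simp
  have C: "isCont (\<lambda>s. s * heat_kernel t s) s" for s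
    using continuous_on_heat_kernel[OF t, of UNIV]
    by (intro continuous_intros) (auto simp: continuous_on_eq_continuous_at)
  have B: "((\<lambda>s. - (2 * t) * heat_kernel t s) \<longlongrightarrow> 0) at_top"
    unfolding heat_kernel_def using t by real_asymp
  have A: "((\<lambda>s. - (2 * t) * heat_kernel t s) \<longlongrightarrow> - (2 * t) * heat_kernel t 0) (at_right 0)"
    using DERIV_isCont[OF D[of 0]] by (auto simp: isCont_def filterlim_at_split)
  have P: "0 \<le> s * heat_kernel t s" if "s > 0" for s
    using that heat_kernel_nonneg[OF t, of s] by simp
  note F = FTC_nonneg_Ioi[OF D C P A B]
  have "(\<integral>s\<in>{0<..}. s * heat_kernel t s \<partial>lborel) = 2 * t / sqrt (pi * t)"
    by (subst F(2)) (simp_all add: heat_kernel_def)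
  then show ?thesis using set_integrable_imp_has_integral_Ici[OF F(1)] by simp
qed

section \<open>The evolution driven by the heat kernel\<close>

context c0_semigroup
begin

lemma kernelI:
  assumes "continuous_on {0..} k" "g integrable_on {0..}" "\<And>s. s \<ge> 0 \<Longrightarrow> \<bar>k s\<bar> \<le> g s"
  shows "kernel k"
  unfolding kernel_def
  using assms by (auto intro!: integrable_on_Ici_dominated[OF _ assms(2)] continuous_intros)

lemma kernel_heat: "t > 0 \<Longrightarrow> kernel (heat_kernel t)"
  by (rule kernelI[OF continuous_on_heat_kernel heat_kernel_moment_integrable[of t 0]])
    (auto simp: heat_kernel_nonneg)

lemma kernel_heat_d1: "t > 0 \<Longrightarrow> kernel (\<lambda>s. - (s / (2 * t)) * heat_kernel t s)"
proof (rule kernelI[where g="\<lambda>s. (1 / (2 * t)) * (heat_kernel t s * s ^ 1)"])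
  assume t: "t > 0"
  show "continuous_on {0..} (\<lambda>s. - (s / (2 * t)) * heat_kernel t s)"
    using t by (intro continuous_intros) auto
  show "(\<lambda>s. (1 / (2 * t)) * (heat_kernel t s * s ^ 1)) integrable_on {0..}"
    by (intro integrable_on_mult_right heat_kernel_moment_integrable t)
  show "\<bar>- (s / (2 * t)) * heat_kernel t s\<bar> \<le> (1 / (2 * t)) * (heat_kernel t s * s ^ 1)" if "s \<ge> 0" for s
    using t that heat_kernel_nonneg[OF t, of s] by (simp add: abs_mult mult.commute)
qed

lemma kernel_heat_d2: "t > 0 \<Longrightarrow> kernel (\<lambda>s. (s\<^sup>2 / (4 * t\<^sup>2) - 1 / (2 * t)) * heat_kernel t s)"
proof (rule kernelI[where g="\<lambda>s. (1 / (4 * t\<^sup>2)) * (heat_kernel t s * s ^ 2) + (1 / (2 * t)) * (heat_kernel t s * s ^ 0)"])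
  assume t: "t > 0"
  show "continuous_on {0..} (\<lambda>s. (s\<^sup>2 / (4 * t\<^sup>2) - 1 / (2 * t)) * heat_kernel t s)"
    using t by (intro continuous_intros) auto
  show "(\<lambda>s. (1 / (4 * t\<^sup>2)) * (heat_kernel t s * s ^ 2) + (1 / (2 * t)) * (heat_kernel t s * s ^ 0)) integrable_on {0..}"
    by (intro integrable_add integrable_on_mult_right heat_kernel_moment_integrable t)
  show "\<bar>(s\<^sup>2 / (4 * t\<^sup>2) - 1 / (2 * t)) * heat_kernel t s\<bar>
      \<le> (1 / (4 * t\<^sup>2)) * (heat_kernel t s * s ^ 2) + (1 / (2 * t)) * (heat_kernel t s * s ^ 0)" for s
  proof -
    have "\<bar>s\<^sup>2 / (4 * t\<^sup>2) - 1 / (2 * t)\<bar> \<le> s\<^sup>2 / (4 * t\<^sup>2) + 1 / (2 * t)"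
      using t by (intro order.trans[OF abs_triangle_ineq4]) simp
    then have "\<bar>s\<^sup>2 / (4 * t\<^sup>2) - 1 / (2 * t)\<bar> * heat_kernel t s \<le> (s\<^sup>2 / (4 * t\<^sup>2) + 1 / (2 * t)) * heat_kernel t s"
      using heat_kernel_nonneg[OF t] by (rule mult_right_mono)
    moreover have "\<bar>(s\<^sup>2 / (4 * t\<^sup>2) - 1 / (2 * t)) * heat_kernel t s\<bar> = \<bar>s\<^sup>2 / (4 * t\<^sup>2) - 1 / (2 * t)\<bar> * heat_kernel t s"
      using heat_kernel_nonneg[OF t, of s] by (simp only: abs_mult abs_of_nonneg)
    ultimately show ?thesis by (simp add: distrib_left distrib_right mult.commute)
  qed
qed

lemma heat_kernel_tendsto_zero:
  assumes "t > 0"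
  shows "(\<lambda>n. heat_kernel t (real n)) \<longlonglongrightarrow> 0" "(\<lambda>n. - (real n / (2 * t)) * heat_kernel t (real n)) \<longlonglongrightarrow> 0"
  unfolding heat_kernel_def using assms by real_asymp+

abbreviation evolution :: "real \<Rightarrow> 'b \<Rightarrow> 'b" where
  "evolution t f \<equiv> orbit_integral (heat_kernel t) f"

abbreviation evolution_dt :: "real \<Rightarrow> 'b \<Rightarrow> 'b" where
  "evolution_dt t f \<equiv> orbit_integral (\<lambda>s. (s\<^sup>2 / (4 * t\<^sup>2) - 1 / (2 * t)) * heat_kernel t s) f"

text \<open>Although \<open>f\<close> lies only in the domain of the generator, the generator can be
  applied twice: after one integration by parts \<open>gen (evolution t f)\<close> is a combination
  of \<open>f\<close> and a kernel operator applied to \<open>f\<close>, both of which lie in the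
  domain.\<close>

lemma evolution_gen:
  assumes t: "t > 0" and f: "f \<in> dom"
  shows "evolution t f \<in> dom" "gen (evolution t f) = evolution t (gen f)"
    and "gen (evolution t f) \<in> dom"
    and "gen (gen (evolution t f)) = evolution_dt t f - gen f /\<^sub>R sqrt (pi * t)"
proof -
  let ?k1 = "\<lambda>s. - (s / (2 * t)) * heat_kernel t s"
  show 1: "evolution t f \<in> dom" "gen (evolution t f) = evolution t (gen f)"
    by (rule gen_orbit_integral[OF kernel_heat[OF t] f])+
  have h0: "heat_kernel t 0 = inverse (sqrt (pi * t))"
    by (simp add: heat_kernel_def inverse_eq_divide)
  have 2: "evolution t (gen f) = - heat_kernel t 0 *\<^sub>R f - orbit_integral ?k1 f"
    using orbit_integral_by_parts[OF kernel_heat[OF t] kernel_heat_d1[OF t] f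
        heat_kernel_derivs(1)[OF t] heat_kernel_tendsto_zero(1)[OF t]] by simp
  \<comment> \<open>There is no boundary term: \<open>?k1\<close> vanishes at 0.\<close>
  have 3: "orbit_integral ?k1 (gen f) = - evolution_dt t f"
    using orbit_integral_by_parts[OF kernel_heat_d1[OF t] kernel_heat_d2[OF t] f
        heat_kernel_derivs(2)[OF t] heat_kernel_tendsto_zero(2)[OF t]] by simp
  note k1 = gen_orbit_integral[OF kernel_heat_d1[OF t] f]
  note s = gen_scaleR[OF f, of "- heat_kernel t 0"]
  show "gen (evolution t f) \<in> dom"
    unfolding 1(2) 2 by (rule gen_diff(1)[OF s(1) k1(1)])
  show "gen (gen (evolution t f)) = evolution_dt t f - gen f /\<^sub>R sqrt (pi * t)"
    unfolding 1(2) 2 gen_diff(2)[OF s(1) k1(1)] s(2) k1(2) 3 unfolding h0 by simp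
qed

text \<open>Differentiation under the integral sign, by dominated convergence along sequences; the
  majorant has to serve all times near \<open>t\<close> at once.\<close>

lemma evolution_derivative:
  assumes t: "t > 0"
  shows "((\<lambda>t. evolution t f) has_vector_derivative evolution_dt t f) (at t)"
proof -
  let ?d = "\<lambda>t s. (s\<^sup>2 / (4 * t\<^sup>2) - 1 / (2 * t)) * heat_kernel t s"
  \<comment> \<open>For times \<open>r\<close> between \<open>t / 2\<close> and \<open>2 * t\<close>
    the exponential is largest at \<open>2 * t\<close>, while the root is at least half of
    \<open>sqrt (pi * (2 * t))\<close>, whence the factor 2. The coefficients come from
    \<open>t\<^sup>2 \<le> 4 * r\<^sup>2\<close> and \<open>t \<le> 2 * r\<close>.\<close>
  let ?B = "\<lambda>s. 2 * (s\<^sup>2 / t\<^sup>2 + 1 / t) * heat_kernel (2 * t) s"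
  have dB: "\<bar>?d r s\<bar> \<le> ?B s" if r: "t / 2 \<le> r" "r \<le> 2 * t" for r s
  proof -
    have r0: "r > 0" using t r by linarith
    have "heat_kernel r s \<le> exp (- s\<^sup>2 / (4 * (2 * t))) / (sqrt (pi * (2 * t)) / 2)"
      unfolding heat_kernel_def
    proof (rule frac_le)
      show "exp (- s\<^sup>2 / (4 * r)) \<le> exp (- s\<^sup>2 / (4 * (2 * t)))"
        using r r0 by (auto intro!: divide_left_mono)
      have "sqrt (pi * (2 * t)) / 2 = sqrt (pi * (2 * t)) / sqrt 4" by simp
      also have "\<dots> = sqrt (pi * (2 * t) / 4)" by (rule real_sqrt_divide[symmetric])
      also have "\<dots> \<le> sqrt (pi * r)" using r by simp
      finally show "sqrt (pi * (2 * t)) / 2 \<le> sqrt (pi * r)" .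
    qed (use t in auto)
    also have "\<dots> = 2 * heat_kernel (2 * t) s" by (simp add: heat_kernel_def)
    finally have 1: "heat_kernel r s \<le> 2 * heat_kernel (2 * t) s" .
    have "\<bar>s\<^sup>2 / (4 * r\<^sup>2) - 1 / (2 * r)\<bar> \<le> s\<^sup>2 / (4 * r\<^sup>2) + 1 / (2 * r)"
      using r0 by (intro order.trans[OF abs_triangle_ineq4]) simp
    also have "\<dots> \<le> s\<^sup>2 / t\<^sup>2 + 1 / t"
    proof (intro add_mono divide_left_mono)
      have "t\<^sup>2 \<le> (2 * r)\<^sup>2" using r t by (intro power_mono) auto
      then show "t\<^sup>2 \<le> 4 * r\<^sup>2" by (simp add: power_mult_distrib)
    qed (use r r0 t in auto)
    finally have 2: "\<bar>s\<^sup>2 / (4 * r\<^sup>2) - 1 / (2 * r)\<bar> \<le> s\<^sup>2 / t\<^sup>2 + 1 / t" .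
    have "\<bar>?d r s\<bar> = \<bar>s\<^sup>2 / (4 * r\<^sup>2) - 1 / (2 * r)\<bar> * heat_kernel r s"
      using heat_kernel_nonneg[OF r0, of s] by (simp add: abs_mult)
    also have "\<dots> \<le> (s\<^sup>2 / t\<^sup>2 + 1 / t) * (2 * heat_kernel (2 * t) s)"
      using heat_kernel_nonneg[OF r0, of s] t by (intro mult_mono 1 2) auto
    also have "\<dots> = ?B s" by (simp only: mult_ac)
    finally show ?thesis .
  qed
  \<comment> \<open>By the mean value inequality the difference quotients obey the same majorant as
    the derivative.\<close>
  have lip: "\<bar>heat_kernel r s - heat_kernel t s\<bar> \<le> ?B s * \<bar>r - t\<bar>" if r: "t / 2 \<le> r" "r \<le> 2 * t" for r s
  proof -
    have "norm (heat_kernel r s - heat_kernel t s) \<le> ?B s * norm (r - t)"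
    proof (rule field_differentiable_bound[of "{t/2..2*t}"])
      show "((\<lambda>r. heat_kernel r s) has_field_derivative ?d z s) (at z within {t/2..2*t})" if "z \<in> {t/2..2*t}" for z
        using that t by (intro has_field_derivative_at_within[OF heat_kernel_derivs(3)]) auto
    qed (use dB r t in auto)
    then show ?thesis by simp
  qed
  have Bi: "?B integrable_on {0..}"
  proof -
    have "(\<lambda>s. (2 / t\<^sup>2) * (heat_kernel (2 * t) s * s ^ 2) + (2 / t) * (heat_kernel (2 * t) s * s ^ 0)) integrable_on {0..}"
      using t by (intro integrable_add integrable_on_mult_right heat_kernel_moment_integrable) auto
    then show ?thesis by (simp add: algebra_simps)
  qed
  have "((\<lambda>r. (evolution r f - evolution t f) /\<^sub>R (r - t)) \<longlongrightarrow> evolution_dt t f) (at t)"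
    unfolding tendsto_at_iff_sequentially
  proof (intro allI impI)
    fix X :: "nat \<Rightarrow> real" assume X: "\<forall>i. X i \<in> UNIV - {t}" "X \<longlonglongrightarrow> t"
    \<comment> \<open>The majorant is valid only between \<open>t / 2\<close> and
      \<open>2 * t\<close>, so finitely many terms of the sequence are dropped.\<close>
    have "\<forall>\<^sub>F n in sequentially. X n \<in> {t/2<..<2*t}"
      using X(2) t by (intro topological_tendstoD) auto
    then obtain N where N: "\<And>n. n \<ge> N \<Longrightarrow> X n \<in> {t/2<..<2*t}"
      by (auto simp: eventually_sequentially)
    define x where "x n = X (n + N)" for n
    have x: "x n \<noteq> t" "t/2 \<le> x n" "x n \<le> 2 * t" "x n > 0" for n
      using X(1) N[of "n + N"] t by (auto simp: x_def)
    have xt: "x \<longlonglongrightarrow> t" unfolding x_def by (rule LIMSEQ_ignore_initial_segment[OF X(2)])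
    let ?q = "\<lambda>n s. (heat_kernel (x n) s - heat_kernel t s) / (x n - t)"
    have "(\<lambda>n. integral {0..} (\<lambda>s. ?q n s *\<^sub>R T s f)) \<longlonglongrightarrow> integral {0..} (\<lambda>s. ?d t s *\<^sub>R T s f)"
    proof (rule dominated_convergence_Ici)
      show "continuous_on {0..} (\<lambda>s. ?q n s *\<^sub>R T s f)" for n
        using x[of n] t by (intro continuous_intros continuous_orbit) auto
      show "continuous_on {0..} (\<lambda>s. ?d t s *\<^sub>R T s f)"
        using t by (intro continuous_intros continuous_orbit) auto
      show "(\<lambda>s. ?B s * (C * norm f)) integrable_on {0..}"
        by (rule integrable_on_mult_left[OF Bi])
      show "norm (?q n s *\<^sub>R T s f) \<le> ?B s * (C * norm f)" if "s \<ge> 0" for n s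
      proof -
        have "\<bar>?q n s\<bar> \<le> ?B s"
          using lip[OF x(2,3), of n s] x(1)[of n] by (simp add: abs_divide divide_le_eq)
        then have "\<bar>?q n s\<bar> * norm (T s f) \<le> ?B s * (C * norm f)"
          using bound[OF that, of f] by (rule mult_mono) (use t heat_kernel_nonneg[of "2 * t" s] in auto)
        then show ?thesis unfolding norm_scaleR .
      qed
      show "(\<lambda>n. ?q n s *\<^sub>R T s f) \<longlonglongrightarrow> ?d t s *\<^sub>R T s f" for s
      proof (intro tendsto_scaleR tendsto_const)
        have "((\<lambda>r. (heat_kernel r s - heat_kernel t s) / (r - t)) \<longlongrightarrow> ?d t s) (at t)"
          using heat_kernel_derivs(3)[OF t, of s] by (simp add: has_field_derivative_iff)
        then show "(\<lambda>n. ?q n s) \<longlonglongrightarrow> ?d t s"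
          unfolding tendsto_at_iff_sequentially using x xt by (auto simp: o_def)
      qed
    qed
    moreover have "integral {0..} (\<lambda>s. ?q n s *\<^sub>R T s f) = (evolution (x n) f - evolution t f) /\<^sub>R (x n - t)" for n
    proof -
      have "evolution (x n) f - evolution t f = integral {0..} (\<lambda>s. heat_kernel (x n) s *\<^sub>R T s f - heat_kernel t s *\<^sub>R T s f)"
        unfolding orbit_integral_def
        by (rule integral_diff[symmetric]) (intro kernel_integrable kernel_heat x t)+
      then have "(evolution (x n) f - evolution t f) /\<^sub>R (x n - t)
          = integral {0..} (\<lambda>s. inverse (x n - t) *\<^sub>R (heat_kernel (x n) s *\<^sub>R T s f - heat_kernel t s *\<^sub>R T s f))"
        by (simp only: integral_cmul)
      also have "\<dots> = integral {0..} (\<lambda>s. ?q n s *\<^sub>R T s f)"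
        by (intro integral_cong) (simp add: divide_inverse mult.commute flip: scaleR_diff_left)
      finally show ?thesis ..
    qed
    ultimately have "(\<lambda>n. ((\<lambda>r. (evolution r f - evolution t f) /\<^sub>R (r - t)) \<circ> X) (n + N)) \<longlonglongrightarrow> evolution_dt t f"
      by (simp add: orbit_integral_def x_def)
    then show "((\<lambda>r. (evolution r f - evolution t f) /\<^sub>R (r - t)) \<circ> X) \<longlonglongrightarrow> evolution_dt t f"
      by (rule LIMSEQ_offset)
  qed
  then have "((\<lambda>r. norm ((evolution r f - evolution t f) /\<^sub>R (r - t) - evolution_dt t f)) \<longlongrightarrow> 0) (at t)"
    by (intro tendsto_norm_zero LIM_zero)
  then have "((\<lambda>r. norm (evolution r f - evolution t f - (r - t) *\<^sub>R evolution_dt t f) / norm (r - t)) \<longlongrightarrow> 0) (at t)"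
  proof (rule Lim_transform_eventually)
    show "\<forall>\<^sub>F r in at t. norm ((evolution r f - evolution t f) /\<^sub>R (r - t) - evolution_dt t f)
        = norm (evolution r f - evolution t f - (r - t) *\<^sub>R evolution_dt t f) / norm (r - t)"
      unfolding eventually_at_filter
    proof (intro always_eventually allI impI)
      fix r assume "r \<noteq> t"
      then have eq: "(evolution r f - evolution t f) /\<^sub>R (r - t) - evolution_dt t f
          = (evolution r f - evolution t f - (r - t) *\<^sub>R evolution_dt t f) /\<^sub>R (r - t)"
        by (simp add: scaleR_diff_right)
      have inv: "\<bar>inverse d\<bar> * y = y / norm d" for d y :: real
        by (simp add: divide_inverse mult.commute)
      show "norm ((evolution r f - evolution t f) /\<^sub>R (r - t) - evolution_dt t f)
        = norm (evolution r f - evolution t f - (r - t) *\<^sub>R evolution_dt t f) / norm (r - t)"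
        unfolding eq norm_scaleR by (rule inv)
    qed
  qed
  then show ?thesis
    unfolding has_vector_derivative_def has_derivative_iff_norm
    by (intro conjI bounded_linear_scaleR_left)
qed

text \<open>An estimate of \<open>norm (T s f - f)\<close> by a small constant plus a multiple of
  \<open>s\<close> holds for all \<open>s\<close>. Integrated against the kernel it leaves the
  constant plus a multiple of the first moment, which tends to 0.\<close>

lemma evolution_initial: "((\<lambda>t. evolution t f) \<longlongrightarrow> f) (at_right 0)"
proof (rule tendstoI)
  fix e :: real assume e: "e > 0"
  have "\<forall>\<^sub>F s in at_right 0. dist (T s f) f < e / 2"
    using tendstoD[OF strong, of "e/2"] e by simp
  then obtain \<delta> where \<delta>: "\<delta> > 0" "\<And>s. s > 0 \<Longrightarrow> s < \<delta> \<Longrightarrow> dist (T s f) f < e / 2"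
    by (auto simp: eventually_at_right_field)
  \<comment> \<open>From \<open>\<delta>\<close> on, the crude bound
    \<open>C * norm f + norm f\<close> equals \<open>K * \<delta>\<close> and is therefore at most
    \<open>K * s\<close>.\<close>
  define K where "K = (C * norm f + norm f) / \<delta>"
  have K0: "K \<ge> 0" using \<delta> C_nonneg by (auto simp: K_def)
  have le: "norm (T s f - f) \<le> e / 2 + K * s" if "s \<ge> 0" for s
  proof (cases "s < \<delta>")
    case True
    then have "norm (T s f - f) \<le> e / 2"
      using \<delta>(2)[of s] that e by (cases "s = 0") (auto simp: zero dist_norm)
    then show ?thesis using K0 that by (simp add: add_increasing2)
  next
    case False
    have "norm (T s f - f) \<le> C * norm f + norm f"
      using norm_triangle_ineq4[of "T s f" f] bound[OF that, of f] by linarith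
    also have "\<dots> = K * \<delta>" using \<delta> by (simp add: K_def)
    also have "\<dots> \<le> K * s" using False K0 by (intro mult_left_mono) auto
    finally show ?thesis using e by simp
  qed
  have main: "norm (evolution t f - f) \<le> e / 2 + K * (2 * t / sqrt (pi * t))" if t: "t > 0" for t
  proof -
    note one = heat_kernel_has_integral[OF t]
    have m: "((\<lambda>s. (e / 2) * heat_kernel t s + K * (s * heat_kernel t s)) has_integral (e / 2) * 1 + K * (2 * t / sqrt (pi * t))) {0..}"
      by (intro has_integral_add has_integral_mult_right one heat_kernel_first_moment t)
    have f1: "((\<lambda>s. heat_kernel t s *\<^sub>R f) has_integral 1 *\<^sub>R f) {0..}"
      by (rule has_integral_scaleR_left[OF one])
    have d: "((\<lambda>s. heat_kernel t s *\<^sub>R T s f - heat_kernel t s *\<^sub>R f) has_integral evolution t f - 1 *\<^sub>R f) {0..}"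
      by (rule has_integral_diff[OF orbit_integral_has_integral[OF kernel_heat[OF t]] f1])
    have "norm (integral {0..} (\<lambda>s. heat_kernel t s *\<^sub>R T s f - heat_kernel t s *\<^sub>R f))
        \<le> integral {0..} (\<lambda>s. (e / 2) * heat_kernel t s + K * (s * heat_kernel t s))"
    proof (rule integral_norm_bound_integral)
      fix s :: real assume "s \<in> {0..}"
      then have "heat_kernel t s * norm (T s f - f) \<le> heat_kernel t s * (e / 2 + K * s)"
        using heat_kernel_nonneg[OF t, of s] by (intro mult_left_mono le) auto
      then show "norm (heat_kernel t s *\<^sub>R T s f - heat_kernel t s *\<^sub>R f) \<le> (e / 2) * heat_kernel t s + K * (s * heat_kernel t s)"
        using heat_kernel_nonneg[OF t, of s]
        by (simp add: distrib_left mult_ac flip: scaleR_diff_right)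
    qed (use d m in \<open>auto simp: integrable_on_def\<close>)
    then show ?thesis
      unfolding integral_unique[OF d] integral_unique[OF m] by simp
  qed
  have "((\<lambda>t. K * (2 * t / sqrt (pi * t))) \<longlongrightarrow> K * 0) (at_right 0)"
    by (intro tendsto_mult tendsto_const) real_asymp
  then have "\<forall>\<^sub>F t in at_right 0. K * (2 * t / sqrt (pi * t)) < e / 2"
    using e by (intro order_tendstoD) auto
  with eventually_at_right_less[of "0::real"]
  show "\<forall>\<^sub>F t in at_right 0. dist (evolution t f) f < e"
  proof eventually_elim
    case (elim t)
    then show ?case using main[of t] by (simp add: dist_norm)
  qed
qed

end

section \<open>Solutions of the two Cauchy problems\<close>

lemma Ioi_subset_Ici: "{a<..} \<subseteq> {a :: real..}"
  by auto

lemma exp_decay_integral: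
  fixes a :: real
  assumes "a > 0"
  shows "set_integrable lborel {0<..} (\<lambda>s. exp (- s * a))"
proof -
  have D: "DERIV (\<lambda>s. - (exp (- s * a) / a)) s :> exp (- s * a)" for s
  proof -
    have "DERIV (\<lambda>s. exp (- s * a)) s :> exp (- s * a) * (- a)"
      by (rule DERIV_chain2[OF DERIV_exp]) (auto intro!: derivative_eq_intros)
    from DERIV_minus[OF DERIV_cdivide[OF this, of a]] show ?thesis using assms by simp
  qed
  have A: "((\<lambda>s. - (exp (- s * a) / a)) \<longlongrightarrow> - (exp (- 0 * a) / a)) (at_right 0)"
    using assms by (intro tendsto_intros) auto
  have B: "((\<lambda>s. - (exp (- s * a) / a)) \<longlongrightarrow> 0) at_top"
    using assms by real_asymp
  have C: "isCont (\<lambda>s. exp (- s * a)) s" for s by (intro continuous_intros)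
  show ?thesis by (rule FTC_nonneg_Ioi(1)[OF D C _ A B]) simp
qed

lemma bounded_mult_integrable:
  fixes k \<phi> :: "real \<Rightarrow> real"
  assumes k: "set_integrable lborel {0<..} k" and \<phi>: "continuous_on {0..} \<phi>"
    and M: "\<And>s. s \<ge> 0 \<Longrightarrow> \<bar>\<phi> s\<bar> \<le> M"
  shows "set_integrable lborel {0<..} (\<lambda>s. k s * \<phi> s)"
    and "((\<lambda>s. k s * \<phi> s) has_integral (\<integral>s\<in>{0<..}. k s * \<phi> s \<partial>lborel)) {0..}"
proof -
  have m\<phi>: "(\<lambda>s. indicator {0<..} s *\<^sub>R \<phi> s) \<in> borel_measurable lborel"
    using borel_measurable_continuous_on_indicator[OF _ continuous_on_subset[OF \<phi> Ioi_subset_Ici]] by auto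
  have k': "integrable lborel (\<lambda>s. indicator {0<..} s *\<^sub>R k s)"
    using k by (simp add: set_integrable_def)
  show *: "set_integrable lborel {0<..} (\<lambda>s. k s * \<phi> s)"
    unfolding set_integrable_def
  proof (rule Bochner_Integration.integrable_bound)
    show "integrable lborel (\<lambda>s. M * (indicator {0<..} s *\<^sub>R k s))"
      by (rule integrable_mult_right[OF k'])
    have "(\<lambda>s. (indicator {0<..} s *\<^sub>R k s) * (indicator {0<..} s *\<^sub>R \<phi> s)) \<in> borel_measurable lborel"
      by (rule borel_measurable_times[OF borel_measurable_integrable[OF k'] m\<phi>])
    also have "(\<lambda>s. (indicator {0<..} s *\<^sub>R k s) * (indicator {0<..} s *\<^sub>R \<phi> s)) = (\<lambda>s. indicator {0<..} s *\<^sub>R (k s * \<phi> s))"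
      by (auto simp: indicator_def)
    finally show "(\<lambda>s. indicator {0<..} s *\<^sub>R (k s * \<phi> s)) \<in> borel_measurable lborel" .
    have "\<bar>k s\<bar> * \<bar>\<phi> s\<bar> \<le> \<bar>M\<bar> * \<bar>k s\<bar>" if "s > 0" for s
      using mult_right_mono[OF order.trans[OF M abs_ge_self], of s "\<bar>k s\<bar>"] that by (simp add: mult.commute)
    then show "AE s in lborel. norm (indicator {0<..} s *\<^sub>R (k s * \<phi> s)) \<le> norm (M * (indicator {0<..} s *\<^sub>R k s))"
      by (intro AE_I2) (auto simp: indicator_def abs_mult)
  qed
  show "((\<lambda>s. k s * \<phi> s) has_integral (\<integral>s\<in>{0<..}. k s * \<phi> s \<partial>lborel)) {0..}"
    by (rule set_integrable_imp_has_integral_Ici[OF *])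
qed

text \<open>Integration in \<open>t\<close> first leaves the factor
  \<open>exp (- s * sqrt l) / sqrt l\<close>; its decay in \<open>s\<close> and the boundedness of
  \<open>\<phi>\<close> give absolute integrability over the quadrant, so Fubini's theorem
  applies.\<close>

lemma heat_kernel_laplace_fubini:
  fixes \<phi> :: "real \<Rightarrow> real"
  assumes l: "l > 0" and \<phi>: "continuous_on {0..} \<phi>" and M: "\<And>s. s \<ge> 0 \<Longrightarrow> \<bar>\<phi> s\<bar> \<le> M"
  shows "((\<lambda>t. exp (- l * t) * (\<integral>s\<in>{0<..}. heat_kernel t s * \<phi> s \<partial>lborel))
    has_integral (\<integral>s\<in>{0<..}. exp (- s * sqrt l) * \<phi> s \<partial>lborel) / sqrt l) {0..}"
proof -
  define \<psi> where "\<psi> s = indicator {0<..} s * \<phi> s" for s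
  define h where "h s t = indicator {0<..} t * (exp (- l * t) * heat_kernel t s)" for s t
  have \<psi>m [measurable]: "\<psi> \<in> borel_measurable borel"
    using borel_measurable_continuous_on_indicator[OF _ continuous_on_subset[OF \<phi> Ioi_subset_Ici]]
    by (auto simp: \<psi>_def[abs_def])
  have "(\<lambda>p. h (fst p) (snd p)) \<in> borel_measurable (borel \<Otimes>\<^sub>M borel)"
    unfolding h_def heat_kernel_def by measurable
  then have hm: "(\<lambda>p. h (fst p) (snd p)) \<in> borel_measurable (lborel \<Otimes>\<^sub>M lborel)"
    by (subst measurable_cong_sets[OF sets_pair_measure_cong[OF sets_lborel sets_lborel] refl])
  have h0: "h s t \<ge> 0" for s t
    by (simp add: h_def heat_kernel_nonneg indicator_def)
  have hi: "integrable lborel (h s)" "(\<integral>t. h s t \<partial>lborel) = exp (- s * sqrt l) / sqrt l" if "s > 0" for s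
    using heat_kernel_laplace[OF that l]
    by (simp_all add: h_def[abs_def] set_integrable_def set_lebesgue_integral_def)
  have e: "integrable lborel (\<lambda>s. indicator {0<..} s * exp (- s * sqrt l))"
    using exp_decay_integral[of "sqrt l"] l by (simp add: set_integrable_def)
  \<comment> \<open>The Laplace transform of the kernel is at hand for \<open>s > 0\<close>; for the
    other \<open>s\<close> the factor \<open>\<psi> s\<close> makes both sides vanish.\<close>
  have \<psi>0: "\<psi> s = 0" if "s \<le> 0" for s using that by (simp add: \<psi>_def)
  have inner: "(\<integral>t. \<psi> s * h s t \<partial>lborel) = (indicator {0<..} s * (exp (- s * sqrt l) * \<phi> s)) / sqrt l" for s
    using hi[of s] \<psi>0[of s] by (cases "s > 0") (auto simp: \<psi>_def)
  have int: "integrable (lborel \<Otimes>\<^sub>M lborel) (\<lambda>(s, t). \<psi> s * h s t)"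
  proof (rule lborel_pair.Fubini_integrable)
    show "(\<lambda>(s, t). \<psi> s * h s t) \<in> borel_measurable (lborel \<Otimes>\<^sub>M lborel)"
      unfolding case_prod_beta'
      by (intro borel_measurable_times hm measurable_compose[OF measurable_fst]) simp
    have "(\<integral>t. norm (\<psi> s * h s t) \<partial>lborel) = \<bar>\<psi> s\<bar> * (\<integral>t. h s t \<partial>lborel)" for s
      by (simp add: abs_mult abs_of_nonneg[OF h0])
    then have n: "(\<integral>t. norm (\<psi> s * h s t) \<partial>lborel) = \<bar>\<psi> s\<bar> * (exp (- s * sqrt l) / sqrt l)" for s
      using hi[of s] \<psi>0[of s] by (cases "s > 0") auto
    have "integrable lborel (\<lambda>s. \<bar>\<psi> s\<bar> * (exp (- s * sqrt l) / sqrt l))"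
    proof (rule Bochner_Integration.integrable_bound)
      show "integrable lborel (\<lambda>s. (M / sqrt l) * (indicator {0<..} s * exp (- s * sqrt l)))"
        by (rule integrable_mult_right[OF e])
      show "AE s in lborel. norm (\<bar>\<psi> s\<bar> * (exp (- s * sqrt l) / sqrt l)) \<le> norm ((M / sqrt l) * (indicator {0<..} s * exp (- s * sqrt l)))"
        using M l by (intro AE_I2) (auto simp: \<psi>_def indicator_def abs_mult intro!: divide_right_mono mult_right_mono order.trans[OF M abs_ge_self])
    qed simp
    then show "integrable lborel (\<lambda>s. \<integral>t. norm (case (s, t) of (s, t) \<Rightarrow> \<psi> s * h s t) \<partial>lborel)"
      using n by simp
    show "AE s in lborel. integrable lborel (\<lambda>t. case (s, t) of (s, t) \<Rightarrow> \<psi> s * h s t)"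
    proof (rule AE_I2)
      fix s
      show "integrable lborel (\<lambda>t. case (s, t) of (s, t) \<Rightarrow> \<psi> s * h s t)"
        using hi(1)[of s] \<psi>0[of s] by (cases "s > 0") auto
    qed
  qed
  have outer: "(\<integral>s. \<psi> s * h s t \<partial>lborel) = indicator {0<..} t * (exp (- l * t) * (\<integral>s\<in>{0<..}. heat_kernel t s * \<phi> s \<partial>lborel))" for t
  proof -
    have "(\<integral>s. \<psi> s * h s t \<partial>lborel)
        = (\<integral>s. (indicator {0<..} t * exp (- l * t)) * (indicator {0<..} s *\<^sub>R (heat_kernel t s * \<phi> s)) \<partial>lborel)"
      by (intro Bochner_Integration.integral_cong) (auto simp: \<psi>_def h_def)
    then show ?thesis by (simp add: set_lebesgue_integral_def mult.assoc)
  qed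
  have "set_integrable lborel {0<..} (\<lambda>t. exp (- l * t) * (\<integral>s\<in>{0<..}. heat_kernel t s * \<phi> s \<partial>lborel))"
    using lborel_pair.integrable_snd[OF int] unfolding outer by (simp add: set_integrable_def)
  then have "((\<lambda>t. exp (- l * t) * (\<integral>s\<in>{0<..}. heat_kernel t s * \<phi> s \<partial>lborel)) has_integral
      (\<integral>t\<in>{0<..}. exp (- l * t) * (\<integral>s\<in>{0<..}. heat_kernel t s * \<phi> s \<partial>lborel) \<partial>lborel)) {0..}"
    by (rule set_integrable_imp_has_integral_Ici)
  also have "(\<integral>t\<in>{0<..}. exp (- l * t) * (\<integral>s\<in>{0<..}. heat_kernel t s * \<phi> s \<partial>lborel) \<partial>lborel)
      = (\<integral>t. \<integral>s. \<psi> s * h s t \<partial>lborel \<partial>lborel)"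
    unfolding outer by (simp add: set_lebesgue_integral_def)
  also have "\<dots> = (\<integral>s. \<integral>t. \<psi> s * h s t \<partial>lborel \<partial>lborel)"
    by (rule lborel_pair.Fubini_integral[OF int])
  also have "\<dots> = (\<integral>s\<in>{0<..}. exp (- s * sqrt l) * \<phi> s \<partial>lborel) / sqrt l"
    unfolding inner by (simp add: set_lebesgue_integral_def)
  finally show ?thesis .
qed

context c0_semigroup
begin

text \<open>Division by zero makes \<open>heat_kernel 0\<close> the zero function, so
  \<open>evolution 0 f\<close> is 0 and not \<open>f\<close>. A function \<open>v\<close> with the
  right value at 0 takes its place: continuity at 0 is \<open>evolution_initial\<close>, and
  elsewhere differentiability gives it.\<close>

lemma continuous_on_extended_evolution:
  assumes "v 0 = f" "\<And>t. t > 0 \<Longrightarrow> v t = evolution t f"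
  shows "continuous_on {0..} v"
  unfolding continuous_on_def
proof
  fix t :: real assume "t \<in> {0..}"
  then consider "t = 0" | "t > 0" by fastforce
  then show "(v \<longlongrightarrow> v t) (at t within {0..})"
  proof cases
    case 1
    have "(v \<longlongrightarrow> f) (at_right 0)"
      by (rule Lim_transform_eventually[OF evolution_initial])
        (use assms(2) in \<open>auto simp: eventually_at_right_field intro: exI[of _ 1]\<close>)
    moreover have "at 0 within {0..} = at_right (0 :: real)"
      by (rule at_within_nhd[of 0 UNIV]) auto
    ultimately show ?thesis using 1 assms(1) by simp
  next
    case 2
    have "((\<lambda>t. evolution t f) \<longlongrightarrow> evolution t f) (at t)"
      using has_vector_derivative_continuous[OF evolution_derivative[OF 2]] by (simp add: isCont_def)
    moreover have "\<forall>\<^sub>F s in at t. evolution s f = v s"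
      using eventually_at_topological 2 assms(2)
      by (auto simp: eventually_at_topological intro!: exI[of _ "{0<..}"])
    ultimately have "(v \<longlongrightarrow> evolution t f) (at t)" by (rule Lim_transform_eventually)
    then show ?thesis using assms(2)[OF 2] by (auto intro: tendsto_within_subset)
  qed
qed

lemma evolution_bound: "t > 0 \<Longrightarrow> norm (evolution t f) \<le> C * norm f"
proof -
  assume t: "t > 0"
  have "integral {0..} (\<lambda>s. \<bar>heat_kernel t s\<bar>) = integral {0..} (heat_kernel t)"
    using heat_kernel_nonneg[OF t] by (intro integral_cong) simp
  also have "\<dots> = 1" by (rule integral_unique[OF heat_kernel_has_integral[OF t]])
  finally show ?thesis using orbit_integral_bound[OF kernel_heat[OF t], of f] by simp
qed

lemma kernel_exp: "a > 0 \<Longrightarrow> kernel (\<lambda>s. exp (- s * a))"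
proof (rule kernelI)
  assume a: "a > 0"
  show "(\<lambda>s. exp (- s * a)) integrable_on {0..}"
    using set_integrable_imp_has_integral_Ici[OF exp_decay_integral[OF a]] by (rule has_integral_integrable)
  show "continuous_on {0..} (\<lambda>s. exp (- s * a))" by (intro continuous_intros)
qed simp

text \<open>A bounded functional passes through the gauge integral. What remains is a real function
  dominated by a multiple of \<open>|k|\<close>, whose gauge and Lebesgue integrals agree.\<close>

lemma functional_orbit_integral:
  assumes \<l>: "bounded_linear \<l>" and k: "set_integrable lborel {0<..} k" "kernel k"
  shows "\<l> (orbit_integral k g) = (\<integral>s\<in>{0<..}. k s * \<l> (T s g) \<partial>lborel)"
proof -
  interpret \<l>: bounded_linear \<l> by (rule \<l>)
  obtain K where K: "\<And>x. norm (\<l> x) \<le> norm x * K" "K > 0" using \<l>.pos_bounded by blast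
  have c: "continuous_on {0..} (\<lambda>s. \<l> (T s g))"
    by (intro \<l>.continuous_on continuous_orbit)
  have b: "\<bar>\<l> (T s g)\<bar> \<le> (C * norm g) * K" if "s \<ge> 0" for s
    using K(1)[of "T s g"] mult_right_mono[OF bound[OF that, of g] less_imp_le[OF K(2)]] by simp
  have "((\<lambda>s. \<l> (k s *\<^sub>R T s g)) has_integral \<l> (orbit_integral k g)) {0..}"
    using has_integral_linear[OF orbit_integral_has_integral[OF k(2)] \<l>] by (simp add: o_def)
  then have "((\<lambda>s. k s * \<l> (T s g)) has_integral \<l> (orbit_integral k g)) {0..}"
    by (simp add: \<l>.scaleR)
  then show ?thesis
    using bounded_mult_integrable(2)[OF k(1) c b] by (rule has_integral_unique)
qed

text \<open>A separating family \<open>\<Lambda>\<close> of functionals reduces the vector-valued Fubini theorem to the scalar one.\<close>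

lemma evolution_laplace:
  fixes \<Lambda> :: "('b \<Rightarrow> real) set"
  assumes lin: "\<And>\<l>. \<l> \<in> \<Lambda> \<Longrightarrow> bounded_linear \<l>"
    and sep: "\<And>x y. (\<And>\<l>. \<l> \<in> \<Lambda> \<Longrightarrow> \<l> x = \<l> y) \<Longrightarrow> x = y"
    and l: "l > 0" and v: "v 0 = g" "\<And>t. t > 0 \<Longrightarrow> v t = evolution t g"
  shows "((\<lambda>t. exp (- l * t) *\<^sub>R v t) has_integral orbit_integral (\<lambda>s. exp (- s * sqrt l)) g /\<^sub>R sqrt l) {0..}"
proof -
  have cont: "continuous_on {0..} v" by (rule continuous_on_extended_evolution[OF v])
  have int: "(\<lambda>t. exp (- l * t) *\<^sub>R v t) integrable_on {0..}"
  proof (rule integrable_on_Ici_dominated)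
    show "continuous_on {0..} (\<lambda>t. exp (- l * t) *\<^sub>R v t)"
      by (intro continuous_intros cont)
    show "(\<lambda>t. exp (- l * t) * (C * norm g + norm g)) integrable_on {0..}"
      using has_integral_exp_minus_to_infinity[OF l, of 0]
      by (intro integrable_on_mult_left) (auto simp: integrable_on_def)
    show "norm (exp (- l * t) *\<^sub>R v t) \<le> exp (- l * t) * (C * norm g + norm g)" if "t \<ge> 0" for t
    proof -
      have "norm (v t) \<le> C * norm g + norm g"
        using that v evolution_bound[of t g] C_nonneg
        by (cases "t = 0") (auto intro: add_increasing add_increasing2)
      then show ?thesis by simp
    qed
  qed
  have "\<l> (integral {0..} (\<lambda>t. exp (- l * t) *\<^sub>R v t)) = \<l> (orbit_integral (\<lambda>s. exp (- s * sqrt l)) g /\<^sub>R sqrt l)"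
    if \<l>\<Lambda>: "\<l> \<in> \<Lambda>" for \<l>
  proof -
    have bl: "bounded_linear \<l>" by (rule lin[OF \<l>\<Lambda>])
    interpret \<l>: bounded_linear \<l> by (rule bl)
    obtain K where K: "\<And>x. norm (\<l> x) \<le> norm x * K" "K > 0" using \<l>.pos_bounded by blast
    have c: "continuous_on {0..} (\<lambda>s. \<l> (T s g))"
      by (intro \<l>.continuous_on continuous_orbit)
    have b: "\<bar>\<l> (T s g)\<bar> \<le> (C * norm g) * K" if "s \<ge> 0" for s
      using K(1)[of "T s g"] mult_right_mono[OF bound[OF that, of g] less_imp_le[OF K(2)]] by simp
    have "((\<lambda>t. \<l> (exp (- l * t) *\<^sub>R v t)) has_integral \<l> (integral {0..} (\<lambda>t. exp (- l * t) *\<^sub>R v t))) {0..}"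
      using has_integral_linear[OF integrable_integral[OF int] bl] by (simp add: o_def)
    then have 1: "((\<lambda>t. exp (- l * t) * \<l> (v t)) has_integral \<l> (integral {0..} (\<lambda>t. exp (- l * t) *\<^sub>R v t))) {0<..}"
      unfolding has_integral_Ioi_iff_Ici by (simp add: \<l>.scaleR)
    have "((\<lambda>t. exp (- l * t) * (\<integral>s\<in>{0<..}. heat_kernel t s * \<l> (T s g) \<partial>lborel))
        has_integral (\<integral>s\<in>{0<..}. exp (- s * sqrt l) * \<l> (T s g) \<partial>lborel) / sqrt l) {0<..}"
      unfolding has_integral_Ioi_iff_Ici by (rule heat_kernel_laplace_fubini[OF l c b])
    then have 2: "((\<lambda>t. exp (- l * t) * \<l> (v t)) has_integral (\<integral>s\<in>{0<..}. exp (- s * sqrt l) * \<l> (T s g) \<partial>lborel) / sqrt l) {0<..}"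
      by (rule has_integral_eq[rotated])
        (auto simp: v functional_orbit_integral[OF bl heat_kernel_integral(1) kernel_heat])
    have "\<l> (orbit_integral (\<lambda>s. exp (- s * sqrt l)) g /\<^sub>R sqrt l)
        = (\<integral>s\<in>{0<..}. exp (- s * sqrt l) * \<l> (T s g) \<partial>lborel) / sqrt l"
      using functional_orbit_integral[OF bl exp_decay_integral kernel_exp, of "sqrt l" g] l
      by (simp add: \<l>.scaleR divide_inverse mult.commute)
    then show ?thesis using has_integral_unique[OF 1 2] by simp
  qed
  then have "integral {0..} (\<lambda>t. exp (- l * t) *\<^sub>R v t) = orbit_integral (\<lambda>s. exp (- s * sqrt l)) g /\<^sub>R sqrt l"
    by (rule sep)
  then show ?thesis using integrable_integral[OF int] by simp
qed

theorem evolution_solves: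
  fixes \<Lambda> :: "('b \<Rightarrow> real) set"
  assumes lin: "\<And>\<l>. \<l> \<in> \<Lambda> \<Longrightarrow> bounded_linear \<l>"
    and sep: "\<And>x y. (\<And>\<l>. \<l> \<in> \<Lambda> \<Longrightarrow> \<l> x = \<l> y) \<Longrightarrow> x = y"
    and f: "f \<in> dom" and u: "u 0 = f" "\<And>t. t > 0 \<Longrightarrow> u t = evolution t f"
  shows "solves_fractional_cauchy (1/2) T f u" "solves_higher_order T f u"
proof -
  have cont: "continuous_on {0..} u" by (rule continuous_on_extended_evolution[OF u])
  \<comment> \<open>\<open>v\<close> continues \<open>gen (u t)\<close> by \<open>gen f\<close> at
    0. It is thus the extended evolution of \<open>gen f\<close>, so that the results on continuity
    and on the Laplace transform apply to it as well.\<close>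
  define v where "v t = (if t > 0 then gen (u t) else gen f)" for t
  have v: "v 0 = gen f" "\<And>t. t > 0 \<Longrightarrow> v t = evolution t (gen f)"
    using evolution_gen(2)[OF _ f] u by (auto simp: v_def)
  have "continuous_on {0<..} v \<longleftrightarrow> continuous_on {0<..} (\<lambda>t. gen (u t))"
    by (rule continuous_on_cong) (auto simp: v_def)
  then have contv: "continuous_on {0<..} (\<lambda>t. gen (u t))"
    using continuous_on_subset[OF continuous_on_extended_evolution[OF v] Ioi_subset_Ici] by simp
  have "((\<lambda>t. exp (- s * t) *\<^sub>R gen (u t)) has_integral
      (s powr (1/2) *\<^sub>R (orbit_integral (\<lambda>r. exp (- r * sqrt s)) f /\<^sub>R sqrt s) - s powr (1/2 - 1) *\<^sub>R u 0)) {0<..}"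
    if s: "s > 0" for s
  proof -
    let ?R = "orbit_integral (\<lambda>r. exp (- r * sqrt s))"
    have "((\<lambda>t. exp (- s * t) *\<^sub>R v t) has_integral ?R (gen f) /\<^sub>R sqrt s) {0<..}"
      unfolding has_integral_Ioi_iff_Ici by (rule evolution_laplace[OF lin sep s v])
    then have 1: "((\<lambda>t. exp (- s * t) *\<^sub>R gen (u t)) has_integral ?R (gen f) /\<^sub>R sqrt s) {0<..}"
      by (rule has_integral_eq[rotated]) (simp add: v_def)
    have k: "kernel (\<lambda>r. exp (- r * sqrt s))" by (rule kernel_exp) (use s in simp)
    then have k': "kernel (\<lambda>r. - sqrt s * exp (- r * sqrt s))"
      using integrable_on_mult_right[of "\<lambda>r. exp (- (r * sqrt s))" "{0..}" "sqrt s"] s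
      by (auto simp: kernel_def abs_mult intro!: continuous_intros)
    have "?R (gen f) = - (exp (- 0 * sqrt s) *\<^sub>R f) - orbit_integral (\<lambda>r. - sqrt s * exp (- r * sqrt s)) f"
    proof (rule orbit_integral_by_parts[OF k k' f])
      show "((\<lambda>r. exp (- r * sqrt s)) has_real_derivative - sqrt s * exp (- r * sqrt s)) (at r)" for r
        by (auto intro!: derivative_eq_intros)
      show "(\<lambda>n. exp (- real n * sqrt s)) \<longlonglongrightarrow> 0" using s by real_asymp
    qed
    also have "orbit_integral (\<lambda>r. - sqrt s * exp (- r * sqrt s)) f = - sqrt s *\<^sub>R ?R f"
    proof -
      have "orbit_integral (\<lambda>r. - sqrt s * exp (- r * sqrt s)) f
          = integral {0..} (\<lambda>r. (- sqrt s) *\<^sub>R (exp (- r * sqrt s) *\<^sub>R T r f))"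
        unfolding orbit_integral_def by (simp only: scaleR_scaleR)
      then show ?thesis unfolding orbit_integral_def by (simp only: integral_cmul)
    qed
    finally have R: "?R (gen f) = sqrt s *\<^sub>R ?R f - f" by simp
    have p: "s powr (1/2 - 1) = inverse (sqrt s)"
      using s by (simp add: powr_minus powr_half_sqrt)
    \<comment> \<open>With the transform of \<open>u\<close> equal to \<open>?R f\<close> divided by
      \<open>sqrt s\<close>, the Caputo expression is \<open>?R f\<close> minus \<open>f\<close>
      divided by \<open>sqrt s\<close>, which is \<open>R\<close> divided by
      \<open>sqrt s\<close>.\<close>
    have "s powr (1/2) *\<^sub>R (?R f /\<^sub>R sqrt s) - s powr (1/2 - 1) *\<^sub>R u 0 = ?R (gen f) /\<^sub>R sqrt s"
      unfolding R p using s by (simp add: u powr_half_sqrt scaleR_diff_right)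
    then show ?thesis using 1 by simp
  qed
  moreover have "((\<lambda>t. exp (- s * t) *\<^sub>R u t) has_integral orbit_integral (\<lambda>r. exp (- r * sqrt s)) f /\<^sub>R sqrt s) {0..}"
    if "s > 0" for s
    by (rule evolution_laplace[OF lin sep that u])
  ultimately have "\<forall>\<^sub>F s in at_top. \<exists>G. ((\<lambda>t. exp (- s * t) *\<^sub>R u t) has_integral G) {0..} \<and>
      ((\<lambda>t. exp (- s * t) *\<^sub>R gen (u t)) has_integral (s powr (1/2) *\<^sub>R G - s powr (1/2 - 1) *\<^sub>R u 0)) {0<..}"
    by (intro eventually_mono[OF eventually_gt_at_top[of 0]]) blast
  then show "solves_fractional_cauchy (1/2) T f u"
    unfolding solves_fractional_cauchy_def has_caputo_derivative_def
    using cont contv u evolution_gen(1)[OF _ f] by auto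
  have "(u has_vector_derivative (gen f /\<^sub>R sqrt (pi * t) + gen (gen (u t)))) (at t)" if t: "t > 0" for t
  proof -
    have "gen f /\<^sub>R sqrt (pi * t) + gen (gen (u t)) = evolution_dt t f"
      using evolution_gen(4)[OF t f] u(2)[OF t] by simp
    moreover have "(u has_vector_derivative evolution_dt t f) (at t)"
      by (rule has_vector_derivative_transform_within_open[OF evolution_derivative[OF t], of "{0<..}"])
        (use t u in auto)
    ultimately show ?thesis by simp
  qed
  then show "solves_higher_order T f u"
    unfolding solves_higher_order_def using cont u evolution_gen[OF _ f] by auto
qed

end

section \<open>The corollary\<close>

lemma L1_separated:
  fixes F G :: "'a::euclidean_space L1"
  assumes "\<And>\<l>. \<l> \<in> integral_over ` sets borel \<Longrightarrow> \<l> F = \<l> G"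
  shows "F = G"
  by (rule integral_over_separates) (use assms in auto)

text \<open>The integral of a non-integrable function is 0 by convention. The estimate can therefore
  be used at every \<open>x\<close>, also on the null set where \<open>f\<close> fails to be
  integrable for the law of the process.\<close>

lemma ennreal_norm_integral_le:
  fixes f :: "'a \<Rightarrow> real"
  shows "ennreal \<bar>\<integral>x. f x \<partial>M\<bar> \<le> (\<integral>\<^sup>+x. ennreal \<bar>f x\<bar> \<partial>M)"
proof (cases "integrable M f")
  case True
  then show ?thesis using integral_norm_bound_ennreal[OF True] by simp
next
  case False
  then show ?thesis by (simp add: not_integrable_integral_eq)
qed

section \<open>Expectations at a random time as elements of the function space\<close>

context
  fixes S :: "'w measure" and P :: "'a::euclidean_space \<Rightarrow> 'w measure" and X :: "real \<Rightarrow> 'w \<Rightarrow> 'a"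
    and T :: "real \<Rightarrow> 'a L1 \<Rightarrow> 'a L1" and C :: real
  assumes markov: "markov_process S P X" and trans: "transition_operators P X T"
    and semigroup: "c0_semigroup T C"
begin

interpretation c0_semigroup T C by (rule semigroup)

lemma expect_at_law:
  assumes "s \<ge> 0" "f \<in> borel_measurable borel"
  shows "expect_at P (X s) f x = (\<integral>y. f y \<partial>law P X s x)"
  unfolding expect_at_def law_def[OF markov]
  by (rule integral_distr[symmetric]) (use assms markov_measurable[OF markov] markov_sets[OF markov] in \<open>auto cong: measurable_cong_sets\<close>)

lemma T_abs_L1:
  assumes "s \<ge> 0" "integrable lborel f"
  shows "integrable lborel (\<lambda>x. \<integral>y. f y \<partial>law P X s x)"
    and "T s (abs_L1 f) = abs_L1 (\<lambda>x. \<integral>y. f y \<partial>law P X s x)"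
    and "AE x in lborel. integrable (law P X s x) f"
proof -
  have f: "f \<in> borel_measurable borel" using assms(2) by auto
  have e: "expect_at P (X s) f = (\<lambda>x. \<integral>y. f y \<partial>law P X s x)"
    using expect_at_law[OF assms(1) f] by blast
  have t: "expect_in_L1 P (X s) f" "T s (abs_L1 f) = abs_L1 (expect_at P (X s) f)"
    using trans assms by (auto simp: transition_operators_def)
  show "integrable lborel (\<lambda>x. \<integral>y. f y \<partial>law P X s x)"
    using t(1) by (simp add: expect_in_L1_def e)
  show "T s (abs_L1 f) = abs_L1 (\<lambda>x. \<integral>y. f y \<partial>law P X s x)"
    using t(2) by (simp add: e)
  have X: "X s \<in> P x \<rightarrow>\<^sub>M borel" for x
    using markov_measurable[OF markov assms(1)] markov_sets[OF markov] by (simp cong: measurable_cong_sets)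
  show "AE x in lborel. integrable (law P X s x) f"
    using t(1) unfolding expect_in_L1_def law_def[OF markov]
    by (auto simp: integrable_distr_eq[OF X f])
qed

text \<open>The semigroup bound is applied to the class of \<open>|f|\<close> instead of that of
  \<open>f\<close>: this controls the absolute integral, uniformly in the time \<open>s\<close>, and
  hence survives integration over \<open>s\<close>.\<close>

lemma nn_integral_law_le:
  assumes s: "s \<ge> 0" and f: "integrable lborel f"
  shows "(\<integral>\<^sup>+x. \<integral>\<^sup>+y. ennreal \<bar>f y\<bar> \<partial>law P X s x \<partial>lborel) \<le> ennreal (C * norm (abs_L1 f))"
proof -
  have af: "integrable lborel (\<lambda>y. \<bar>f y\<bar>)" using f by simp
  note t = T_abs_L1[OF s af]
  have "(\<integral>\<^sup>+x. \<integral>\<^sup>+y. ennreal \<bar>f y\<bar> \<partial>law P X s x \<partial>lborel)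
      = (\<integral>\<^sup>+x. ennreal (\<integral>y. \<bar>f y\<bar> \<partial>law P X s x) \<partial>lborel)"
    by (rule nn_integral_cong_AE) (use t(3) in \<open>eventually_elim, simp add: nn_integral_eq_integral\<close>)
  also have "\<dots> = ennreal (\<integral>x. (\<integral>y. \<bar>f y\<bar> \<partial>law P X s x) \<partial>lborel)"
    by (rule nn_integral_eq_integral[OF t(1)]) simp
  also have "(\<integral>x. (\<integral>y. \<bar>f y\<bar> \<partial>law P X s x) \<partial>lborel) = norm (T s (abs_L1 (\<lambda>y. \<bar>f y\<bar>)))"
    unfolding t(2) by (simp add: norm_abs_L1 t(1))
  also have "\<dots> \<le> C * norm (abs_L1 f)"
    using bound[OF s, of "abs_L1 (\<lambda>y. \<bar>f y\<bar>)"] f by (simp add: norm_abs_L1)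
  finally show ?thesis by (simp add: ennreal_leI)
qed

context
  fixes \<mu> :: "real measure" and f :: "'a \<Rightarrow> real"
  assumes \<mu>: "real_distribution \<mu>" and f: "integrable lborel f"
begin

interpretation \<mu>: real_distribution \<mu> by (rule \<mu>)

interpretation \<mu>L: pair_sigma_finite \<mu> "lborel :: 'a measure" ..

lemma integrand_borel [measurable]: "f \<in> borel_measurable borel"
  using f by auto

lemma law_measurable_pair: "(\<lambda>p. law P X (max 0 (fst p)) (snd p)) \<in> \<mu> \<Otimes>\<^sub>M lborel \<rightarrow>\<^sub>M subprob_algebra borel"
proof -
  have "(\<lambda>p. law P X (max 0 (fst p)) (snd p)) \<in> borel \<Otimes>\<^sub>M borel \<rightarrow>\<^sub>M subprob_algebra borel"
    using measurable_prob_algebraD[OF measurable_law_joint[OF markov]] by (simp add: case_prod_beta')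
  then show ?thesis
    by (subst measurable_cong_sets[OF sets_pair_measure_cong[OF \<mu>.events_eq_borel sets_lborel] refl])
qed

lemma nn_law_measurable_pair:
  "(\<lambda>p. \<integral>\<^sup>+y. ennreal \<bar>f y\<bar> \<partial>law P X (max 0 (fst p)) (snd p)) \<in> borel_measurable (\<mu> \<Otimes>\<^sub>M lborel)"
  by (rule measurable_compose[OF law_measurable_pair nn_integral_measurable_subprob_algebra]) simp

lemma nn_integral_pair_law_le:
  "(\<integral>\<^sup>+p. \<integral>\<^sup>+y. ennreal \<bar>f y\<bar> \<partial>law P X (max 0 (fst p)) (snd p) \<partial>(\<mu> \<Otimes>\<^sub>M lborel)) \<le> ennreal (C * norm (abs_L1 f))"
proof -
  have "(\<integral>\<^sup>+p. \<integral>\<^sup>+y. ennreal \<bar>f y\<bar> \<partial>law P X (max 0 (fst p)) (snd p) \<partial>(\<mu> \<Otimes>\<^sub>M lborel))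
      = (\<integral>\<^sup>+s. \<integral>\<^sup>+x. \<integral>\<^sup>+y. ennreal \<bar>f y\<bar> \<partial>law P X (max 0 s) x \<partial>lborel \<partial>\<mu>)"
    using lborel.nn_integral_fst[OF nn_law_measurable_pair] by simp
  also have "\<dots> \<le> (\<integral>\<^sup>+s. ennreal (C * norm (abs_L1 f)) \<partial>\<mu>)"
    by (intro nn_integral_mono nn_integral_law_le f) simp
  also have "\<dots> = ennreal (C * norm (abs_L1 f))" 
    by (simp only: nn_integral_const \<mu>.emeasure_space_1 mult_1_right)
  finally show ?thesis .
qed

lemma nn_integral_mixture_le:
  "(\<integral>\<^sup>+x. \<integral>\<^sup>+y. ennreal \<bar>f y\<bar> \<partial>mixture S P X \<mu> x \<partial>lborel) \<le> ennreal (C * norm (abs_L1 f))"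
proof -
  have "(\<integral>\<^sup>+x. \<integral>\<^sup>+y. ennreal \<bar>f y\<bar> \<partial>mixture S P X \<mu> x \<partial>lborel)
      = (\<integral>\<^sup>+x. \<integral>\<^sup>+s. \<integral>\<^sup>+y. ennreal \<bar>f y\<bar> \<partial>law P X (max 0 s) x \<partial>\<mu> \<partial>lborel)"
    by (subst nn_integral_mixture[OF markov \<mu>]) auto
  also have "\<dots> = (\<integral>\<^sup>+p. \<integral>\<^sup>+y. ennreal \<bar>f y\<bar> \<partial>law P X (max 0 (fst p)) (snd p) \<partial>(\<mu> \<Otimes>\<^sub>M lborel))"
    using \<mu>L.nn_integral_snd[OF nn_law_measurable_pair] by (simp add: case_prod_beta')
  finally show ?thesis using nn_integral_pair_law_le by simp
qed

lemma mixture_kernel: "mixture S P X \<mu> \<in> lborel \<rightarrow>\<^sub>M subprob_algebra borel"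
  using measurable_prob_algebraD[OF measurable_mixture[OF markov \<mu>]] by (simp cong: measurable_cong_sets)

lemma sets_mixture: "sets (mixture S P X \<mu> x) = sets borel"
  by (simp add: mixture_def[OF markov])

lemma mixture_integrable: "AE x in lborel. integrable (mixture S P X \<mu> x) f"
proof -
  have "AE x in lborel. (\<integral>\<^sup>+y. ennreal \<bar>f y\<bar> \<partial>mixture S P X \<mu> x) \<noteq> \<infinity>"
  proof (rule nn_integral_PInf_AE)
    show "(\<lambda>x. \<integral>\<^sup>+y. ennreal \<bar>f y\<bar> \<partial>mixture S P X \<mu> x) \<in> borel_measurable lborel"
      by (rule measurable_compose[OF mixture_kernel nn_integral_measurable_subprob_algebra]) simp
    show "(\<integral>\<^sup>+x. \<integral>\<^sup>+y. ennreal \<bar>f y\<bar> \<partial>mixture S P X \<mu> x \<partial>lborel) \<noteq> \<infinity>"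
      using nn_integral_mixture_le by (auto simp: top_unique)
  qed
  then show ?thesis
  proof eventually_elim
    case (elim x)
    have "f \<in> borel_measurable (mixture S P X \<mu> x)"
      by (subst measurable_cong_sets[OF sets_mixture refl]) (rule integrand_borel)
    then show ?case using elim by (auto simp: integrable_iff_bounded less_top)
  qed
qed

lemma integrable_expect_mixture: "integrable lborel (\<lambda>x. \<integral>y. f y \<partial>mixture S P X \<mu> x)"
proof (rule integrableI_bounded)
  show "(\<lambda>x. \<integral>y. f y \<partial>mixture S P X \<mu> x) \<in> borel_measurable lborel"
    by (rule measurable_compose[OF mixture_kernel integral_measurable_subprob_algebra]) simp
  have "(\<integral>\<^sup>+x. ennreal (norm (\<integral>y. f y \<partial>mixture S P X \<mu> x)) \<partial>lborel)
      \<le> (\<integral>\<^sup>+x. \<integral>\<^sup>+y. ennreal \<bar>f y\<bar> \<partial>mixture S P X \<mu> x \<partial>lborel)"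
    by (intro nn_integral_mono) (simp add: ennreal_norm_integral_le)
  also have "\<dots> \<le> ennreal (C * norm (abs_L1 f))" by (rule nn_integral_mixture_le)
  also have "\<dots> < \<infinity>" by simp
  finally show "(\<integral>\<^sup>+x. ennreal (norm (\<integral>y. f y \<partial>mixture S P X \<mu> x)) \<partial>lborel) < \<infinity>" .
qed

text \<open>Testing against the indicator of \<open>A\<close> leaves a scalar double integral over
  time and starting point. After the exchange the inner integral over the starting point is that of
  \<open>T s f\<close>, so the semigroup appears.\<close>

lemma integral_over_mixture:
  assumes A: "A \<in> sets borel"
  shows "integral_over A (abs_L1 (\<lambda>x. \<integral>y. f y \<partial>mixture S P X \<mu> x))
    = (\<integral>s. integral_over A (T (max 0 s) (abs_L1 f)) \<partial>\<mu>)"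
proof -
  let ?g = "\<lambda>s x. \<integral>y. f y \<partial>law P X (max 0 s) x"
  have int: "integrable (\<mu> \<Otimes>\<^sub>M lborel) (\<lambda>(s, x). indicator A x * ?g s x)"
  proof (rule integrableI_bounded)
    have "(\<lambda>p. ?g (fst p) (snd p)) \<in> borel_measurable (\<mu> \<Otimes>\<^sub>M lborel)"
      by (rule measurable_compose[OF law_measurable_pair integral_measurable_subprob_algebra]) simp
    then show "(\<lambda>(s, x). indicator A x * ?g s x) \<in> borel_measurable (\<mu> \<Otimes>\<^sub>M lborel)"
      unfolding case_prod_beta'
      using A by (intro borel_measurable_times measurable_compose[OF measurable_snd borel_measurable_indicator]) auto
    have "(\<integral>\<^sup>+p. ennreal (norm (case p of (s, x) \<Rightarrow> indicator A x * ?g s x)) \<partial>(\<mu> \<Otimes>\<^sub>M lborel))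
        \<le> (\<integral>\<^sup>+p. \<integral>\<^sup>+y. ennreal \<bar>f y\<bar> \<partial>law P X (max 0 (fst p)) (snd p) \<partial>(\<mu> \<Otimes>\<^sub>M lborel))"
    proof (rule nn_integral_mono)
      fix p :: "real \<times> 'a"
      have "ennreal (norm (case p of (s, x) \<Rightarrow> indicator A x * ?g s x)) \<le> ennreal \<bar>?g (fst p) (snd p)\<bar>"
        by (auto simp: case_prod_beta' indicator_def)
      also have "\<dots> \<le> (\<integral>\<^sup>+y. ennreal \<bar>f y\<bar> \<partial>law P X (max 0 (fst p)) (snd p))"
        by (rule ennreal_norm_integral_le)
      finally show "ennreal (norm (case p of (s, x) \<Rightarrow> indicator A x * ?g s x))
          \<le> (\<integral>\<^sup>+y. ennreal \<bar>f y\<bar> \<partial>law P X (max 0 (fst p)) (snd p))" .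
    qed
    also have "\<dots> \<le> ennreal (C * norm (abs_L1 f))" by (rule nn_integral_pair_law_le)
    also have "\<dots> < \<infinity>" by simp
    finally show "(\<integral>\<^sup>+p. ennreal (norm (case p of (s, x) \<Rightarrow> indicator A x * ?g s x)) \<partial>(\<mu> \<Otimes>\<^sub>M lborel)) < \<infinity>" .
  qed
  have "integral_over A (abs_L1 (\<lambda>x. \<integral>y. f y \<partial>mixture S P X \<mu> x))
      = (\<integral>x. indicator A x * (\<integral>y. f y \<partial>mixture S P X \<mu> x) \<partial>lborel)"
    by (rule integral_over_abs_L1[OF A integrable_expect_mixture])
  also have "\<dots> = (\<integral>x. \<integral>s. indicator A x * ?g s x \<partial>\<mu> \<partial>lborel)"
  proof (rule integral_cong_AE)
    show "(\<lambda>x. indicator A x * (\<integral>y. f y \<partial>mixture S P X \<mu> x)) \<in> borel_measurable lborel"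
      using A by (intro borel_measurable_times borel_measurable_integrable[OF integrable_expect_mixture]) auto
    show "(\<lambda>x. \<integral>s. indicator A x * ?g s x \<partial>\<mu>) \<in> borel_measurable lborel"
      by (rule borel_measurable_integrable[OF \<mu>L.integrable_snd[OF int]])
    show "AE x in lborel. indicator A x * (\<integral>y. f y \<partial>mixture S P X \<mu> x) = (\<integral>s. indicator A x * ?g s x \<partial>\<mu>)"
      using mixture_integrable by eventually_elim (simp add: integral_mixture[OF markov \<mu> integrand_borel])
  qed
  also have "\<dots> = (\<integral>s. \<integral>x. indicator A x * ?g s x \<partial>lborel \<partial>\<mu>)"
    by (rule \<mu>L.Fubini_integral[OF int])
  also have "\<dots> = (\<integral>s. integral_over A (T (max 0 s) (abs_L1 f)) \<partial>\<mu>)"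
    by (intro Bochner_Integration.integral_cong refl) (simp add: T_abs_L1 integral_over_abs_L1 A f)
  finally show ?thesis .
qed

end

text \<open>Here the two meanings of u meet: the expectation taken separately at each starting
  point, and the gauge integral of the orbit. Every functional \<open>integral_over A\<close> gives
  them the same value.\<close>

lemma abs_L1_mixture_heat:
  assumes t: "t > 0" and f: "integrable lborel f"
  shows "abs_L1 (\<lambda>x. \<integral>y. f y \<partial>mixture S P X (Ioi_density (heat_kernel t)) x) = evolution t (abs_L1 f)"
proof (rule integral_over_separates)
  fix A :: "'a set" assume A: "A \<in> sets borel"
  let ?\<mu> = "Ioi_density (heat_kernel t)"
  interpret \<l>: bounded_linear "integral_over A" by (rule bounded_linear_integral_over[OF A])
  have c: "continuous_on UNIV (\<lambda>s. integral_over A (T (max 0 s) (abs_L1 f)))"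
    by (intro \<l>.continuous_on continuous_on_compose2[OF continuous_orbit, of UNIV "\<lambda>s. max 0 s"] continuous_intros) auto
  have "integral_over A (abs_L1 (\<lambda>x. \<integral>y. f y \<partial>mixture S P X ?\<mu> x))
      = (\<integral>s. integral_over A (T (max 0 s) (abs_L1 f)) \<partial>?\<mu>)"
    by (rule integral_over_mixture[OF real_distribution_heat[OF t] f A])
  also have "\<dots> = (\<integral>s\<in>{0<..}. integral_over A (T (max 0 s) (abs_L1 f)) * heat_kernel t s \<partial>lborel)"
    by (rule integral_Ioi_density[OF heat_density_facts]) (use t c in \<open>auto intro: borel_measurable_continuous_onI\<close>)
  also have "\<dots> = (\<integral>s\<in>{0<..}. heat_kernel t s * integral_over A (T s (abs_L1 f)) \<partial>lborel)"
    by (rule set_lebesgue_integral_cong) (auto simp: max_absorb2)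
  also have "\<dots> = integral_over A (evolution t (abs_L1 f))"
    by (rule functional_orbit_integral[OF \<l>.bounded_linear_axioms heat_kernel_integral(1)[OF t] kernel_heat[OF t], symmetric])
  finally show "integral_over A (abs_L1 (\<lambda>x. \<integral>y. f y \<partial>mixture S P X ?\<mu> x)) = integral_over A (evolution t (abs_L1 f))" .
qed

text \<open>The two time changes differ in the process \<open>W\<close> that generates
  \<open>\<tau>\<close>. The equations depend only on the one-dimensional laws of
  \<open>\<tau>\<close> and on the independence of \<open>X\<close> and \<open>W\<close>, which
  covers both cases at once.\<close>

theorem random_time_solves:
  fixes W :: "real \<Rightarrow> 'w \<Rightarrow> real" and \<tau> :: "real \<Rightarrow> 'w \<Rightarrow> real"
  assumes \<tau>: "\<And>t. t \<ge> 0 \<Longrightarrow> \<tau> t \<in> path_algebra (space S) {0..} W \<rightarrow>\<^sub>M borel"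
    and \<tau>0: "\<And>t \<omega>. \<tau> t \<omega> \<ge> 0"
    and indep: "\<And>x. independent_processes (P x) X W"
    and start: "\<And>x. AE \<omega> in P x. \<tau> 0 \<omega> = 0"
    and heat: "\<And>x t. t > 0 \<Longrightarrow> distr (P x) borel (\<tau> t) = Ioi_density (heat_kernel t)"
    and f: "integrable lborel f" and dom: "abs_L1 f \<in> generator_domain T"
  defines "Z \<equiv> \<lambda>t \<omega>. X (\<tau> t \<omega>) \<omega>"
  shows "(\<forall>t\<ge>0. expect_in_L1 P (Z t) f) \<and>
    solves_fractional_cauchy (1/2) T (abs_L1 f) (\<lambda>t. abs_L1 (expect_at P (Z t) f)) \<and>
    solves_higher_order T (abs_L1 f) (\<lambda>t. abs_L1 (expect_at P (Z t) f))"
proof -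
  have fb: "f \<in> borel_measurable borel" using f by auto
  have Zm: "Z t \<in> P x \<rightarrow>\<^sub>M borel" if "t \<ge> 0" for t x
    unfolding Z_def by (rule distr_at_random_time(1)[OF markov \<tau>[OF that] \<tau>0 indep])
  have Zd: "distr (P x) borel (Z t) = mixture S P X (Ioi_density (heat_kernel t)) x" if "t > 0" for t x
    using distr_at_random_time(2)[OF markov \<tau> \<tau>0 indep, of t x] heat[OF that, of x] that by (simp add: Z_def)
  have e: "expect_at P (Z t) f = (\<lambda>x. \<integral>y. f y \<partial>mixture S P X (Ioi_density (heat_kernel t)) x)" if "t > 0" for t
  proof
    fix x
    show "expect_at P (Z t) f x = (\<integral>y. f y \<partial>mixture S P X (Ioi_density (heat_kernel t)) x)"
      unfolding expect_at_def Zd[OF that, symmetric]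
      by (rule integral_distr[symmetric, OF Zm fb]) (use that in simp)
  qed
  \<comment> \<open>The density describes the random time for \<open>t > 0\<close> only. At
    \<open>t = 0\<close> the time vanishes almost surely, so that \<open>Z 0\<close> is the starting
    point and the initial value is \<open>f\<close> at every \<open>x\<close>.\<close>
  have Z0: "AE \<omega> in P x. f (Z 0 \<omega>) = f x" for x
  proof -
    have "AE \<omega> in P x. X 0 \<omega> = x" using markov unfolding markov_process_def by blast
    then show ?thesis using start[of x] by eventually_elim (simp add: Z_def)
  qed
  have m0: "(\<lambda>\<omega>. f (Z 0 \<omega>)) \<in> borel_measurable (P x)" for x
    using measurable_compose[OF Zm fb, of 0 x] by simp
  have e0: "expect_at P (Z 0) f = f"
  proof
    fix x
    interpret prob_space "P x" by (rule markov_prob[OF markov])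
    have "expect_at P (Z 0) f x = (\<integral>\<omega>. f x \<partial>P x)"
      unfolding expect_at_def by (rule integral_cong_AE[OF m0 _ Z0]) simp
    then show "expect_at P (Z 0) f x = f x" by (simp add: prob_space)
  qed
  have "expect_in_L1 P (Z t) f" if "t \<ge> 0" for t
  proof (cases "t = 0")
    case True
    have "integrable (P x) (\<lambda>\<omega>. f (Z 0 \<omega>))" for x
    proof -
      interpret prob_space "P x" by (rule markov_prob[OF markov])
      show ?thesis by (subst integrable_cong_AE[OF m0 _ Z0]) auto
    qed
    then show ?thesis using True f by (simp add: expect_in_L1_def e0)
  next
    case False
    then have t: "t > 0" using that by simp
    have "integrable (mixture S P X (Ioi_density (heat_kernel t)) x) f \<longleftrightarrow> integrable (P x) (\<lambda>\<omega>. f (Z t \<omega>))" for x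
      unfolding Zd[OF t, symmetric] by (rule integrable_distr_eq[OF Zm[OF that] fb])
    then show ?thesis
      using mixture_integrable[OF real_distribution_heat[OF t] f]
        integrable_expect_mixture[OF real_distribution_heat[OF t] f]
      by (simp add: expect_in_L1_def e[OF t])
  qed
  moreover have u: "abs_L1 (expect_at P (Z 0) f) = abs_L1 f"
    "\<And>t. t > 0 \<Longrightarrow> abs_L1 (expect_at P (Z t) f) = evolution t (abs_L1 f)"
    using e0 e abs_L1_mixture_heat[OF _ f] by auto
  moreover note evolution_solves[where \<Lambda>="integral_over ` sets borel", OF _ L1_separated dom, where u="\<lambda>t. abs_L1 (expect_at P (Z t) f)", OF _ _ u]
  ultimately show ?thesis
    using bounded_linear_integral_over by blast
qed

end

lemma same_law_at_random_times:
  assumes markov: "markov_process S P X"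
    and \<tau>: "\<tau> \<in> path_algebra (space S) {0..} W \<rightarrow>\<^sub>M borel" "\<And>\<omega>. \<tau> \<omega> \<ge> (0::real)"
    and \<sigma>: "\<sigma> \<in> path_algebra (space S) {0..} V \<rightarrow>\<^sub>M borel" "\<And>\<omega>. \<sigma> \<omega> \<ge> (0::real)"
    and "independent_processes (P x) X W" "independent_processes (P x) X V"
    and "distr (P x) borel \<tau> = distr (P x) borel \<sigma>"
  shows "same_law (P x) (\<lambda>\<omega>. X (\<tau> \<omega>) \<omega>) (\<lambda>\<omega>. X (\<sigma> \<omega>) \<omega>)"
  unfolding same_law_def
  using distr_at_random_time[OF markov \<tau> assms(6)] distr_at_random_time[OF markov \<sigma> assms(7)] assms(8)
  by simp

theorem corollary3p4:
  fixes S :: "'w measure"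
    and P :: "'a::euclidean_space \<Rightarrow> 'w measure"
    and X :: "real \<Rightarrow> 'w \<Rightarrow> 'a"
    and T :: "real \<Rightarrow> 'a L1 \<Rightarrow> 'a L1"
    and Y D :: "real \<Rightarrow> 'w \<Rightarrow> real"
  assumes "markov_process S P X"
    and "transition_operators P X T"
    and "bounded_C0_semigroup T"
    and "\<And>x. brownian_motion (P x) 2 Y"
    and "\<And>x. independent_processes (P x) X Y"
    and "\<And>x. stable_subordinator (P x) (1/2) D"
    and "\<And>x. independent_processes (P x) X D"
  shows "(\<forall>x. \<forall>t\<ge>0. same_law (P x) (\<lambda>\<omega>. X \<bar>Y t \<omega>\<bar> \<omega>) (\<lambda>\<omega>. X (inverse_process D t \<omega>) \<omega>)) \<and>
    (\<forall>Z \<in> {\<lambda>t \<omega>. X \<bar>Y t \<omega>\<bar> \<omega>, \<lambda>t \<omega>. X (inverse_process D t \<omega>) \<omega>}.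
      \<forall>f. integrable lborel f \<and> abs_L1 f \<in> generator_domain T \<longrightarrow>
        (\<forall>t\<ge>0. expect_in_L1 P (Z t) f) \<and>
        solves_fractional_cauchy (1/2) T (abs_L1 f) (\<lambda>t. abs_L1 (expect_at P (Z t) f)) \<and>
        solves_higher_order T (abs_L1 f) (\<lambda>t. abs_L1 (expect_at P (Z t) f)))"
proof -
  obtain C where C: "c0_semigroup T C" using c0_semigroup_of_bounded[OF assms(3)] .
  have mY: "(\<lambda>\<omega>. \<bar>Y t \<omega>\<bar>) \<in> path_algebra (space S) {0..} Y \<rightarrow>\<^sub>M borel" if "t \<ge> 0" for t
    using measurable_path_algebra[of t "{0..}" Y "space S"] that by simp
  have mD: "inverse_process D t \<in> path_algebra (space S) {0..} D \<rightarrow>\<^sub>M borel" for t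
  proof (rule measurable_inverse_process)
    fix \<omega> assume "\<omega> \<in> space S"
    then show "strict_mono_on {0..} (\<lambda>x. D x \<omega>)"
      using subordinator_mono[OF assms(6)] markov_space[OF assms(1)] by metis
  qed
  have Y0: "AE \<omega> in P x. \<bar>Y 0 \<omega>\<bar> = 0" for x
    using assms(4)[of x] by (simp add: brownian_motion_def)
  note D0 = inverse_process_at_zero[OF assms(6)]
  \<comment> \<open>At \<open>t = 0\<close> there is no density to compare; both random times are
    then 0 almost surely.\<close>
  have same: "distr (P x) borel (\<lambda>\<omega>. \<bar>Y t \<omega>\<bar>) = distr (P x) borel (inverse_process D t)" if "t \<ge> 0" for x t
  proof (cases "t = 0")
    case True
    have "AE \<omega> in P x. \<bar>Y 0 \<omega>\<bar> = inverse_process D 0 \<omega>"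
      using Y0[of x] D0[of x] by eventually_elim simp
    moreover have "Y 0 \<in> borel_measurable (P x)" using assms(4)[of x] by (simp add: brownian_motion_def)
    moreover have "inverse_process D 0 \<in> borel_measurable (P x)" by (rule measurable_inverse_subordinator[OF assms(6)])
    ultimately show ?thesis using True by (intro distr_cong_AE) auto
  next
    case False
    then show ?thesis
      using that distr_abs_brownian[OF assms(4)[of x]] distr_inverse_subordinator[OF assms(6)[of x]] by simp
  qed
  have "same_law (P x) (\<lambda>\<omega>. X \<bar>Y t \<omega>\<bar> \<omega>) (\<lambda>\<omega>. X (inverse_process D t \<omega>) \<omega>)" if "t \<ge> 0" for x t
    by (rule same_law_at_random_times[OF assms(1) mY[OF that] abs_ge_zero mD inverse_process_nonneg assms(5) assms(7) same[OF that]])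
  moreover note random_time_solves[OF assms(1,2) C mY abs_ge_zero assms(5) Y0 distr_abs_brownian[OF assms(4)]]
    and random_time_solves[OF assms(1,2) C mD inverse_process_nonneg assms(7) D0 distr_inverse_subordinator[OF assms(6)]]
  ultimately show ?thesis by auto
qed

end
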